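(* (i) Let $\lambda\in P^e_+$. Then $W(\lambda)$ is an integrable $\mathbf U^e$-module. (ii) Let $\boldsymbol\pi=(\pi_1,\dots,\pi_n)$ be an $n$-tuple of polynomials in $\mathbb C[u]$ with constant term $1$. Then $W(\boldsymbol\pi)$ is a finite-dimensional $\mathbf U$-module.
   Context: Let $\mathfrak g$ be a finite-dimensional complex simple Lie algebra of rank $n$, $\mathfrak h$ a Cartan subalgebra, $R$ the roots, $I=\{1,\dots,n\}$, $\alpha_i$ ($i\in I$) simple roots, $R^+$ the positive roots, $\theta$ the highest root. For $\alpha\in R^+$ fix nonzero root vectors $x_\alpha^\pm\in\mathfrak g_{\pm\alpha}$ and $h_\alpha\in\mathfrak h$ with $[x_\alpha^+,x_\alpha^-]=h_\alpha$, $[h_\alpha,x_\alpha^\pm]=\pm2x_\alpha^\pm$; write $x_i^\pm=x_{\alpha_i}^\pm$, $h_i=h_{\alpha_i}$. $L(\mathfrak g)=\mathfrak g\otimes\mathbb C[t,t^{-1}]$ is the loop algebra, $L^e(\mathfrak g)=L(\mathfrak g)\oplus\mathbb Cd$ with $[d,x\otimes t^r]=r\,x\otimes t^r$. Put $\mathbf U=U(L(\mathfrak g))$, $\mathbf U^e=U(L^e(\mathfrak g))$, $\mathfrak h^e=\mathfrak h\oplus\mathbb Cd$. For $x\in\mathfrak g$ write $x_m=x\otimes t^m$; so $x^\pm_{\beta,m}=x_\beta^\pm\otimes t^m$, $h_{\beta,m}=h_\beta\otimes t^m$, $x^\pm_{i,m}=x^\pm_{\alpha_i,m}$. $P_+^e$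 is the set of $\lambda\in(\mathfrak h^e)^*$ with $\lambda(h_i)\in\mathbb Z_{\ge0}$ for all $i\in I$ and $\lambda(d)\in\mathbb Z$. $\mathbf U(0)\subset\mathbf U$ is the (commutative) subalgebra generated by all $h_{\alpha,m}$, $\alpha\in R^+$, $m\ne0$. Define $\Lambda_{i,\pm m}\in\mathbf U(0)$ ($m\ge0$) by $\Lambda_i^\pm(u)=\sum_{m\ge0}\Lambda_{i,\pm m}u^m=\exp\left(-\sum_{k\ge1}\frac{h_{\alpha_i,\pm k}}{k}u^k\right)$, and put $\tilde X_i^-(u)=\sum_{m\in\mathbb Z}x^-_{i,m}u^{m+1}$, $X^-_{i,0}(u)=\sum_{m\ge0}x^-_{i,m}u^{m+1}$. For a series $f$ in $u$, $f_m$ denotes the coefficient of $u^m$. Integrable module: a $\mathbf U^e$-module $V$ is integrable if $V=\bigoplus_{\mu\in(\mathfrak h^e)^*}V_\mu$, where $V_\mu$ is the $\mathfrak h^e$-weight space, and the elements $e_i^\pm=x_i^\pm\otimes1$ ($i\in I$), $e_0^\pm=x_\theta^\mp\otimes t^{\pm1}$ act locally nilpotently on $V$. Definition of $W(\lambda)$, $\lambda\in P_+^e$: $W(\lambda)=\mathbf U^e/\tilde I^e_\lambda$, where $\tilde I_\lambda^e$ is the left ideal generated by: $x^+_{i,m}$ ($i\in I,m\in\mathbb Z$); $d-\lambda(d)$; $h-\lambda(h)$ ($h\in\mathfrak h$); $\Lambda_{i,m}$ ($|m|>\lambda(h_i)$); $\Lambda_{i,\lambda(h_i)}\Lambda_{i,-m}-\Lambda_{i,\lambda(h_i)-m}$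 ($1\le m\le\lambda(h_i)$); $(\tilde X_i^-(u)\Lambda_i^+(u))_m f$ ($m\in\mathbb Z$, $f\in\mathbf U(0)$), understood as $\sum_{k=0}^{\lambda(h_i)}x^-_{i,m-1-k}\Lambda_{i,k}f$; and $(X^-_{i,0}(u)^r\Lambda_i^+(u))_mf$ ($r\ge1$, $|m|>\lambda(h_i)$, $f\in\mathbf U(0)$); here $i\in I$ throughout. As a $\mathbf U$-module, $W(\lambda)=\mathbf U/\tilde I_\lambda$, where $\tilde I_\lambda$ is the left ideal of $\mathbf U$ with the same generators except $d-\lambda(d)$. Since $\tilde I_\lambda\mathbf U(0)\subset\tilde I_\lambda$, $W(\lambda)$ is also a right $\mathbf U(0)$-module. Definition of $W(\boldsymbol\pi)$: put $\pi_i^+=\pi_i$ and let $\pi_i^-(u)$ be $u^{\deg\pi_i}\pi_i(u^{-1})$ divided by its constant term. Let $\mathbb C_{\boldsymbol\pi}$ be the one-dimensional $\mathbf U(0)$-module $\mathbf U(0)/I_{\boldsymbol\pi}(0)$, with $I_{\boldsymbol\pi}(0)$ the maximal ideal generated by the coefficients of $\Lambda_i^\pm(u)-\pi_i^\pm(u)$, $i\in I$. Let $\lambda_{\boldsymbol\pi}\in P_+^e$ satisfy $\lambda_{\boldsymbol\pi}(h_i)=\deg\pi_i$, with any integer value of $\lambda_{\boldsymbol\pi}(d)$ (the $\mathbf U$-module below does not depend on it). Then $W(\boldsymbol\pi)=W(\lambda_{\boldsymbol\pi})\otimes_{\mathbf U(0)}\mathbb C_{\boldsymbol\pi}$, a left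 $\mathbf U$-module. *)

theory Defs
  imports
    Complex_Main
    "HOL-Library.Poly_Mapping"
    "HOL-Computational_Algebra.Polynomial"
    "HOL-Computational_Algebra.Formal_Power_Series"
    "HOL-Algebra.Module"
begin

section \<open>Complex vector spaces, algebras and Lie algebras\<close>

class complex_vector = ab_group_add +
  fixes scaleC :: "complex \<Rightarrow> 'a \<Rightarrow> 'a"  (infixr \<open>*\<^sub>C\<close> 75)
  assumes scaleC_add_right: "a *\<^sub>C (x + y) = a *\<^sub>C x + a *\<^sub>C y"
    and scaleC_add_left: "(a + b) *\<^sub>C x = a *\<^sub>C x + b *\<^sub>C x"
    and scaleC_scaleC: "a *\<^sub>C b *\<^sub>C x = (a * b) *\<^sub>C x"
    and scaleC_one: "1 *\<^sub>C x = x"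

global_interpretation complex_vector: vector_space "scaleC :: complex \<Rightarrow> 'a \<Rightarrow> 'a::complex_vector"
  by unfold_locales (fact scaleC_add_right scaleC_add_left scaleC_scaleC scaleC_one)+

class complex_algebra_1 = complex_vector + ring_1 +
  assumes mult_scaleC_left: "(a *\<^sub>C x) * y = a *\<^sub>C (x * y)"
    and mult_scaleC_right: "x * (a *\<^sub>C y) = a *\<^sub>C (x * y)"

definition of_complex :: "complex \<Rightarrow> 'a::complex_algebra_1"
  where "of_complex c = c *\<^sub>C 1"

class complex_lie_algebra = complex_vector +
  fixes lie :: "'a \<Rightarrow> 'a \<Rightarrow> 'a"
  assumes lie_add_left: "lie (x + y) z = lie x z + lie y z"
    and lie_add_right: "lie x (y + z) = lie x y + lie x z"
    and lie_scaleC_left: "lie (c *\<^sub>C x) y = c *\<^sub>C lie x y"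
    and lie_scaleC_right: "lie x (c *\<^sub>C y) = c *\<^sub>C lie x y"
    and lie_self: "lie x x = 0"
    and jacobi: "lie x (lie y z) + lie y (lie z x) + lie z (lie x y) = 0"
begin

lemma lie_zero_left [simp]: "lie 0 x = 0"
  using lie_add_left[of 0 0 x] by simp

lemma lie_zero_right [simp]: "lie x 0 = 0"
  using lie_add_right[of x 0 0] by simp

lemma lie_anticomm: "lie x y = - lie y x"
proof -
  have "lie x y + lie y x = lie (x + y) (x + y)"
    by (simp only: lie_add_left lie_add_right) (simp add: lie_self add.commute)
  also have "\<dots> = 0"
    by (rule lie_self)
  finally show ?thesis
    by (simp only: eq_neg_iff_add_eq_0)
qed

lemma lie_minus_left: "lie (- x) y = - lie x y"
proof -
  have "lie (- x) y + lie x y = 0"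
    using lie_add_left[of "- x" x y] by simp
  then show ?thesis by (simp add: eq_neg_iff_add_eq_0)
qed

lemma lie_minus_right: "lie x (- y) = - lie x y"
  by (metis lie_anticomm lie_minus_left)

lemma lie_sum_left: "lie (sum f A) y = (\<Sum>a\<in>A. lie (f a) y)"
  by (induction A rule: infinite_finite_induct) (simp_all add: lie_add_left)

lemma lie_sum_right: "lie y (sum f A) = (\<Sum>a\<in>A. lie y (f a))"
  by (induction A rule: infinite_finite_induct) (simp_all add: lie_add_right)

end

definition lie_subalgebra :: "'g::complex_lie_algebra set \<Rightarrow> bool"
  where "lie_subalgebra H \<longleftrightarrow> complex_vector.subspace H \<and> (\<forall>x\<in>H. \<forall>y\<in>H. lie x y \<in> H)"

definition lie_ideal :: "'g::complex_lie_algebra set \<Rightarrow> bool"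
  where "lie_ideal J \<longleftrightarrow> complex_vector.subspace J \<and> (\<forall>x. \<forall>y\<in>J. lie x y \<in> J)"

definition finite_dimensional_lie :: "'g::complex_lie_algebra itself \<Rightarrow> bool"
  where "finite_dimensional_lie _ \<longleftrightarrow> (\<exists>B :: 'g set. finite B \<and> complex_vector.span B = UNIV)"

definition simple_lie :: "'g::complex_lie_algebra itself \<Rightarrow> bool"
  where "simple_lie _ \<longleftrightarrow>
    (\<exists>x y :: 'g. lie x y \<noteq> 0) \<and> (\<forall>J :: 'g set. lie_ideal J \<longrightarrow> J = {0} \<or> J = UNIV)"

fun lower_central_series :: "'g::complex_lie_algebra set \<Rightarrow> nat \<Rightarrow> 'g set"
  where "lower_central_series H 0 = H"
  | "lower_central_series H (Suc k) =
      complex_vector.span {lie x y | x y. x \<in> H \<and> y \<in> lower_central_series H k}"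

definition cartan_subalgebra :: "'g::complex_lie_algebra set \<Rightarrow> bool"
  where "cartan_subalgebra H \<longleftrightarrow>
    lie_subalgebra H \<and> (\<exists>k. lower_central_series H k = {0}) \<and>
    {x. \<forall>h\<in>H. lie x h \<in> H} = H"

text \<open>The linear dual of a subspace \<open>H\<close>. To have equality of functionals on \<open>H\<close> as equality of
  functions, they take the value 0 outside \<open>H\<close>.\<close>

definition dual :: "'a::complex_vector set \<Rightarrow> ('a \<Rightarrow> complex) set"
  where "dual H = {f. (\<forall>x\<in>H. \<forall>y\<in>H. f (x + y) = f x + f y) \<and>
    (\<forall>c. \<forall>x\<in>H. f (c *\<^sub>C x) = c * f x) \<and> (\<forall>x. x \<notin> H \<longrightarrow> f x = 0)}"

definition root_space :: "'g::complex_lie_algebra set \<Rightarrow> ('g \<Rightarrow> complex) \<Rightarrow> 'g set"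
  where "root_space H \<alpha> = {x. \<forall>h\<in>H. lie h x = \<alpha> h *\<^sub>C x}"

definition roots :: "'g::complex_lie_algebra set \<Rightarrow> ('g \<Rightarrow> complex) set"
  where "roots H = {\<alpha> \<in> dual H. \<alpha> \<noteq> (\<lambda>_. 0) \<and> root_space H \<alpha> \<noteq> {0}}"

text \<open>A choice of Cartan subalgebra, simple roots (indexed by \<open>{1..rank}\<close>), highest root, root
  vectors for the positive roots and their coroots.\<close>

record 'g cartan_data =
  cartan :: "'g set"
  rank :: nat
  simple_root :: "nat \<Rightarrow> 'g \<Rightarrow> complex"
  highest_root :: "'g \<Rightarrow> complex"
  xplus :: "('g \<Rightarrow> complex) \<Rightarrow> 'g"
  xminus :: "('g \<Rightarrow> complex) \<Rightarrow> 'g"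
  coroot :: "('g \<Rightarrow> complex) \<Rightarrow> 'g"

abbreviation index_set :: "'g cartan_data \<Rightarrow> nat set"
  where "index_set D \<equiv> {1..rank D}"

definition positive_cone :: "'g cartan_data \<Rightarrow> ('g \<Rightarrow> complex) set"
  where "positive_cone D = {\<beta>. \<exists>c :: nat \<Rightarrow> nat. \<beta> = (\<lambda>h. \<Sum>i\<in>index_set D. of_nat (c i) * simple_root D i h)}"

definition positive_roots :: "'g::complex_lie_algebra cartan_data \<Rightarrow> ('g \<Rightarrow> complex) set"
  where "positive_roots D = roots (cartan D) \<inter> positive_cone D"

definition simple_system :: "'g::complex_lie_algebra cartan_data \<Rightarrow> bool"
  where "simple_system D \<longleftrightarrow>
    (\<forall>i\<in>index_set D. simple_root D i \<in> roots (cartan D)) \<and>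
    (\<forall>c :: nat \<Rightarrow> complex. (\<forall>h\<in>cartan D. (\<Sum>i\<in>index_set D. c i * simple_root D i h) = 0) \<longrightarrow>
      (\<forall>i\<in>index_set D. c i = 0)) \<and>
    (\<forall>\<alpha>\<in>roots (cartan D). \<alpha> \<in> positive_cone D \<or> (\<lambda>h. - \<alpha> h) \<in> positive_cone D)"

definition is_cartan_data :: "'g::complex_lie_algebra cartan_data \<Rightarrow> bool"
  where "is_cartan_data D \<longleftrightarrow>
    cartan_subalgebra (cartan D) \<and>
    rank D = complex_vector.dim (cartan D) \<and>
    simple_system D \<and>
    highest_root D \<in> roots (cartan D) \<and>
    (\<forall>\<beta>\<in>roots (cartan D). (\<lambda>h. highest_root D h - \<beta> h) \<in> positive_cone D) \<and>
    (\<forall>\<alpha>\<in>positive_roots D.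
      xplus D \<alpha> \<in> root_space (cartan D) \<alpha> - {0} \<and>
      xminus D \<alpha> \<in> root_space (cartan D) (\<lambda>h. - \<alpha> h) - {0} \<and>
      coroot D \<alpha> \<in> cartan D \<and>
      lie (xplus D \<alpha>) (xminus D \<alpha>) = coroot D \<alpha> \<and>
      lie (coroot D \<alpha>) (xplus D \<alpha>) = 2 *\<^sub>C xplus D \<alpha> \<and>
      lie (coroot D \<alpha>) (xminus D \<alpha>) = (- 2) *\<^sub>C xminus D \<alpha>)"


section \<open>The loop algebra and its extension by the degree derivation\<close>

instantiation complex :: complex_vector
begin
definition scaleC_complex :: "complex \<Rightarrow> complex \<Rightarrow> complex" where "scaleC_complex = (*)"
instance by standard (simp_all add: scaleC_complex_def algebra_simps)
end

instantiation poly_mapping :: (type, complex_vector) complex_vector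
begin

definition scaleC_poly_mapping :: "complex \<Rightarrow> ('a \<Rightarrow>\<^sub>0 'b) \<Rightarrow> ('a \<Rightarrow>\<^sub>0 'b)"
  where "scaleC_poly_mapping c = Poly_Mapping.map (scaleC c)"

lemma lookup_scaleC [simp]: "Poly_Mapping.lookup (c *\<^sub>C f) k = c *\<^sub>C Poly_Mapping.lookup f k"
  by (simp add: scaleC_poly_mapping_def Poly_Mapping.map.rep_eq when_def)

instance
  by standard (auto intro!: poly_mapping_eqI
      simp: lookup_add scaleC_add_right scaleC_add_left scaleC_scaleC scaleC_one)

end

lemma scaleC_single: "c *\<^sub>C Poly_Mapping.single k x = Poly_Mapping.single k (c *\<^sub>C x)"
  by (rule poly_mapping_eqI) (simp add: lookup_single when_def)

lemma poly_mapping_additive_induct [case_names single add]: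
  assumes single: "\<And>k x. P (Poly_Mapping.single k x)" and add: "\<And>f g. P f \<Longrightarrow> P g \<Longrightarrow> P (f + g)"
  shows "P (f :: 'a \<Rightarrow>\<^sub>0 'b::comm_monoid_add)"
proof -
  have "P (\<Sum>k\<in>A. Poly_Mapping.single k (g k))" if "finite A" for A and g :: "'a \<Rightarrow> 'b"
    using that
  proof (induction A rule: finite_induct)
    case empty
    then show ?case using single[of undefined 0] by simp
  next
    case (insert x A)
    then show ?case by (simp add: add single)
  qed
  moreover have "f = (\<Sum>k\<in>Poly_Mapping.keys f. Poly_Mapping.single k (Poly_Mapping.lookup f k))"
    by (rule poly_mapping_eqI) (auto simp: lookup_sum lookup_single when_def sum.delta in_keys_iff)
  ultimately show ?thesis
    by (metis finite_keys)
qed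

text \<open>A finitely supported map \<open>f :: 'a \<Rightarrow>\<^sub>0 'b\<close> stands for
  \<open>\<Sum>k. f k \<otimes> t^k\<close> in the tensor product of \<open>'b\<close> with the monoid algebra of \<open>'a\<close>; for
  \<open>'a = int\<close> this is the tensor product with the Laurent polynomials.\<close>

instantiation poly_mapping :: (comm_monoid_add, complex_lie_algebra) complex_lie_algebra
begin

definition lie_poly_mapping :: "('a \<Rightarrow>\<^sub>0 'b) \<Rightarrow> ('a \<Rightarrow>\<^sub>0 'b) \<Rightarrow> ('a \<Rightarrow>\<^sub>0 'b)"
  where "lie_poly_mapping f g = (\<Sum>i\<in>Poly_Mapping.keys f. \<Sum>j\<in>Poly_Mapping.keys g.
    Poly_Mapping.single (i + j) (lie (Poly_Mapping.lookup f i) (Poly_Mapping.lookup g j)))"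

lemma lie_poly_mapping_superset:
  assumes "finite A" "Poly_Mapping.keys f \<subseteq> A" "finite B" "Poly_Mapping.keys g \<subseteq> B"
  shows "lie f g = (\<Sum>i\<in>A. \<Sum>j\<in>B.
    Poly_Mapping.single (i + j) (lie (Poly_Mapping.lookup f i) (Poly_Mapping.lookup g j)))"
proof -
  have "lie f g = (\<Sum>i\<in>Poly_Mapping.keys f. \<Sum>j\<in>B.
    Poly_Mapping.single (i + j) (lie (Poly_Mapping.lookup f i) (Poly_Mapping.lookup g j)))"
    unfolding lie_poly_mapping_def
    by (intro sum.cong refl sum.mono_neutral_left assms) (simp add: in_keys_iff)
  also have "\<dots> = (\<Sum>i\<in>A. \<Sum>j\<in>B.
    Poly_Mapping.single (i + j) (lie (Poly_Mapping.lookup f i) (Poly_Mapping.lookup g j)))"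
    by (intro sum.mono_neutral_left assms) (simp add: in_keys_iff)
  finally show ?thesis .
qed

lemma lie_single_single:
  "lie (Poly_Mapping.single i x) (Poly_Mapping.single j y) = Poly_Mapping.single (i + j) (lie x y)"
  by (subst lie_poly_mapping_superset[of "{i}" _ "{j}"]) auto

lemma lie_poly_mapping_add_left: "lie (f + g) h = lie f h + lie g h" for f g h :: "'a \<Rightarrow>\<^sub>0 'b"
proof -
  let ?A = "Poly_Mapping.keys f \<union> Poly_Mapping.keys g"
  have "Poly_Mapping.keys (f + g) \<subseteq> ?A" by (rule Poly_Mapping.keys_add)
  then show ?thesis
    by (subst (1 2 3) lie_poly_mapping_superset[of ?A _ "Poly_Mapping.keys h"])
      (auto simp: lookup_add lie_add_left single_add sum.distrib)
qed

lemma lie_poly_mapping_add_right: "lie h (f + g) = lie h f + lie h g" for f g h :: "'a \<Rightarrow>\<^sub>0 'b"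
proof -
  let ?A = "Poly_Mapping.keys f \<union> Poly_Mapping.keys g"
  have "Poly_Mapping.keys (f + g) \<subseteq> ?A" by (rule Poly_Mapping.keys_add)
  then show ?thesis
    by (subst (1 2 3) lie_poly_mapping_superset[of "Poly_Mapping.keys h" _ ?A])
      (auto simp: lookup_add lie_add_right single_add sum.distrib)
qed

instance
proof
  fix x y z :: "'a \<Rightarrow>\<^sub>0 'b" and c :: complex
  show "lie (x + y) z = lie x z + lie y z"
    by (rule lie_poly_mapping_add_left)
  show "lie x (y + z) = lie x y + lie x z"
    by (rule lie_poly_mapping_add_right)
  show "lie (c *\<^sub>C x) y = c *\<^sub>C lie x y"
  proof (induction x rule: poly_mapping_additive_induct)
    case (single k a)
    show ?case
      by (induction y rule: poly_mapping_additive_induct)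
        (simp_all add: lie_single_single scaleC_single lie_scaleC_left lie_poly_mapping_add_right
          scaleC_add_right)
  qed (simp add: scaleC_add_right lie_poly_mapping_add_left)
  show "lie x (c *\<^sub>C y) = c *\<^sub>C lie x y"
  proof (induction x rule: poly_mapping_additive_induct)
    case (single k a)
    show ?case
      by (induction y rule: poly_mapping_additive_induct)
        (simp_all add: lie_single_single scaleC_single lie_scaleC_right lie_poly_mapping_add_right
          scaleC_add_right)
  qed (simp add: scaleC_add_right lie_poly_mapping_add_left)
  have anti: "lie f g + lie g f = 0" for f g :: "'a \<Rightarrow>\<^sub>0 'b"
  proof (induction f rule: poly_mapping_additive_induct)
    case (single k a)
    show ?case
    proof (induction g rule: poly_mapping_additive_induct)
      case (single j b)
      have "lie a b + lie b a = 0" using lie_anticomm[of a b] by simp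
      then show ?case
        by (simp add: lie_single_single add.commute[of j k] flip: single_add)
    next
      case (add f g)
      then show ?case
        by (simp add: lie_poly_mapping_add_left lie_poly_mapping_add_right add_eq_0_iff)
    qed
  next
    case (add f f')
    then show ?case
      by (simp add: lie_poly_mapping_add_left lie_poly_mapping_add_right add_eq_0_iff)
  qed
  show "lie x x = 0"
  proof (induction x rule: poly_mapping_additive_induct)
    case (single k a)
    then show ?case by (simp add: lie_single_single lie_self)
  next
    case (add f g)
    then show ?case
      using anti[of g f] by (simp add: lie_poly_mapping_add_left lie_poly_mapping_add_right)
  qed
  show "lie x (lie y z) + lie y (lie z x) + lie z (lie x y) = 0"
  proof (induction x rule: poly_mapping_additive_induct)
    case x: (single i a)
    show ?case
    proof (induction y rule: poly_mapping_additive_induct)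
      case y: (single j b)
      show ?case
      proof (induction z rule: poly_mapping_additive_induct)
        case (single k c)
        then show ?case
          using jacobi[of a b c]
          by (simp add: lie_single_single add.assoc add.commute add.left_commute flip: single_add)
      next
        case (add f g)
        have "lie (Poly_Mapping.single i a) (lie (Poly_Mapping.single j b) (f + g)) + lie (Poly_Mapping.single j b) (lie (f + g) (Poly_Mapping.single i a)) + lie (f + g) (lie (Poly_Mapping.single i a) (Poly_Mapping.single j b)) =
            (lie (Poly_Mapping.single i a) (lie (Poly_Mapping.single j b) f) + lie (Poly_Mapping.single j b) (lie f (Poly_Mapping.single i a)) + lie f (lie (Poly_Mapping.single i a) (Poly_Mapping.single j b))) +
            (lie (Poly_Mapping.single i a) (lie (Poly_Mapping.single j b) g) + lie (Poly_Mapping.single j b) (lie g (Poly_Mapping.single i a)) + lie g (lie (Poly_Mapping.single i a) (Poly_Mapping.single j b)))"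
          by (simp only: lie_poly_mapping_add_left lie_poly_mapping_add_right add_ac)
        with add show ?case by simp
      qed
    next
      case (add f g)
      have "lie (Poly_Mapping.single i a) (lie (f + g) z) + lie (f + g) (lie z (Poly_Mapping.single i a)) + lie z (lie (Poly_Mapping.single i a) (f + g)) =
          (lie (Poly_Mapping.single i a) (lie f z) + lie f (lie z (Poly_Mapping.single i a)) + lie z (lie (Poly_Mapping.single i a) f)) +
          (lie (Poly_Mapping.single i a) (lie g z) + lie g (lie z (Poly_Mapping.single i a)) + lie z (lie (Poly_Mapping.single i a) g))"
        by (simp only: lie_poly_mapping_add_left lie_poly_mapping_add_right add_ac)
      with add show ?case by simp
    qed
  next
    case (add f g)
    have "lie (f + g) (lie y z) + lie y (lie z (f + g)) + lie z (lie (f + g) y) =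
        (lie f (lie y z) + lie y (lie z f) + lie z (lie f y)) +
        (lie g (lie y z) + lie y (lie z g) + lie z (lie g y))"
      by (simp only: lie_poly_mapping_add_left lie_poly_mapping_add_right add_ac)
    with add show ?case by simp
  qed
qed

end

type_synonym 'g loop = "int \<Rightarrow>\<^sub>0 'g"

definition loop_elt :: "'g::zero \<Rightarrow> int \<Rightarrow> 'g loop"
  where "loop_elt x m = Poly_Mapping.single m x"

lift_definition loop_deriv :: "'g::complex_vector loop \<Rightarrow> 'g loop"
  is "\<lambda>f r. of_int r *\<^sub>C f r"
  by (erule finite_subset[rotated]) auto


lemma loop_deriv_add: "loop_deriv (f + g) = loop_deriv f + loop_deriv g"
  by (rule poly_mapping_eqI) (simp add: loop_deriv.rep_eq lookup_add scaleC_add_right)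

lemma loop_deriv_minus: "loop_deriv (- f) = - loop_deriv f"
  by (rule poly_mapping_eqI) (simp add: loop_deriv.rep_eq)

lemma loop_deriv_diff: "loop_deriv (f - g) = loop_deriv f - loop_deriv g"
  using loop_deriv_add[of f "- g"] by (simp add: loop_deriv_minus)

lemma loop_deriv_scaleC: "loop_deriv (c *\<^sub>C f) = c *\<^sub>C loop_deriv f"
  by (rule poly_mapping_eqI) (simp add: loop_deriv.rep_eq scaleC_scaleC mult.commute)

lemma loop_deriv_single: "loop_deriv (Poly_Mapping.single m x) = Poly_Mapping.single m (of_int m *\<^sub>C x)"
  by (rule poly_mapping_eqI) (simp add: loop_deriv.rep_eq lookup_single when_def)

lemma loop_deriv_lie: "loop_deriv (lie f g) = lie (loop_deriv f) g + lie f (loop_deriv g)"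
proof (induction f rule: poly_mapping_additive_induct)
  case (single i a)
  show ?case
    by (induction g rule: poly_mapping_additive_induct)
      (simp_all add: lie_single_single loop_deriv_single lie_scaleC_left lie_scaleC_right
        scaleC_add_left lie_add_right loop_deriv_add flip: single_add)
qed (simp_all add: lie_add_left loop_deriv_add)

text \<open>The pair \<open>(f, a)\<close> stands for \<open>f + a d\<close>, where \<open>d\<close> is the degree derivation.\<close>

typedef (overloaded) 'g ext_loop = "UNIV :: ('g::complex_lie_algebra loop \<times> complex) set"
  by simp

setup_lifting type_definition_ext_loop

instantiation ext_loop :: (complex_lie_algebra) complex_lie_algebra
begin

lift_definition zero_ext_loop :: "'a ext_loop" is "(0, 0)" .

lift_definition plus_ext_loop :: "'a ext_loop \<Rightarrow> 'a ext_loop \<Rightarrow> 'a ext_loop"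
  is "\<lambda>(f, a) (g, b). (f + g, a + b)" .

lift_definition minus_ext_loop :: "'a ext_loop \<Rightarrow> 'a ext_loop \<Rightarrow> 'a ext_loop"
  is "\<lambda>(f, a) (g, b). (f - g, a - b)" .

lift_definition uminus_ext_loop :: "'a ext_loop \<Rightarrow> 'a ext_loop"
  is "\<lambda>(f, a). (- f, - a)" .

lift_definition scaleC_ext_loop :: "complex \<Rightarrow> 'a ext_loop \<Rightarrow> 'a ext_loop"
  is "\<lambda>c (f, a). (c *\<^sub>C f, c * a)" .

lift_definition lie_ext_loop :: "'a ext_loop \<Rightarrow> 'a ext_loop \<Rightarrow> 'a ext_loop"
  is "\<lambda>(f, a) (g, b). (lie f g + a *\<^sub>C loop_deriv g - b *\<^sub>C loop_deriv f, 0)" .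

instance
proof
  fix x y z :: "'a ext_loop" and c b :: complex
  show "x + y + z = x + (y + z)" "x + y = y + x" "0 + x = x" "- x + x = 0" "x - y = x + - y"
    by (transfer; auto)+
  show "c *\<^sub>C (x + y) = c *\<^sub>C x + c *\<^sub>C y" "(c + b) *\<^sub>C x = c *\<^sub>C x + b *\<^sub>C x"
    "c *\<^sub>C b *\<^sub>C x = (c * b) *\<^sub>C x" "1 *\<^sub>C x = x"
    by (transfer; auto simp: algebra_simps scaleC_add_right scaleC_add_left scaleC_scaleC scaleC_one)+
  show "lie (x + y) z = lie x z + lie y z"
    by transfer (auto simp: lie_add_left loop_deriv_add scaleC_add_left scaleC_add_right)
  show "lie x (y + z) = lie x y + lie x z"
    by transfer (auto simp: lie_add_right loop_deriv_add scaleC_add_left scaleC_add_right)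
  show "lie (c *\<^sub>C x) y = c *\<^sub>C lie x y" "lie x (c *\<^sub>C y) = c *\<^sub>C lie x y"
    by (transfer; auto simp: lie_scaleC_left lie_scaleC_right loop_deriv_scaleC
        complex_vector.scale_right_diff_distrib scaleC_add_right scaleC_scaleC mult.commute)+
  show "lie x x = 0"
    by transfer (auto simp: lie_self)
  show "lie x (lie y z) + lie y (lie z x) + lie z (lie x y) = 0"
  proof (transfer, clarsimp)
    fix f g h :: "'a loop" and a b c :: complex
    have diff: "lie u (v - w) = lie u v - lie u w" for u v w :: "'a loop"
      using lie_add_right[of u v "- w"] by (simp add: lie_minus_right)
    have "lie (loop_deriv f) g = - lie g (loop_deriv f)"
      "lie (loop_deriv g) h = - lie h (loop_deriv g)"
      "lie (loop_deriv h) f = - lie f (loop_deriv h)"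
      by (rule lie_anticomm)+
    moreover have "lie h (lie f g) = - lie f (lie g h) - lie g (lie h f)"
      using jacobi[of f g h] by (simp add: algebra_simps eq_neg_iff_add_eq_0)
    ultimately show
      "lie f (lie g h + b *\<^sub>C loop_deriv h - c *\<^sub>C loop_deriv g) +
         a *\<^sub>C loop_deriv (lie g h + b *\<^sub>C loop_deriv h - c *\<^sub>C loop_deriv g) +
       (lie g (lie h f + c *\<^sub>C loop_deriv f - a *\<^sub>C loop_deriv h) +
         b *\<^sub>C loop_deriv (lie h f + c *\<^sub>C loop_deriv f - a *\<^sub>C loop_deriv h)) +
       (lie h (lie f g + a *\<^sub>C loop_deriv g - b *\<^sub>C loop_deriv f) +
         c *\<^sub>C loop_deriv (lie f g + a *\<^sub>C loop_deriv g - b *\<^sub>C loop_deriv f)) = 0"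
      by (simp add: diff loop_deriv_add loop_deriv_diff loop_deriv_scaleC loop_deriv_lie
          lie_scaleC_right lie_add_right complex_vector.scale_right_diff_distrib scaleC_add_right
          scaleC_scaleC mult.commute)
  qed
qed

end

lift_definition ext_elt :: "'g::complex_lie_algebra \<Rightarrow> int \<Rightarrow> 'g ext_loop"
  is "\<lambda>x m. (loop_elt x m, 0)" .

lift_definition deg_d :: "'g::complex_lie_algebra ext_loop" is "(0, 1)" .

definition ext_cartan :: "'g::complex_lie_algebra cartan_data \<Rightarrow> 'g ext_loop set"
  where "ext_cartan D = {ext_elt h 0 + c *\<^sub>C deg_d | h c. h \<in> cartan D}"


section \<open>Universal enveloping algebras\<close>

definition two_sided_ideal :: "'a::ring_1 set \<Rightarrow> bool"
  where "two_sided_ideal J \<longleftrightarrow>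
    0 \<in> J \<and> (\<forall>x\<in>J. \<forall>y\<in>J. x + y \<in> J) \<and> (\<forall>r. \<forall>x\<in>J. r * x \<in> J \<and> x * r \<in> J)"

text \<open>The free associative algebra on the set \<open>'l\<close> is the monoid algebra of the free monoid of
  words over \<open>'l\<close>. The enveloping algebra is its quotient by the relations that make the map
  from \<open>'l\<close> linear and turn the bracket into the commutator.\<close>

datatype 'l word = Word (letters: "'l list")

instantiation word :: (type) monoid_add
begin
definition "0 = Word []"
definition "v + w = Word (letters v @ letters w)"
instance by standard (simp_all add: zero_word_def plus_word_def)
end

type_synonym 'l free_algebra = "'l word \<Rightarrow>\<^sub>0 complex"

definition free_gen :: "'l \<Rightarrow> 'l free_algebra"
  where "free_gen x = Poly_Mapping.single (Word [x]) 1"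

lemma scaleC_free_algebra: "c *\<^sub>C p = Poly_Mapping.single 0 c * p" for p :: "'l free_algebra"
proof (induction p rule: poly_mapping_additive_induct)
  case (single k x)
  then show ?case by (simp add: scaleC_single mult_single scaleC_complex_def)
qed (simp add: scaleC_add_right distrib_left)

lemma single_0_central: "Poly_Mapping.single 0 c * p = p * Poly_Mapping.single 0 c" for p :: "'l free_algebra"
proof (induction p rule: poly_mapping_additive_induct)
  case (single k x)
  then show ?case by (simp add: mult_single mult.commute)
qed (simp add: distrib_left distrib_right)

definition uea_relations :: "'l::complex_lie_algebra free_algebra set"
  where "uea_relations =
    {free_gen (x + y) - free_gen x - free_gen y | x y. True} \<union>
    {free_gen (c *\<^sub>C x) - c *\<^sub>C free_gen x | c x. True} \<union>
    {free_gen x * free_gen y - free_gen y * free_gen x - free_gen (lie x y) | x y. True}"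

definition uea_ideal :: "'l::complex_lie_algebra free_algebra set"
  where "uea_ideal = two_sided_ideal hull uea_relations"

lemma two_sided_ideal_uea_ideal: "two_sided_ideal uea_ideal"
  unfolding uea_ideal_def by (rule hull_in) (auto simp: two_sided_ideal_def)

lemma uea_ideal_zero: "0 \<in> uea_ideal"
  and uea_ideal_add: "p \<in> uea_ideal \<Longrightarrow> q \<in> uea_ideal \<Longrightarrow> p + q \<in> uea_ideal"
  and uea_ideal_mult_left: "p \<in> uea_ideal \<Longrightarrow> r * p \<in> uea_ideal"
  and uea_ideal_mult_right: "p \<in> uea_ideal \<Longrightarrow> p * r \<in> uea_ideal"
  using two_sided_ideal_uea_ideal by (auto simp: two_sided_ideal_def)

lemma uea_ideal_minus: "p \<in> uea_ideal \<Longrightarrow> - p \<in> uea_ideal"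
  using uea_ideal_mult_left[of p "- 1"] by simp

quotient_type (overloaded) 'l uea = "'l::complex_lie_algebra free_algebra" / "\<lambda>p q. p - q \<in> uea_ideal"
proof (rule equivpI)
  show "reflp (\<lambda>p q :: 'l free_algebra. p - q \<in> uea_ideal)"
    by (simp add: reflp_def uea_ideal_zero)
  show "symp (\<lambda>p q :: 'l free_algebra. p - q \<in> uea_ideal)"
    by (auto simp: symp_def dest: uea_ideal_minus)
  show "transp (\<lambda>p q :: 'l free_algebra. p - q \<in> uea_ideal)"
    by (auto simp: transp_def dest: uea_ideal_add)
qed

instantiation uea :: (complex_lie_algebra) "{ring, one, complex_vector}"
begin

lift_definition zero_uea :: "'a uea" is 0 .

lift_definition one_uea :: "'a uea" is 1 .

lift_definition plus_uea :: "'a uea \<Rightarrow> 'a uea \<Rightarrow> 'a uea" is "(+)"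
  by (simp only: add_diff_add uea_ideal_add)

lift_definition uminus_uea :: "'a uea \<Rightarrow> 'a uea" is uminus
  by (simp only: minus_diff_minus uea_ideal_minus)

lift_definition minus_uea :: "'a uea \<Rightarrow> 'a uea \<Rightarrow> 'a uea" is "(-)"
proof -
  fix p p' q q' :: "'a free_algebra"
  assume "p - p' \<in> uea_ideal" "q - q' \<in> uea_ideal"
  then have "(p - p') + - (q - q') \<in> uea_ideal"
    by (intro uea_ideal_add uea_ideal_minus)
  then show "p - q - (p' - q') \<in> uea_ideal"
    by (simp add: algebra_simps)
qed

lift_definition times_uea :: "'a uea \<Rightarrow> 'a uea \<Rightarrow> 'a uea" is "(*)"
proof -
  fix p p' q q' :: "'a free_algebra"
  assume "p - p' \<in> uea_ideal" "q - q' \<in> uea_ideal"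
  then have "(p - p') * q + p' * (q - q') \<in> uea_ideal"
    by (intro uea_ideal_add uea_ideal_mult_left uea_ideal_mult_right)
  then show "p * q - p' * q' \<in> uea_ideal"
    by (simp add: algebra_simps)
qed

lift_definition scaleC_uea :: "complex \<Rightarrow> 'a uea \<Rightarrow> 'a uea" is scaleC
  by (simp add: uea_ideal_mult_left scaleC_free_algebra flip: right_diff_distrib)

instance
proof
  fix x y z :: "'a uea" and a b :: complex
  show "x + y + z = x + (y + z)" "x + y = y + x" "0 + x = x" "- x + x = 0" "x - y = x + - y"
    "x * y * z = x * (y * z)" "(x + y) * z = x * z + y * z" "x * (y + z) = x * y + x * z"
    by (transfer; simp add: uea_ideal_zero algebra_simps)+
  show "a *\<^sub>C (x + y) = a *\<^sub>C x + a *\<^sub>C y" "(a + b) *\<^sub>C x = a *\<^sub>C x + b *\<^sub>C x"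
    "a *\<^sub>C b *\<^sub>C x = (a * b) *\<^sub>C x" "1 *\<^sub>C x = x"
    by (transfer; simp add: uea_ideal_zero scaleC_add_right scaleC_add_left scaleC_scaleC scaleC_one)+
qed

end


lemma one_notin_uea_ideal: "1 \<notin> (uea_ideal :: 'l::complex_lie_algebra free_algebra set)"
proof -
  define J :: "'l free_algebra set" where "J = {p. Poly_Mapping.lookup p 0 = 0}"
  have const: "Poly_Mapping.lookup (p * q) 0 = Poly_Mapping.lookup p 0 * Poly_Mapping.lookup q 0"
    for p q :: "'l free_algebra"
  proof (induction p rule: poly_mapping_additive_induct)
    case (single v a)
    show ?case
    proof (induction q rule: poly_mapping_additive_induct)
      case (single w b)
      have "v + w = 0 \<longleftrightarrow> v = 0 \<and> w = 0"
        by (cases v; cases w) (auto simp: zero_word_def plus_word_def)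
      then show ?case
        by (simp add: mult_single lookup_single when_def)
    qed (simp add: distrib_left lookup_add)
  qed (simp add: distrib_right lookup_add)
  have gen: "Poly_Mapping.lookup (free_gen x) 0 = 0" for x :: 'l
    by (simp add: free_gen_def lookup_single when_def zero_word_def)
  have "two_sided_ideal J"
    by (auto simp: two_sided_ideal_def J_def const lookup_add)
  moreover have "uea_relations \<subseteq> J"
    by (auto simp: uea_relations_def J_def lookup_minus const gen scaleC_complex_def)
  ultimately have "uea_ideal \<subseteq> J"
    unfolding uea_ideal_def by (rule hull_minimal[rotated])
  then show ?thesis
    by (auto simp: J_def)
qed

instance uea :: (complex_lie_algebra) complex_algebra_1
proof
  fix x y :: "'a uea" and a :: complex
  show "1 * x = x" "x * 1 = x"
    by (transfer; simp add: uea_ideal_zero)+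
  show "(0 :: 'a uea) \<noteq> 1"
    by transfer (use uea_ideal_minus one_notin_uea_ideal in fastforce)
  show "(a *\<^sub>C x) * y = a *\<^sub>C (x * y)"
    by transfer (simp add: scaleC_free_algebra mult.assoc uea_ideal_zero)
  show "x * (a *\<^sub>C y) = a *\<^sub>C (x * y)"
  proof transfer
    fix p q :: "'a free_algebra" and a :: complex
    have "p * (a *\<^sub>C q) = a *\<^sub>C (p * q)"
      unfolding scaleC_free_algebra by (metis mult.assoc single_0_central)
    then show "p * (a *\<^sub>C q) - a *\<^sub>C (p * q) \<in> uea_ideal"
      by (simp add: uea_ideal_zero)
  qed
qed

lift_definition uea_of :: "'l::complex_lie_algebra \<Rightarrow> 'l uea" is free_gen .


section \<open>Modules over a possibly noncommutative ring\<close>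

text \<open>Only the additive group and the scalar action of the record type \<open>module\<close> are used; its
  fields for a multiplication and a unit are left undefined.\<close>

definition left_module :: "('r::ring_1, 'm) module \<Rightarrow> bool"
  where "left_module M \<longleftrightarrow> abelian_group M \<and>
    (\<forall>r. \<forall>x\<in>carrier M. r \<odot>\<^bsub>M\<^esub> x \<in> carrier M) \<and>
    (\<forall>r s. \<forall>x\<in>carrier M. (r + s) \<odot>\<^bsub>M\<^esub> x = r \<odot>\<^bsub>M\<^esub> x \<oplus>\<^bsub>M\<^esub> s \<odot>\<^bsub>M\<^esub> x) \<and>
    (\<forall>r. \<forall>x\<in>carrier M. \<forall>y\<in>carrier M. r \<odot>\<^bsub>M\<^esub> (x \<oplus>\<^bsub>M\<^esub> y) = r \<odot>\<^bsub>M\<^esub> x \<oplus>\<^bsub>M\<^esub> r \<odot>\<^bsub>M\<^esub> y) \<and>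
    (\<forall>r s. \<forall>x\<in>carrier M. (r * s) \<odot>\<^bsub>M\<^esub> x = r \<odot>\<^bsub>M\<^esub> (s \<odot>\<^bsub>M\<^esub> x)) \<and>
    (\<forall>x\<in>carrier M. 1 \<odot>\<^bsub>M\<^esub> x = x)"

definition finite_dimensional_module :: "('r::complex_algebra_1, 'm) module \<Rightarrow> bool"
  where "finite_dimensional_module M \<longleftrightarrow> (\<exists>B. finite B \<and> B \<subseteq> carrier M \<and>
    (\<forall>x\<in>carrier M. \<exists>c. x = finsum M (\<lambda>b. of_complex (c b) \<odot>\<^bsub>M\<^esub> b) B))"

text \<open>The quotient \<open>A / J\<close> of additive groups, with the action induced by \<open>act\<close>. The action on a
  coset is computed on all representatives, so that it does not involve a choice.\<close>

definition quotient_module :: "('r \<Rightarrow> 'a \<Rightarrow> 'a) \<Rightarrow> 'a::ab_group_add set \<Rightarrow> 'a set \<Rightarrow> ('r, 'a set) module"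
  where "quotient_module act A J = \<lparr>carrier = (\<lambda>a. (+) a ` J) ` A, mult = undefined, one = undefined,
    zero = J, add = (\<lambda>X Y. {x + y | x y. x \<in> X \<and> y \<in> Y}),
    smult = (\<lambda>r X. {act r x + j | x j. x \<in> X \<and> j \<in> J})\<rparr>"

definition left_submodule :: "'r::ring_1 set \<Rightarrow> 'r set \<Rightarrow> bool"
  where "left_submodule S J \<longleftrightarrow>
    0 \<in> J \<and> (\<forall>x\<in>J. \<forall>y\<in>J. x + y \<in> J) \<and> (\<forall>r\<in>S. \<forall>x\<in>J. r * x \<in> J)"

abbreviation left_ideal :: "'r::ring_1 set \<Rightarrow> bool"
  where "left_ideal \<equiv> left_submodule UNIV"

definition subalgebra :: "'r::complex_algebra_1 set \<Rightarrow> bool"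
  where "subalgebra S \<longleftrightarrow> complex_vector.subspace S \<and> 1 \<in> S \<and> (\<forall>x\<in>S. \<forall>y\<in>S. x * y \<in> S)"

definition additive_subgroup :: "'a::ab_group_add set \<Rightarrow> bool"
  where "additive_subgroup J \<longleftrightarrow> 0 \<in> J \<and> (\<forall>x\<in>J. \<forall>y\<in>J. x - y \<in> J)"

text \<open>\<open>M \<otimes>\<^sub>S N\<close> for a left module \<open>M\<close> with a right action \<open>ract\<close> of \<open>S\<close> and a left
  \<open>S\<close>-module \<open>N\<close>: the free abelian group on \<open>M \<times> N\<close> modulo the relations of a balanced
  biadditive map, with the left action coming from \<open>M\<close>.\<close>

definition tensor_relations ::
    "'s set \<Rightarrow> ('m \<Rightarrow> 's \<Rightarrow> 'm) \<Rightarrow> ('r, 'm) module \<Rightarrow> ('s, 'n) module \<Rightarrow> ('m \<times> 'n \<Rightarrow>\<^sub>0 int) set"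
  where "tensor_relations S ract M N =
    {frag_of (m \<oplus>\<^bsub>M\<^esub> m', n) - frag_of (m, n) - frag_of (m', n) | m m' n.
      m \<in> carrier M \<and> m' \<in> carrier M \<and> n \<in> carrier N} \<union>
    {frag_of (m, n \<oplus>\<^bsub>N\<^esub> n') - frag_of (m, n) - frag_of (m, n') | m n n'.
      m \<in> carrier M \<and> n \<in> carrier N \<and> n' \<in> carrier N} \<union>
    {frag_of (ract m s, n) - frag_of (m, s \<odot>\<^bsub>N\<^esub> n) | m s n.
      m \<in> carrier M \<and> s \<in> S \<and> n \<in> carrier N}"

definition tensor_module ::
    "'s set \<Rightarrow> ('m \<Rightarrow> 's \<Rightarrow> 'm) \<Rightarrow> ('r, 'm) module \<Rightarrow> ('s, 'n) module \<Rightarrow> ('r, ('m \<times> 'n \<Rightarrow>\<^sub>0 int) set) module"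
  where "tensor_module S ract M N = quotient_module
    (\<lambda>r. frag_extend (\<lambda>(m, n). frag_of (r \<odot>\<^bsub>M\<^esub> m, n)))
    {p. Poly_Mapping.keys p \<subseteq> carrier M \<times> carrier N}
    (additive_subgroup hull tensor_relations S ract M N)"


section \<open>Integrable modules\<close>

definition weight_space ::
    "'g::complex_lie_algebra cartan_data \<Rightarrow> ('g ext_loop uea, 'v) module \<Rightarrow> ('g ext_loop \<Rightarrow> complex) \<Rightarrow> 'v set"
  where "weight_space D V \<mu> =
    {v \<in> carrier V. \<forall>y\<in>ext_cartan D. uea_of y \<odot>\<^bsub>V\<^esub> v = of_complex (\<mu> y) \<odot>\<^bsub>V\<^esub> v}"

definition weight_decomposition ::
    "'g::complex_lie_algebra cartan_data \<Rightarrow> ('g ext_loop uea, 'v) module \<Rightarrow> bool"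
  where "weight_decomposition D V \<longleftrightarrow> (\<forall>v\<in>carrier V. \<exists>!f.
    (\<forall>\<mu>\<in>dual (ext_cartan D). f \<mu> \<in> weight_space D V \<mu>) \<and>
    (\<forall>\<mu>. \<mu> \<notin> dual (ext_cartan D) \<longrightarrow> f \<mu> = \<zero>\<^bsub>V\<^esub>) \<and>
    finite {\<mu>. f \<mu> \<noteq> \<zero>\<^bsub>V\<^esub>} \<and>
    v = finsum V f {\<mu>. f \<mu> \<noteq> \<zero>\<^bsub>V\<^esub>})"

definition locally_nilpotent :: "('r::ring_1, 'm) module \<Rightarrow> 'r \<Rightarrow> bool"
  where "locally_nilpotent V a \<longleftrightarrow> (\<forall>v\<in>carrier V. \<exists>k. a ^ k \<odot>\<^bsub>V\<^esub> v = \<zero>\<^bsub>V\<^esub>)"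

definition integrable :: "'g::complex_lie_algebra cartan_data \<Rightarrow> ('g ext_loop uea, 'v) module \<Rightarrow> bool"
  where "integrable D V \<longleftrightarrow>
    left_module V \<and>
    weight_decomposition D V \<and>
    (\<forall>i\<in>index_set D.
      locally_nilpotent V (uea_of (ext_elt (xplus D (simple_root D i)) 0)) \<and>
      locally_nilpotent V (uea_of (ext_elt (xminus D (simple_root D i)) 0))) \<and>
    locally_nilpotent V (uea_of (ext_elt (xminus D (highest_root D)) 1)) \<and>
    locally_nilpotent V (uea_of (ext_elt (xplus D (highest_root D)) (- 1)))"


section \<open>Weyl modules\<close>

definition simple_coroot :: "'g cartan_data \<Rightarrow> nat \<Rightarrow> 'g"
  where "simple_coroot D i = coroot D (simple_root D i)"

definition dominant_weights :: "'g::complex_lie_algebra cartan_data \<Rightarrow> ('g ext_loop \<Rightarrow> complex) set"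
  where "dominant_weights D = {lam \<in> dual (ext_cartan D).
    (\<forall>i\<in>index_set D. lam (ext_elt (simple_coroot D i) 0) \<in> \<nat>) \<and> lam deg_d \<in> \<int>}"

definition weight_label :: "'g::complex_lie_algebra cartan_data \<Rightarrow> ('g ext_loop \<Rightarrow> complex) \<Rightarrow> nat \<Rightarrow> nat"
  where "weight_label D lam i = (THE k. lam (ext_elt (simple_coroot D i) 0) = of_nat k)"

text \<open>In the next definitions \<open>X x m\<close> is the image of \<open>x \<otimes> t^m\<close> in an algebra, which will be
  the enveloping algebra of the loop algebra or of the extended loop algebra.\<close>

definition U0 :: "'g::complex_lie_algebra cartan_data \<Rightarrow> ('g \<Rightarrow> int \<Rightarrow> 'u::complex_algebra_1) \<Rightarrow> 'u set"
  where "U0 D X = subalgebra hull {X (coroot D \<alpha>) m | \<alpha> m. \<alpha> \<in> positive_roots D \<and> m \<noteq> 0}"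

text \<open>The series \<open>\<Lambda>\<^sub>i\<^sup>+\<close> for \<open>s = 1\<close> and \<open>\<Lambda>\<^sub>i\<^sup>-\<close> for \<open>s = -1\<close>. The exponential is the composition
  with the series whose coefficients are the images of \<open>1/n!\<close> in the algebra.\<close>

definition Lam_series ::
    "'g::complex_lie_algebra cartan_data \<Rightarrow> ('g \<Rightarrow> int \<Rightarrow> 'u::complex_algebra_1) \<Rightarrow> nat \<Rightarrow> int \<Rightarrow> 'u fps"
  where "Lam_series D X i s =
    fps_compose (Abs_fps (\<lambda>n. of_complex (1 / fact n)))
      (Abs_fps (\<lambda>k. if k = 0 then 0 else - ((1 / of_nat k) *\<^sub>C X (simple_coroot D i) (s * int k))))"

definition Lam ::
    "'g::complex_lie_algebra cartan_data \<Rightarrow> ('g \<Rightarrow> int \<Rightarrow> 'u::complex_algebra_1) \<Rightarrow> nat \<Rightarrow> int \<Rightarrow> 'u"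
  where "Lam D X i m = fps_nth (Lam_series D X i (if m \<ge> 0 then 1 else - 1)) (nat \<bar>m\<bar>)"

definition Xminus_series ::
    "'g::complex_lie_algebra cartan_data \<Rightarrow> ('g \<Rightarrow> int \<Rightarrow> 'u::complex_algebra_1) \<Rightarrow> nat \<Rightarrow> 'u fps"
  where "Xminus_series D X i =
    Abs_fps (\<lambda>k. if k = 0 then 0 else X (xminus D (simple_root D i)) (int k - 1))"

text \<open>The last family of relations is indexed by \<open>m\<close> natural, since the coefficients of a power
  series at negative exponents vanish.\<close>

definition weyl_relations ::
    "'g::complex_lie_algebra cartan_data \<Rightarrow> ('g \<Rightarrow> int \<Rightarrow> 'u::complex_algebra_1) \<Rightarrow> ('g ext_loop \<Rightarrow> complex) \<Rightarrow> 'u set"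
  where "weyl_relations D X lam =
    {X (xplus D (simple_root D i)) m | i m. i \<in> index_set D} \<union>
    {X h 0 - of_complex (lam (ext_elt h 0)) | h. h \<in> cartan D} \<union>
    {Lam D X i m | i m. i \<in> index_set D \<and> \<bar>m\<bar> > int (weight_label D lam i)} \<union>
    {Lam D X i (int (weight_label D lam i)) * Lam D X i (- m) - Lam D X i (int (weight_label D lam i) - m) | i m.
      i \<in> index_set D \<and> 1 \<le> m \<and> m \<le> int (weight_label D lam i)} \<union>
    {(\<Sum>k = 0..weight_label D lam i. X (xminus D (simple_root D i)) (m - 1 - int k) * Lam D X i (int k)) * f | i m f.
      i \<in> index_set D \<and> f \<in> U0 D X} \<union>
    {fps_nth (Xminus_series D X i ^ r * Lam_series D X i 1) m * f | i r m f.
      i \<in> index_set D \<and> r \<ge> 1 \<and> m > weight_label D lam i \<and> f \<in> U0 D X}"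

definition loop_gen :: "'g::complex_lie_algebra \<Rightarrow> int \<Rightarrow> 'g loop uea"
  where "loop_gen x m = uea_of (loop_elt x m)"

definition ext_gen :: "'g::complex_lie_algebra \<Rightarrow> int \<Rightarrow> 'g ext_loop uea"
  where "ext_gen x m = uea_of (ext_elt x m)"

text \<open>\<open>W(\<lambda>)\<close> as a module over the enveloping algebra of the extended loop algebra.\<close>

definition weyl_module ::
    "'g::complex_lie_algebra cartan_data \<Rightarrow> ('g ext_loop \<Rightarrow> complex) \<Rightarrow> ('g ext_loop uea, 'g ext_loop uea set) module"
  where "weyl_module D lam = quotient_module (*) UNIV
    (left_ideal hull (insert (uea_of deg_d - of_complex (lam deg_d)) (weyl_relations D ext_gen lam)))"

text \<open>\<open>W(\<lambda>)\<close> as a module over the enveloping algebra of the loop algebra, and the right action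
  on it of \<open>U0\<close>.\<close>

definition weyl_ideal :: "'g::complex_lie_algebra cartan_data \<Rightarrow> ('g ext_loop \<Rightarrow> complex) \<Rightarrow> 'g loop uea set"
  where "weyl_ideal D lam = left_ideal hull weyl_relations D loop_gen lam"

definition weyl_module_loop ::
    "'g::complex_lie_algebra cartan_data \<Rightarrow> ('g ext_loop \<Rightarrow> complex) \<Rightarrow> ('g loop uea, 'g loop uea set) module"
  where "weyl_module_loop D lam = quotient_module (*) UNIV (weyl_ideal D lam)"

definition weyl_right_action ::
    "'g::complex_lie_algebra cartan_data \<Rightarrow> ('g ext_loop \<Rightarrow> complex) \<Rightarrow> 'g loop uea set \<Rightarrow> 'g loop uea \<Rightarrow> 'g loop uea set"
  where "weyl_right_action D lam X s = {x * s + j | x j. x \<in> X \<and> j \<in> weyl_ideal D lam}"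

text \<open>\<open>reflect_poly p\<close> is \<open>u^(deg p) p(1/u)\<close>.\<close>

definition poly_minus :: "complex poly \<Rightarrow> complex poly"
  where "poly_minus p = Polynomial.smult (1 / coeff (reflect_poly p) 0) (reflect_poly p)"

text \<open>\<open>U0\<close> is commutative, so an ideal of \<open>U0\<close> is the same as a \<open>U0\<close>-submodule.\<close>

definition pi_ideal :: "'g::complex_lie_algebra cartan_data \<Rightarrow> (nat \<Rightarrow> complex poly) \<Rightarrow> 'g loop uea set"
  where "pi_ideal D \<pi> = left_submodule (U0 D loop_gen) hull
    ({fps_nth (Lam_series D loop_gen i 1) k - of_complex (coeff (\<pi> i) k) | i k. i \<in> index_set D} \<union>
     {fps_nth (Lam_series D loop_gen i (- 1)) k - of_complex (coeff (poly_minus (\<pi> i)) k) | i k. i \<in> index_set D})"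

definition pi_module ::
    "'g::complex_lie_algebra cartan_data \<Rightarrow> (nat \<Rightarrow> complex poly) \<Rightarrow> ('g loop uea, 'g loop uea set) module"
  where "pi_module D \<pi> = quotient_module (*) (U0 D loop_gen) (pi_ideal D \<pi>)"

definition weyl_module_pi ::
    "'g::complex_lie_algebra cartan_data \<Rightarrow> ('g ext_loop \<Rightarrow> complex) \<Rightarrow> (nat \<Rightarrow> complex poly) \<Rightarrow>
      ('g loop uea, ('g loop uea set \<times> 'g loop uea set \<Rightarrow>\<^sub>0 int) set) module"
  where "weyl_module_pi D lam \<pi> = tensor_module (U0 D loop_gen) (weyl_right_action D lam)
    (weyl_module_loop D lam) (pi_module D \<pi>)"

end

theory Submission
  imports Defs "HOL-Computational_Algebra.Fundamental_Theorem_Algebra"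
begin

text \<open>The structure theory of \<open>\<gg>\<close> is derived from the given \<open>sl\<^sub>2\<close>-triples without the Killing form: the
  sum over the roots of \<open>\<alpha>(h) \<alpha>(h')\<close> is a reflection-invariant form on the Cartan subalgebra which is
  positive on coroots, and this suffices to show that \<open>\<gg>\<close> is the sum of its root spaces and is generated
  by the \<open>x\<^sup>\<plusminus>\<^sub>i\<close>.

  On a cyclic module \<open>U w\<close>, an ad-nilpotent element that is nilpotent at \<open>w\<close> is locally nilpotent. For
  each \<open>m\<close>, conjugation by exponentials of the \<open>x\<^sup>\<plusminus>\<^sub>i\<close> shows that the span of the \<open>x\<close> for which
  \<open>x \<otimes> t\<^sup>m\<close> is locally nilpotent is an ideal of \<open>\<gg>\<close>, and it contains the \<open>x\<^sup>+\<^sub>i\<close>. So all of \<open>\<gg> \<otimes> t\<^sup>m\<close> is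
  spanned by locally nilpotent elements, and by the argument of Poincare, Birkhoff and Witt a
  finite-dimensional Lie algebra spanned by such elements generates a finite-dimensional space from \<open>w\<close>.

  In \<open>W(\<pi>)\<close> the relation \<open>\<Sum>\<^sub>k \<pi>\<^sub>i\<^sub>,\<^sub>k x\<^sup>-\<^sub>i\<^sub>,\<^sub>m\<^sub>-\<^sub>k w = 0\<close> says that \<open>x\<^sup>-\<^sub>i \<otimes> p\<^sub>i t\<^sup>s\<close> kills \<open>w\<close> for a polynomial \<open>p\<^sub>i\<close> with
  \<open>p\<^sub>i(0) \<noteq> 0\<close>. Bracketing such relations, some power \<open>F\<close> of the product of the \<open>p\<^sub>i\<close> satisfies
  \<open>(\<gg> \<otimes> F \<complex>[t,t\<^sup>-\<^sup>1]) w = 0\<close>, so the finite-dimensional algebra \<open>\<gg> \<otimes> \<complex>[t,t\<^sup>-\<^sup>1]/(F)\<close> acts.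

  In \<open>W(\<lambda>)\<close> the space \<open>U(\<gg>) w\<close> is finite-dimensional, so \<open>x\<^sup>-\<^sub>\<theta>\<close> is locally nilpotent, and the theory of
  \<open>sl\<^sub>2\<close> applied to \<open>(x\<^sup>-\<^sub>\<theta> \<otimes> t)\<^sup>k w\<close> with \<open>k\<close> large would give a weight above \<open>\<lambda>\<close> unless this vector is 0.\<close>

section \<open>Linear algebra modulo a subspace\<close>

text \<open>Every module here is a quotient of an algebra by a left ideal J. Computations stay in
  the algebra, and an equation between vectors is membership of a difference in J. Hence the linear
  algebra and the theory of sl_2 are developed modulo a stable subspace; with J = {0} the same
  lemmas govern the adjoint representation. The obstacle in the structure theory is how little the
  data say. A Cartan subalgebra is nilpotent and self-normalizing, so neither its commutativity nor
  its diagonal action is given, and triples are given for positive roots only, so a negative root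
  might lack an opposite. Commutativity comes from having dim H independent simple roots. The
  opposite roots must be found before the root spaces can be shown to fill the algebra, because that
  proof brackets with an opposite root vector. Local nilpotency is read off from the relations for
  the x^+_i in all degrees of t and for the x^-_i in degree 0; the ideal argument carries it to a
  spanning set of the Lie algebra in each degree.\<close>

abbreviation "csubspace \<equiv> complex_vector.subspace"
abbreviation "cspan \<equiv> complex_vector.span"
abbreviation "cindependent \<equiv> complex_vector.independent"

lemmas cindependentD = complex_vector.independentD
  and cindependent_span_bound = complex_vector.independent_span_bound
  and cspan_Un = complex_vector.span_Un
  and cspan_add = complex_vector.span_add
  and cspan_base = complex_vector.span_base
  and cspan_diff = complex_vector.span_diff
  and cspan_eq_iff = complex_vector.span_eq_iff
  and cspan_finite = complex_vector.span_finite
  and cspan_induct = complex_vector.span_induct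
  and cspan_induct_alt = complex_vector.span_induct_alt
  and cspan_minimal = complex_vector.span_minimal
  and cspan_mono = complex_vector.span_mono
  and cspan_scale = complex_vector.span_scale
  and cspan_sum = complex_vector.span_sum
  and cspan_zero = complex_vector.span_zero
  and csubspaceI = complex_vector.subspaceI
  and csubspace_0 = complex_vector.subspace_0
  and csubspace_Inter = complex_vector.subspace_Inter
  and csubspace_UNIV = complex_vector.subspace_UNIV
  and csubspace_add = complex_vector.subspace_add
  and csubspace_diff = complex_vector.subspace_diff
  and csubspace_neg = complex_vector.subspace_neg
  and csubspace_scale = complex_vector.subspace_scale
  and csubspace_single_0 = complex_vector.subspace_single_0
  and csubspace_span = complex_vector.subspace_span
  and csubspace_sum = complex_vector.subspace_sum

definition clinear :: "('a::complex_vector \<Rightarrow> 'b::complex_vector) \<Rightarrow> bool"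
  where "clinear f \<longleftrightarrow> (\<forall>x y. f (x + y) = f x + f y) \<and> (\<forall>c x. f (c *\<^sub>C x) = c *\<^sub>C f x)"

lemma clinearI:
  "(\<And>x y. f (x + y) = f x + f y) \<Longrightarrow> (\<And>c x. f (c *\<^sub>C x) = c *\<^sub>C f x) \<Longrightarrow> clinear f"
  by (simp add: clinear_def)

lemma clinear_add: "clinear f \<Longrightarrow> f (x + y) = f x + f y"
  and clinear_scale: "clinear f \<Longrightarrow> f (c *\<^sub>C x) = c *\<^sub>C f x"
  by (simp_all add: clinear_def)

lemma clinear_0: "clinear f \<Longrightarrow> f 0 = 0"
  using clinear_scale[of f 0 0] by simp

lemma clinear_minus: "clinear f \<Longrightarrow> f (- x) = - f x"
  using clinear_scale[of f "-1" x] by (simp add: scaleC_one)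

lemma clinear_diff: "clinear f \<Longrightarrow> f (x - y) = f x - f y"
  using clinear_add[of f x "- y"] by (simp add: clinear_minus)

lemma clinear_sum: "clinear f \<Longrightarrow> f (sum g A) = (\<Sum>a\<in>A. f (g a))"
  by (induction A rule: infinite_finite_induct) (simp_all add: clinear_0 clinear_add)

lemma clinear_lie: "clinear (lie x)"
  by (simp add: clinear_def lie_add_right lie_scaleC_right)

lemma clinear_mult: "clinear ((*) (u :: 'u::complex_algebra_1))"
  by (simp add: clinear_def distrib_left mult_scaleC_right)

lemma clinear_funpow: "clinear f \<Longrightarrow> clinear (f ^^ n)" for f :: "'a::complex_vector \<Rightarrow> 'a"
  by (induction n) (simp_all add: clinear_def)

text \<open>Gaussian elimination with the pivot \<open>a p e\<close>. The linear relations in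
  \<open>dependent_mod\<close>, \<open>eq_0_of_simple_roots\<close> and \<open>ex_rho\<close> all
  come from here.\<close>

lemma homogeneous_system:
  fixes a :: "'i \<Rightarrow> 'e \<Rightarrow> complex"
  assumes "finite E" "finite I" "card E < card I"
  shows "\<exists>c. (\<exists>i\<in>I. c i \<noteq> 0) \<and> (\<forall>e\<in>E. (\<Sum>i\<in>I. c i * a i e) = 0)"
  using assms
proof (induction E arbitrary: I a rule: finite_induct)
  case empty
  then obtain i where "i \<in> I" by (metis card.empty less_irrefl ex_in_conv)
  then show ?case by (intro exI[of _ "\<lambda>_. 1"]) auto
next
  case (insert e E)
  show ?case
  proof (cases "\<exists>p\<in>I. a p e \<noteq> 0")
    case False
    with insert.IH[of I a] insert.prems insert.hyps show ?thesis by auto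
  next
    case True
    then obtain p where p: "p \<in> I" "a p e \<noteq> 0" by blast
    \<comment> \<open>Coefficients after equation e has been used to eliminate the unknown
      p.\<close>
    define a' where "a' i j = a i j - a i e / a p e * a p j" for i j
    have "card E < card (I - {p})"
      using insert.prems insert.hyps p by simp
    then obtain c where c: "\<exists>i\<in>I - {p}. c i \<noteq> 0" "\<forall>j\<in>E. (\<Sum>i\<in>I - {p}. c i * a' i j) = 0"
      using insert.IH[of "I - {p}" a'] insert.prems by auto
    \<comment> \<open>The value of the unknown p that equation e forces.\<close>
    define s where "s = - (\<Sum>i\<in>I - {p}. c i * a i e) / a p e"
    have sum: "(\<Sum>i\<in>I. (c(p := s)) i * a i j) = s * a p j + (\<Sum>i\<in>I - {p}. c i * a i j)" for j
      using p insert.prems by (subst sum.remove[of I p]) (auto intro!: sum.cong)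
    have "(\<Sum>i\<in>I. (c(p := s)) i * a i j) = 0" if "j \<in> insert e E" for j
    proof (cases "j = e")
      case True
      then show ?thesis unfolding sum using p by (simp add: s_def)
    next
      case False
      then have "0 = (\<Sum>i\<in>I - {p}. c i * a' i j)" using c that by auto
      also have "\<dots> = (\<Sum>i\<in>I - {p}. c i * a i j) - (\<Sum>i\<in>I - {p}. c i * a i e) / a p e * a p j"
        by (simp add: a'_def right_diff_distrib sum_subtractf sum_divide_distrib sum_distrib_right mult.assoc)
      finally show ?thesis unfolding sum by (simp add: s_def)
    qed
    moreover have "\<exists>i\<in>I. (c(p := s)) i \<noteq> 0" using c(1) by auto
    ultimately show ?thesis by blast
  qed
qed

lemma span_finite_obtain:
  assumes "finite B" "x \<in> cspan (B :: 'a::complex_vector set)"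
  obtains a where "x = (\<Sum>b\<in>B. a b *\<^sub>C b)"
  using assms by (auto simp: cspan_finite)

text \<open>Modulo J the \<open>v i\<close> lie in a space with \<open>card B\<close> generators,
  and a combination whose coordinates all cancel lies in J.\<close>

lemma dependent_mod:
  fixes v :: "'i \<Rightarrow> 'a::complex_vector"
  assumes J: "csubspace J" and "finite B" "finite I" "card B < card I"
    and v: "\<And>i. i \<in> I \<Longrightarrow> \<exists>b\<in>cspan B. v i - b \<in> J"
  shows "\<exists>c. (\<exists>i\<in>I. c i \<noteq> 0) \<and> (\<Sum>i\<in>I. c i *\<^sub>C v i) \<in> J"
proof -
  have "\<exists>a. v i - (\<Sum>b\<in>B. a b *\<^sub>C b) \<in> J" if "i \<in> I" for i
    using v[OF that] span_finite_obtain[OF \<open>finite B\<close>] by metis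
  then obtain a where a: "\<And>i. i \<in> I \<Longrightarrow> v i - (\<Sum>b\<in>B. a i b *\<^sub>C b) \<in> J" by metis
  obtain c where c: "\<exists>i\<in>I. c i \<noteq> 0" "\<forall>b\<in>B. (\<Sum>i\<in>I. c i * a i b) = 0"
    using homogeneous_system[of B I a] assms by blast
  have "(\<Sum>i\<in>I. c i *\<^sub>C (v i - (\<Sum>b\<in>B. a i b *\<^sub>C b))) \<in> J"
    using a by (intro csubspace_sum[OF J] csubspace_scale[OF J])
  moreover have "(\<Sum>i\<in>I. c i *\<^sub>C (\<Sum>b\<in>B. a i b *\<^sub>C b)) = (\<Sum>b\<in>B. (\<Sum>i\<in>I. c i * a i b) *\<^sub>C b)"
    by (simp add: complex_vector.scale_sum_right scaleC_scaleC complex_vector.scale_sum_left) (rule sum.swap)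
  ultimately have "(\<Sum>i\<in>I. c i *\<^sub>C v i) \<in> J"
    using c by (simp add: complex_vector.scale_right_diff_distrib sum_subtractf)
  with c show ?thesis by blast
qed

text \<open>Independence of simultaneous eigenvectors with different characters, read in the
  quotient by J. With J = {0} it serves the root spaces, with a left ideal the weight spaces of a
  cyclic module.\<close>

lemma weight_vectors_independent_mod:
  fixes A :: "'y \<Rightarrow> 'a::complex_vector \<Rightarrow> 'a"
  assumes lin: "\<And>y. y \<in> Y \<Longrightarrow> clinear (A y)"
    and J: "csubspace J"
    and stable: "\<And>y x. y \<in> Y \<Longrightarrow> x \<in> J \<Longrightarrow> A y x \<in> J"
    and "finite F"
    and "\<And>i y. i \<in> F \<Longrightarrow> y \<in> Y \<Longrightarrow> A y (v i) - w i y *\<^sub>C v i \<in> J"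
    and "\<And>i j. i \<in> F \<Longrightarrow> j \<in> F \<Longrightarrow> i \<noteq> j \<Longrightarrow> \<exists>y\<in>Y. w i y \<noteq> w j y"
    and "(\<Sum>i\<in>F. v i) \<in> J" and "i \<in> F"
  shows "v i \<in> J"
  using assms(4-)
proof (induction F arbitrary: v i rule: finite_induct)
  case empty
  then show ?case by simp
next
  case (insert k F)
  have "v j \<in> J" if j: "j \<in> F" for j
  proof -
    from insert j obtain y where y: "y \<in> Y" "w j y \<noteq> w k y" by (metis insertCI)
    \<comment> \<open>\<open>A y - w k y\<close> kills \<open>v k\<close> modulo J and multiplies
      the other \<open>v i\<close> by scalars, the one at i = j being nonzero.\<close>
    let ?v = "\<lambda>i. (w i y - w k y) *\<^sub>C v i"
    have "A y (\<Sum>i\<in>insert k F. v i) - w k y *\<^sub>C (\<Sum>i\<in>insert k F. v i) \<in> J"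
      using insert.prems y by (intro csubspace_diff[OF J] stable csubspace_scale[OF J])
    moreover have "A y (\<Sum>i\<in>insert k F. v i) - w k y *\<^sub>C (\<Sum>i\<in>insert k F. v i) =
       (\<Sum>i\<in>insert k F. (A y (v i) - w i y *\<^sub>C v i)) + (\<Sum>i\<in>insert k F. ?v i)"
      by (simp add: clinear_sum[OF lin[OF y(1)]] complex_vector.scale_sum_right sum_subtractf
          complex_vector.scale_left_diff_distrib del: sum.insert)
    moreover have "(\<Sum>i\<in>insert k F. (A y (v i) - w i y *\<^sub>C v i)) \<in> J"
      using insert.prems y by (intro csubspace_sum[OF J]) auto
    ultimately have "(\<Sum>i\<in>insert k F. ?v i) \<in> J"
      using csubspace_diff[OF J] by fastforce
    then have sum: "(\<Sum>i\<in>F. ?v i) \<in> J" using insert.hyps by simp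
    have "?v j \<in> J"
    proof (rule insert.IH[OF _ _ sum j])
      fix i z assume i: "i \<in> F" "z \<in> Y"
      then have "(w i y - w k y) *\<^sub>C (A z (v i) - w i z *\<^sub>C v i) \<in> J"
        using insert.prems by (intro csubspace_scale[OF J]) auto
      then show "A z (?v i) - w i z *\<^sub>C ?v i \<in> J"
        by (simp add: clinear_scale[OF lin[OF i(2)]] complex_vector.scale_right_diff_distrib scaleC_scaleC mult.commute)
    qed (use insert.prems in auto)
    then have "(1 / (w j y - w k y)) *\<^sub>C ?v j \<in> J" by (rule csubspace_scale[OF J])
    then show ?thesis using y by (simp add: scaleC_scaleC scaleC_one)
  qed
  moreover from this have "v k \<in> J"
    using insert.prems(3) insert.hyps csubspace_sum[OF J, of F v]
      csubspace_diff[OF J, of "v k + sum v F" "sum v F"] by simp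
  ultimately show ?case using insert.prems by auto
qed

text \<open>The image of p under the linear map sending u^i to \<open>g i\<close>. For
  \<open>g i = (A ^^ i) x0\<close> it is p(A) applied to x0; for \<open>g i = X x (s + i)\<close> it
  is x \<otimes> t^s p(t).\<close>

definition poly_comb :: "complex poly \<Rightarrow> (nat \<Rightarrow> 'a::complex_vector) \<Rightarrow> 'a"
  where "poly_comb p g = (\<Sum>i\<le>degree p. coeff p i *\<^sub>C g i)"

lemma poly_comb_bound: "degree p \<le> n \<Longrightarrow> poly_comb p g = (\<Sum>i\<le>n. coeff p i *\<^sub>C g i)"
  unfolding poly_comb_def by (rule sum.mono_neutral_left) (auto simp: coeff_eq_0)

lemma poly_comb_0 [simp]: "poly_comb 0 g = 0"
  by (simp add: poly_comb_def)

lemma poly_comb_add: "poly_comb (p + q) g = poly_comb p g + poly_comb q g"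
  using poly_comb_bound[of p "max (degree p) (degree q)" g] poly_comb_bound[of q "max (degree p) (degree q)" g]
    poly_comb_bound[of "p + q" "max (degree p) (degree q)" g]
  by (simp add: degree_add_le scaleC_add_left sum.distrib)

lemma poly_comb_smult: "poly_comb (Polynomial.smult c p) g = c *\<^sub>C poly_comb p g"
  using poly_comb_bound[of "Polynomial.smult c p" "degree p" g]
  by (simp add: poly_comb_def complex_vector.scale_sum_right scaleC_scaleC degree_smult_le)

lemma poly_comb_pCons: "poly_comb (pCons a p) g = a *\<^sub>C g 0 + poly_comb p (\<lambda>i. g (Suc i))"
  by (subst poly_comb_bound[of "pCons a p" "Suc (degree p)"])
    (simp_all add: degree_pCons_le sum.atMost_Suc_shift poly_comb_def del: sum.atMost_Suc)

lemma clinear_poly_comb: "clinear f \<Longrightarrow> f (poly_comb p g) = poly_comb p (\<lambda>i. f (g i))"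
  by (simp add: poly_comb_def clinear_sum clinear_scale)

lemma poly_comb_mult: "poly_comb (p * q) g = poly_comb p (\<lambda>i. poly_comb q (\<lambda>j. g (i + j)))"
proof (induction p arbitrary: g)
  case (pCons a p)
  show ?case
    by (simp add: mult_pCons_left poly_comb_add poly_comb_smult poly_comb_pCons pCons.IH)
qed simp

lemma poly_comb_in_subspace:
  "csubspace S \<Longrightarrow> (\<And>i. g i \<in> S) \<Longrightarrow> poly_comb p g \<in> S"
  unfolding poly_comb_def
  by (intro csubspace_sum csubspace_scale)

text \<open>A nonzero polynomial p of least degree with p(A) x0 in S has a root a. If p = (u - a) q,
  then q(A) x0 is an eigenvector modulo S, outside S by minimality. The subspace W is carried along
  for the induction in \<open>common_eigenvector_mod\<close>.\<close>

lemma eigenvector_mod: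
  fixes A :: "'a::complex_vector \<Rightarrow> 'a"
  assumes fd: "finite B" "cspan B = (UNIV :: 'a set)"
    and lin: "clinear A" and S: "csubspace S" and W: "csubspace W"
    and stW: "\<And>x. x \<in> W \<Longrightarrow> A x \<in> W" and x0: "x0 \<in> W" "x0 \<notin> S"
  shows "\<exists>x a. x \<in> W \<and> x \<notin> S \<and> A x - a *\<^sub>C x \<in> S"
proof -
  define ev where "ev p = poly_comb p (\<lambda>i. (A ^^ i) x0)" for p
  define P where "P p \<longleftrightarrow> p \<noteq> 0 \<and> ev p \<in> S" for p
  obtain c where c: "\<exists>i\<in>{..card B}. c i \<noteq> 0" "(\<Sum>i\<in>{..card B}. c i *\<^sub>C (A ^^ i) x0) \<in> S"
  proof -
    have "\<exists>b\<in>cspan B. (A ^^ i) x0 - b \<in> S" for i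
      using csubspace_0[OF S] fd(2) by (intro bexI[of _ "(A ^^ i) x0"]) auto
    then show ?thesis
      using dependent_mod[OF S fd(1), of "{..card B}" "\<lambda>i. (A ^^ i) x0"] that by auto
  qed
  define p0 where "p0 = (\<Sum>i\<le>card B. monom (c i) i)"
  have cf: "coeff p0 i = (if i \<le> card B then c i else 0)" for i
    by (simp add: p0_def coeff_sum if_distrib cong: if_cong)
  have "p0 \<noteq> 0" using c(1) cf by (metis atMost_iff coeff_0)
  moreover have "ev p0 \<in> S"
    using c(2) poly_comb_bound[of p0 "card B" "\<lambda>i. (A ^^ i) x0"] cf
    by (simp add: ev_def degree_le)
  ultimately have "P p0" by (simp add: P_def)
  then obtain p where p: "P p" and min: "\<And>q. P q \<Longrightarrow> degree p \<le> degree q"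
    using arg_min_natI[of P p0 degree] arg_min_nat_le[of P _ degree] by blast
  have "degree p \<noteq> 0"
  proof
    assume "degree p = 0"
    then obtain b where b: "p = [:b:]" by (metis degree_eq_zeroE)
    then have "b \<noteq> 0" "b *\<^sub>C x0 \<in> S" using p by (auto simp: P_def ev_def poly_comb_def)
    then have "(1 / b) *\<^sub>C b *\<^sub>C x0 \<in> S" using csubspace_scale[OF S] by blast
    with \<open>b \<noteq> 0\<close> x0 show False by (simp add: scaleC_scaleC scaleC_one)
  qed
  then obtain a where "poly p a = 0"
    using fundamental_theorem_of_algebra constant_degree by metis
  then obtain q where q: "p = [:- a, 1:] * q" by (metis poly_eq_0_iff_dvd dvdE)
  have "q \<noteq> 0" using p q by (auto simp: P_def)
  then have "degree q < degree p" unfolding q by (subst degree_mult_eq) auto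
  then have "ev q \<notin> S" using min[of q] \<open>q \<noteq> 0\<close> by (auto simp: P_def)
  moreover have "ev q \<in> W"
  proof -
    have "(A ^^ i) x0 \<in> W" for i by (induction i) (auto simp: x0 stW)
    then show ?thesis unfolding ev_def by (intro poly_comb_in_subspace[OF W])
  qed
  moreover have "A (ev q) - a *\<^sub>C ev q = ev p"
  proof -
    have "ev p = poly_comb (Polynomial.smult (- a) q + pCons 0 q) (\<lambda>i. (A ^^ i) x0)"
      by (simp add: ev_def q)
    also have "\<dots> = A (ev q) - a *\<^sub>C ev q"
      unfolding poly_comb_add poly_comb_smult poly_comb_pCons by (simp add: ev_def clinear_poly_comb[OF lin])
    finally show ?thesis ..
  qed
  ultimately show ?thesis using p unfolding P_def by metis
qed

text \<open>The eigenvectors of one operator modulo S form a space stable under the operators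
  commuting with it, so the next operator can be restricted to it.\<close>

lemma common_eigenvector_mod:
  fixes A :: "'y \<Rightarrow> 'a::complex_vector \<Rightarrow> 'a"
  assumes fd: "finite B" "cspan B = (UNIV :: 'a set)"
    and S: "csubspace S"
    and lin: "\<And>y. y \<in> Y \<Longrightarrow> clinear (A y)"
    and comm: "\<And>y z x. y \<in> Y \<Longrightarrow> z \<in> Y \<Longrightarrow> A y (A z x) = A z (A y x)"
    and stS: "\<And>y x. y \<in> Y \<Longrightarrow> x \<in> S \<Longrightarrow> A y x \<in> S"
    and "finite Y" "S \<noteq> UNIV"
  shows "\<exists>x \<mu>. x \<notin> S \<and> (\<forall>y\<in>Y. A y x - \<mu> y *\<^sub>C x \<in> S)"
proof -
  have "\<exists>x \<mu>. x \<in> W \<and> x \<notin> S \<and> (\<forall>y\<in>Z. A y x - \<mu> y *\<^sub>C x \<in> S)"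
    if "finite Z" "Z \<subseteq> Y" "csubspace W" "\<And>y x. y \<in> Y \<Longrightarrow> x \<in> W \<Longrightarrow> A y x \<in> W"
      "x0 \<in> W" "x0 \<notin> S" for Z W x0
    using that
  proof (induction Z arbitrary: W x0 rule: finite_induct)
    case empty
    then show ?case by auto
  next
    case (insert k Z)
    then have k: "k \<in> Y" by auto
    obtain x a where x: "x \<in> W" "x \<notin> S" "A k x - a *\<^sub>C x \<in> S"
      using eigenvector_mod[OF fd lin[OF k] S, of W x0] insert.prems k by blast
    let ?W = "{x \<in> W. A k x - a *\<^sub>C x \<in> S}"
    have "csubspace ?W"
    proof (rule csubspaceI)
      show "0 \<in> ?W"
        using csubspace_0[OF S] csubspace_0[OF insert.prems(2)]
        by (simp add: clinear_0[OF lin[OF k]])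
    next
      fix x y assume "x \<in> ?W" "y \<in> ?W"
      then have "x + y \<in> W" "(A k x - a *\<^sub>C x) + (A k y - a *\<^sub>C y) \<in> S"
        using csubspace_add[OF S] csubspace_add[OF insert.prems(2)] by auto
      then show "x + y \<in> ?W"
        by (simp add: clinear_add[OF lin[OF k]] scaleC_add_right algebra_simps)
    next
      fix c x assume "x \<in> ?W"
      then have "c *\<^sub>C x \<in> W" "c *\<^sub>C (A k x - a *\<^sub>C x) \<in> S"
        using csubspace_scale[OF S] csubspace_scale[OF insert.prems(2)] by auto
      then show "c *\<^sub>C x \<in> ?W"
        by (simp add: clinear_scale[OF lin[OF k]] complex_vector.scale_right_diff_distrib scaleC_scaleC mult.commute)
    qed
    moreover have "A y z \<in> ?W" if y: "y \<in> Y" and z: "z \<in> ?W" for y z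
    proof -
      have "A k (A y z) - a *\<^sub>C A y z = A y (A k z - a *\<^sub>C z)"
        by (simp add: clinear_diff[OF lin[OF y]] clinear_scale[OF lin[OF y]] comm[OF k y])
      then show ?thesis using z y stS insert.prems by auto
    qed
    ultimately obtain y \<mu> where y: "y \<in> ?W" "y \<notin> S" "\<forall>z\<in>Z. A z y - \<mu> z *\<^sub>C y \<in> S"
      using insert.IH[of ?W x] insert.prems x by blast
    then have "\<forall>z\<in>insert k Z. A z y - (\<mu>(k := a)) z *\<^sub>C y \<in> S"
      using insert.hyps by auto
    with y show ?case by blast
  qed
  from this[of Y UNIV] show ?thesis
    using assms by (auto simp: csubspace_UNIV)
qed

section \<open>Representations of \<open>sl\<^sub>2\<close> modulo a subspace\<close>

lemma subspace_diff_cancel: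
  fixes A B C :: "'a::complex_vector"
  assumes "csubspace J" "A \<in> J" "B \<in> J" "B - (A - C) \<in> J"
  shows "C \<in> J"
  using csubspace_diff[OF assms(1) assms(4) csubspace_diff[OF assms(1,3,2)]]
  by (simp add: algebra_simps)

lemma scale_in_subspace_iff:
  assumes "csubspace J"
  shows "c *\<^sub>C x \<in> J \<longleftrightarrow> c = 0 \<or> x \<in> J"
proof
  assume "c *\<^sub>C x \<in> J"
  from csubspace_scale[OF assms this, of "1 / c"] show "c = 0 \<or> x \<in> J"
    by (cases "c = 0") (simp_all add: scaleC_scaleC scaleC_one)
qed (auto simp: csubspace_0[OF assms] csubspace_scale[OF assms])

text \<open>The relations of sl_2 hold exactly and only the weight of v is taken modulo J. So these
  lemmas apply to ad with J = {0} and to left multiplication modulo a left ideal.\<close>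

lemma sl2_raise_weight:
  fixes e f h :: "'a::complex_vector \<Rightarrow> 'a"
  assumes J: "csubspace J" and lin: "clinear e" "clinear h"
    and stable: "\<And>x. x \<in> J \<Longrightarrow> e x \<in> J"
    and he: "\<And>x. h (e x) - e (h x) = 2 *\<^sub>C e x"
    and hv: "h v - m *\<^sub>C v \<in> J"
  shows "h ((e ^^ j) v) - (m + 2 * of_nat j) *\<^sub>C (e ^^ j) v \<in> J"
proof (induction j)
  case 0
  then show ?case using hv by simp
next
  case (Suc j)
  have "h ((e ^^ Suc j) v) = e (h ((e ^^ j) v)) + 2 *\<^sub>C (e ^^ Suc j) v"
    using he[of "(e ^^ j) v"] by (simp add: algebra_simps)
  then have "h ((e ^^ Suc j) v) - (m + 2 * of_nat (Suc j)) *\<^sub>C (e ^^ Suc j) v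
      = e (h ((e ^^ j) v) - (m + 2 * of_nat j) *\<^sub>C (e ^^ j) v)"
    by (simp add: clinear_diff[OF lin(1)] clinear_scale[OF lin(1)] clinear_add[OF lin(1)] algebra_simps scaleC_add_left)
  then show ?case using stable[OF Suc.IH] by simp
qed

text \<open>The factor (j+1)(m+j) is the sum of the weights m, m+2, ..., m+2j that arise when f is
  moved past j+1 copies of e.\<close>

lemma sl2_lower_raise:
  fixes e f h :: "'a::complex_vector \<Rightarrow> 'a"
  assumes J: "csubspace J" and lin: "clinear e" "clinear h"
    and stable: "\<And>x. x \<in> J \<Longrightarrow> e x \<in> J"
    and ef: "\<And>x. e (f x) - f (e x) = h x"
    and he: "\<And>x. h (e x) - e (h x) = 2 *\<^sub>C e x"
    and hv: "h v - m *\<^sub>C v \<in> J"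
  shows "f ((e ^^ Suc j) v) - ((e ^^ Suc j) (f v) - (of_nat (Suc j) * (m + of_nat j)) *\<^sub>C (e ^^ j) v) \<in> J"
proof (induction j)
  case 0
  have "f (e v) - (e (f v) - m *\<^sub>C v) = - (h v - m *\<^sub>C v)"
    using ef[of v] by (simp add: algebra_simps)
  then have "f (e v) - (e (f v) - m *\<^sub>C v) \<in> J" by (simp only: csubspace_neg[OF J hv])
  then show ?case by simp
next
  case (Suc j)
  let ?w = "(e ^^ Suc j) v"
  let ?r = "f ?w - ((e ^^ Suc j) (f v) - (of_nat (Suc j) * (m + of_nat j)) *\<^sub>C (e ^^ j) v)"
  let ?k = "m + 2 * of_nat (Suc j)"
  have 1: "f (e ?w) = e (f ?w) - h ?w"
    using ef[of ?w] by (simp add: algebra_simps)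
  have 2: "e ?r = e (f ?w) - (e ^^ Suc (Suc j)) (f v) + (of_nat (Suc j) * (m + of_nat j)) *\<^sub>C ?w"
    by (simp add: clinear_diff[OF lin(1)] clinear_scale[OF lin(1)])
  have 3: "(of_nat (Suc (Suc j)) * (m + of_nat (Suc j))) = of_nat (Suc j) * (m + of_nat j) + ?k"
    by (simp add: algebra_simps)
  have "f ((e ^^ Suc (Suc j)) v) - ((e ^^ Suc (Suc j)) (f v) -
      (of_nat (Suc (Suc j)) * (m + of_nat (Suc j))) *\<^sub>C (e ^^ Suc j) v)
    = e ?r - (h ?w - ?k *\<^sub>C ?w)"
    unfolding 2 3 scaleC_add_left using 1 by (simp add: algebra_simps del: of_nat_Suc)
  moreover have "e ?r \<in> J" using Suc.IH stable by blast
  ultimately show ?case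
    using sl2_raise_weight[OF J lin stable he hv, of "Suc j"] csubspace_diff[OF J] by metis
qed

text \<open>With e f v = 0 the identity of \<open>sl2_lower_raise\<close> becomes f e^(j+1) v =
  -(j+1)(m+j) e^j v, so vanishing descends from e^k v to v.\<close>

lemma sl2_eq_0_of_raise_lower:
  fixes e f h :: "'a::complex_vector \<Rightarrow> 'a"
  assumes J: "csubspace J" and lin: "clinear e" "clinear f" "clinear h"
    and stable: "\<And>x. x \<in> J \<Longrightarrow> e x \<in> J" "\<And>x. x \<in> J \<Longrightarrow> f x \<in> J"
    and ef: "\<And>x. e (f x) - f (e x) = h x"
    and he: "\<And>x. h (e x) - e (h x) = 2 *\<^sub>C e x"
    and hv: "h v - m *\<^sub>C v \<in> J" and efv: "e (f v) \<in> J"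
    and m: "\<And>j. j < k \<Longrightarrow> m + of_nat j \<noteq> 0" and nil: "(e ^^ k) v \<in> J"
  shows "v \<in> J"
  using m nil
proof (induction k)
  case 0
  then show ?case by simp
next
  case (Suc j)
  have "(e ^^ Suc j) (f v) = (e ^^ j) (e (f v))" by (simp only: funpow_Suc_right o_apply)
  moreover have "(e ^^ j) x \<in> J" if "x \<in> J" for x by (induction j) (auto simp: that stable)
  ultimately have 1: "(e ^^ Suc j) (f v) \<in> J" using efv by simp
  have 2: "f ((e ^^ Suc j) v) \<in> J" using Suc.prems stable by blast
  let ?c = "of_nat (Suc j) * (m + of_nat j)"
  have "?c *\<^sub>C (e ^^ j) v \<in> J"
    using subspace_diff_cancel[OF J 1 2 sl2_lower_raise[OF J lin(1,3) stable(1) ef he hv, of j]] .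
  then have "(1 / ?c) *\<^sub>C (?c *\<^sub>C (e ^^ j) v) \<in> J" by (rule csubspace_scale[OF J])
  moreover have "?c \<noteq> 0" using Suc.prems(1)[of j] by (simp del: of_nat_Suc)
  ultimately have "(e ^^ j) v \<in> J" by (simp only: scaleC_scaleC) (simp add: scaleC_one del: of_nat_Suc)
  then show ?case using Suc by simp
qed

lemma last_nonmember:
  fixes e :: "'a \<Rightarrow> 'a"
  assumes "v \<notin> J" "(e ^^ k) v \<in> J"
  obtains q where "(e ^^ q) v \<notin> J" "(e ^^ Suc q) v \<in> J"
proof -
  define k' where "k' = (LEAST k. (e ^^ k) v \<in> J)"
  have k': "(e ^^ k') v \<in> J" unfolding k'_def using assms(2) by (rule LeastI)
  then have "k' \<noteq> 0" using assms(1) by (intro notI) simp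
  then obtain q where q: "k' = Suc q" by (cases k') auto
  then have "(e ^^ q) v \<notin> J" using not_less_Least[of q "\<lambda>k. (e ^^ k) v \<in> J"] by (simp add: k'_def)
  with k' q that show thesis by simp
qed

text \<open>The last nonzero vector y = e^q v has weight m + 2q and is killed by e. If f^p y is the
  last nonzero vector below it, \<open>sl2_lower_raise\<close> with e and f exchanged forces m + 2q
  = p.\<close>

lemma sl2_string:
  fixes e f h :: "'a::complex_vector \<Rightarrow> 'a"
  assumes J: "csubspace J" and lin: "clinear e" "clinear f" "clinear h"
    and stable: "\<And>x. x \<in> J \<Longrightarrow> e x \<in> J" "\<And>x. x \<in> J \<Longrightarrow> f x \<in> J"
    and ef: "\<And>x. e (f x) - f (e x) = h x"
    and he: "\<And>x. h (e x) - e (h x) = 2 *\<^sub>C e x"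
    and hf: "\<And>x. h (f x) - f (h x) = (- 2) *\<^sub>C f x"
    and hv: "h v - m *\<^sub>C v \<in> J" and v: "v \<notin> J"
    and nil_e: "\<exists>k. (e ^^ k) v \<in> J" and nil_f: "\<And>q. \<exists>k. (f ^^ k) ((e ^^ q) v) \<in> J"
  shows "\<exists>q p. m = of_nat p - 2 * of_nat q \<and> (\<forall>j\<le>p. (f ^^ j) ((e ^^ q) v) \<notin> J)"
proof -
  obtain q where q: "(e ^^ q) v \<notin> J" "(e ^^ Suc q) v \<in> J"
    using last_nonmember[OF v] nil_e by blast
  let ?y = "(e ^^ q) v"
  obtain p where p: "(f ^^ p) ?y \<notin> J" "(f ^^ Suc p) ?y \<in> J"
    using last_nonmember[OF q(1)] nil_f by blast
  \<comment> \<open>Exchanging e and f replaces h by its negative.\<close>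
  let ?h = "\<lambda>x. - h x" and ?m = "m + 2 * of_nat q"
  have "h ?y - ?m *\<^sub>C ?y \<in> J"
    by (rule sl2_raise_weight[OF J lin(1,3) stable(1) he hv])
  then have "- (h ?y - ?m *\<^sub>C ?y) \<in> J" by (rule csubspace_neg[OF J])
  then have hy: "?h ?y - (- ?m) *\<^sub>C ?y \<in> J"
    by (simp only: complex_vector.scale_minus_left minus_diff_minus)
  have linh: "clinear ?h" using lin(3) by (simp add: clinear_def)
  have fe: "f (e x) - e (f x) = ?h x" for x using ef[of x] by (simp add: algebra_simps)
  have hf': "?h (f x) - f (?h x) = 2 *\<^sub>C f x" for x
    using hf[of x] by (simp add: clinear_minus[OF lin(2)] algebra_simps)
  have fJ: "(f ^^ j) x \<in> J" if "x \<in> J" for x j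
    by (induction j) (auto simp: that stable)
  have "(f ^^ Suc p) (e ?y) \<in> J" using q(2) fJ[of "e ?y" "Suc p"] by simp
  moreover have "e ((f ^^ Suc p) ?y) \<in> J" using p stable by blast
  moreover have "e ((f ^^ Suc p) ?y) - ((f ^^ Suc p) (e ?y) - (of_nat (Suc p) * (- ?m + of_nat p)) *\<^sub>C (f ^^ p) ?y) \<in> J"
    by (rule sl2_lower_raise[OF J lin(2) linh stable(2) fe hf' hy])
  ultimately have "(of_nat (Suc p) * (- ?m + of_nat p)) *\<^sub>C (f ^^ p) ?y \<in> J"
    by (rule subspace_diff_cancel[OF J])
  then have "of_nat (Suc p) * (- ?m + of_nat p) = (0 :: complex)"
    using p(1) scale_in_subspace_iff[OF J] by blast
  then have "m = of_nat p - 2 * of_nat q"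
  proof -
    assume "of_nat (Suc p) * (- ?m + of_nat p) = (0 :: complex)"
    then have "- ?m + of_nat p = 0" by (simp only: mult_eq_0_iff of_nat_eq_0_iff) simp
    then show ?thesis by (simp add: algebra_simps)
  qed
  moreover have "(f ^^ j) ?y \<notin> J" if "j \<le> p" for j
  proof
    assume "(f ^^ j) ?y \<in> J"
    then have "(f ^^ (p - j)) ((f ^^ j) ?y) \<in> J" by (rule fJ)
    then have "(f ^^ (p - j + j)) ?y \<in> J" by (simp only: funpow_add o_apply)
    with p that show False by simp
  qed
  ultimately show ?thesis by blast
qed

section \<open>Root systems of simple Lie algebras\<close>

lemma lie_lie_left: "lie h (lie x y) = lie (lie h x) y + lie x (lie h y)"
  for h x y :: "'g::complex_lie_algebra"
  using jacobi[of h x y] lie_anticomm[of y "lie h x"] lie_anticomm[of y h]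
  by (simp add: lie_minus_right algebra_simps eq_neg_iff_add_eq_0)

locale cartan_setting =
  fixes D :: "'g::complex_lie_algebra cartan_data"
  assumes fd: "finite_dimensional_lie TYPE('g)" and simple: "simple_lie TYPE('g)"
    and cartan_data: "is_cartan_data D"
begin

abbreviation "H \<equiv> cartan D"
abbreviation "I \<equiv> index_set D"
abbreviation "rs \<equiv> root_space H"
abbreviation "R \<equiv> roots H"
abbreviation "Rpos \<equiv> positive_roots D"
abbreviation "sr \<equiv> simple_root D"

section \<open>Functionals on the Cartan subalgebra and root spaces\<close>

lemma cartan: "cartan_subalgebra H"
  and rank: "rank D = complex_vector.dim H"
  and simple_system: "simple_system D"
  and triple_data: "\<alpha> \<in> Rpos \<Longrightarrow> xplus D \<alpha> \<in> rs \<alpha> - {0} \<and> xminus D \<alpha> \<in> rs (\<lambda>h. - \<alpha> h) - {0} \<and>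
     coroot D \<alpha> \<in> H \<and> lie (xplus D \<alpha>) (xminus D \<alpha>) = coroot D \<alpha> \<and>
     lie (coroot D \<alpha>) (xplus D \<alpha>) = 2 *\<^sub>C xplus D \<alpha> \<and>
     lie (coroot D \<alpha>) (xminus D \<alpha>) = (- 2) *\<^sub>C xminus D \<alpha>"
  using cartan_data unfolding is_cartan_data_def by simp_all

lemma subspace_H: "csubspace H"
  using cartan by (simp add: cartan_subalgebra_def lie_subalgebra_def)

lemma lie_H: "x \<in> H \<Longrightarrow> y \<in> H \<Longrightarrow> lie x y \<in> H"
  using cartan by (simp add: cartan_subalgebra_def lie_subalgebra_def)

lemma normalizer_H: "(\<And>h. h \<in> H \<Longrightarrow> lie x h \<in> H) \<Longrightarrow> x \<in> H"
  using cartan by (auto simp: cartan_subalgebra_def)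

lemma normalizer_H': "(\<And>h. h \<in> H \<Longrightarrow> lie h x \<in> H) \<Longrightarrow> x \<in> H"
  by (rule normalizer_H) (metis lie_anticomm csubspace_neg[OF subspace_H])

lemma finite_basis: obtains B :: "'g set" where "finite B" "cspan B = UNIV"
  using fd unfolding finite_dimensional_lie_def by blast

lemma finite_independent: "cindependent (B :: 'g set) \<Longrightarrow> finite B"
  by (metis cindependent_span_bound finite_basis subset_UNIV)

lemma dual_zero: "(\<lambda>_. 0) \<in> dual A"
  by (simp add: dual_def)

lemma dual_comb: "\<alpha> \<in> dual A \<Longrightarrow> \<beta> \<in> dual A \<Longrightarrow> (\<lambda>h. \<alpha> h + c * \<beta> h) \<in> dual A"
  by (simp add: dual_def algebra_simps)

lemma dual_minus: "\<alpha> \<in> dual A \<Longrightarrow> (\<lambda>h. - \<alpha> h) \<in> dual A"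
  by (simp add: dual_def)

lemma dual_add: "\<alpha> \<in> dual A \<Longrightarrow> x \<in> A \<Longrightarrow> y \<in> A \<Longrightarrow> \<alpha> (x + y) = \<alpha> x + \<alpha> y"
  and dual_scale: "\<alpha> \<in> dual A \<Longrightarrow> x \<in> A \<Longrightarrow> \<alpha> (c *\<^sub>C x) = c * \<alpha> x"
  and dual_outside: "\<alpha> \<in> dual A \<Longrightarrow> x \<notin> A \<Longrightarrow> \<alpha> x = 0"
  by (simp_all add: dual_def)

lemma dual_neg: "\<alpha> \<in> dual H \<Longrightarrow> x \<in> H \<Longrightarrow> \<alpha> (- x) = - \<alpha> x"
  using dual_scale[of \<alpha> H x "-1"] by simp

lemma dual_sum:
  assumes "\<alpha> \<in> dual H" "\<And>i. i \<in> A \<Longrightarrow> f i \<in> H"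
  shows "\<alpha> (sum f A) = (\<Sum>i\<in>A. \<alpha> (f i))"
  using assms(2)
proof (induction A rule: infinite_finite_induct)
  case (insert i A)
  then show ?case
    using csubspace_sum[OF subspace_H, of A f] by (simp add: dual_add[OF assms(1)])
qed (use dual_scale[OF assms(1) csubspace_0[OF subspace_H], of 0] in simp_all)

lemma roots_dual: "\<alpha> \<in> R \<Longrightarrow> \<alpha> \<in> dual H"
  and roots_nonzero: "\<alpha> \<in> R \<Longrightarrow> \<alpha> \<noteq> (\<lambda>_. 0)"
  by (simp_all add: roots_def)

lemma roots_obtain: assumes "\<alpha> \<in> R" obtains x where "x \<in> rs \<alpha>" "x \<noteq> 0"
proof -
  have "0 \<in> rs \<alpha>" by (simp add: root_space_def)
  with assms that show thesis by (auto simp: roots_def)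
qed

lemma rootsI: "\<alpha> \<in> dual H \<Longrightarrow> \<alpha> \<noteq> (\<lambda>_. 0) \<Longrightarrow> x \<in> rs \<alpha> \<Longrightarrow> x \<noteq> 0 \<Longrightarrow> \<alpha> \<in> R"
  by (auto simp: roots_def)

lemma subspace_rs: "csubspace (rs \<alpha>)"
  by (rule csubspaceI)
    (auto simp: root_space_def lie_add_right lie_scaleC_right scaleC_add_right scaleC_scaleC mult.commute)

lemma lie_rs: "x \<in> rs \<alpha> \<Longrightarrow> y \<in> rs \<beta> \<Longrightarrow> lie x y \<in> rs (\<lambda>h. \<alpha> h + \<beta> h)"
  by (simp add: root_space_def lie_lie_left lie_scaleC_left lie_scaleC_right scaleC_add_left)

lemma rs_cong: "(\<And>h. h \<in> H \<Longrightarrow> \<alpha> h = \<beta> h) \<Longrightarrow> rs \<alpha> = rs \<beta>"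
  by (auto simp: root_space_def)

lemma simple_roots: "i \<in> I \<Longrightarrow> sr i \<in> R"
  and simple_roots_independent: "(\<And>h. h \<in> H \<Longrightarrow> (\<Sum>i\<in>I. c i * sr i h) = 0) \<Longrightarrow> i \<in> I \<Longrightarrow> c i = 0"
  and roots_signed: "\<alpha> \<in> R \<Longrightarrow> \<alpha> \<in> positive_cone D \<or> (\<lambda>h. - \<alpha> h) \<in> positive_cone D"
  using simple_system unfolding simple_system_def by blast+

text \<open>Both elements of H act on a root vector by scalars, so their bracket acts by 0. As the
  simple roots separate the points of H, this makes H abelian.\<close>

lemma root_vanishes_on_bracket:
  assumes "\<alpha> \<in> R" "h \<in> H" "h' \<in> H"
  shows "\<alpha> (lie h h') = 0"
proof -
  obtain x where x: "x \<in> rs \<alpha>" "x \<noteq> 0" using roots_obtain assms by blast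
  have "lie (lie h h') x = lie h (lie h' x) - lie h' (lie h x)"
    using lie_lie_left[of h h' x] by simp
  also have "\<dots> = 0"
    using x assms by (simp add: root_space_def lie_scaleC_right scaleC_scaleC mult.commute)
  finally have "\<alpha> (lie h h') *\<^sub>C x = 0"
    using x lie_H[OF assms(2,3)] by (simp add: root_space_def)
  with x show ?thesis by simp
qed

text \<open>There are dim H independent simple roots. If h is nonzero, extend it to a basis of H:
  the conditions at the other basis vectors are fewer than the simple roots, so a nontrivial
  combination of these vanishes there, and at h by assumption.\<close>

lemma eq_0_of_simple_roots:
  assumes h: "h \<in> H" and 0: "\<And>i. i \<in> I \<Longrightarrow> sr i h = 0"
  shows "h = 0"
proof (rule ccontr)
  assume "h \<noteq> 0"
  then have "cindependent {h}" by simp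
  then obtain B where B: "{h} \<subseteq> B" "B \<subseteq> H" "cindependent B" "H \<subseteq> cspan B"
    using complex_vector.maximal_independent_subset_extend[of "{h}" H] h by auto
  have fin: "finite B" using B finite_independent by blast
  have card: "card B = rank D" using B by (simp add: rank complex_vector.basis_card_eq_dim)
  have "card (B - {h}) < card I" using B(1) card card_Diff1_less[OF fin, of h] by simp
  then obtain c where c: "\<exists>i\<in>I. c i \<noteq> 0" "\<forall>b\<in>B - {h}. (\<Sum>i\<in>I. c i * sr i b) = 0"
    using homogeneous_system[of "B - {h}" I sr] fin by auto
  have "(\<Sum>i\<in>I. c i * sr i x) = 0" if "x \<in> H" for x
  proof -
    from that B(4) have "x \<in> cspan B" by blast
    then obtain a where a: "x = (\<Sum>b\<in>B. a b *\<^sub>C b)"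
      by (rule span_finite_obtain[OF fin])
    have "(\<Sum>i\<in>I. c i * sr i x) = (\<Sum>i\<in>I. c i * (\<Sum>b\<in>B. a b * sr i b))"
    proof (rule sum.cong[OF refl])
      fix i assume "i \<in> I"
      then have d: "sr i \<in> dual H" using simple_roots roots_dual by blast
      have "sr i x = (\<Sum>b\<in>B. a b * sr i b)"
        unfolding a using B(2)
        by (subst dual_sum[OF d]) (auto intro!: sum.cong dual_scale[OF d] csubspace_scale[OF subspace_H])
      then show "c i * sr i x = c i * (\<Sum>b\<in>B. a b * sr i b)" by simp
    qed
    also have "\<dots> = (\<Sum>b\<in>B. a b * (\<Sum>i\<in>I. c i * sr i b))"
      unfolding sum_distrib_left by (subst sum.swap) (simp add: mult_ac)
    also have "\<dots> = 0" using c(2) 0 by (intro sum.neutral) auto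
    finally show ?thesis .
  qed
  then show False using simple_roots_independent c(1) by blast
qed

lemma abelian_H: "h \<in> H \<Longrightarrow> h' \<in> H \<Longrightarrow> lie h h' = 0"
  by (rule eq_0_of_simple_roots) (auto simp: lie_H root_vanishes_on_bracket simple_roots)

text \<open>The simple roots are a basis of the dual of H, so values for them can be prescribed. At
  this element a root takes its height as value.\<close>

lemma ex_rho: "\<exists>\<rho>\<in>H. \<forall>i\<in>I. sr i \<rho> = 1"
proof -
  obtain B where B: "B \<subseteq> H" "cindependent B" "H \<subseteq> cspan B" "card B = rank D"
    using complex_vector.basis_exists[of H] rank by metis
  have fin: "finite B" using B finite_independent by blast
  \<comment> \<open>The unknown \<open>None\<close> stands for the common value of the simple roots
    at h. This turns the inhomogeneous system into a homogeneous one with one unknown more than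
    equations.\<close>
  define a where "a b i = (case b of None \<Rightarrow> -1 | Some b \<Rightarrow> sr i b)" for b i
  have "card I < card (insert None (Some ` B))"
    using fin B(4) by (simp add: card_image)
  then obtain c where c: "\<exists>b\<in>insert None (Some ` B). c b \<noteq> 0" "\<forall>i\<in>I. (\<Sum>b\<in>insert None (Some ` B). c b * a b i) = 0"
    using homogeneous_system[of I "insert None (Some ` B)" a] fin by auto
  define h where "h = (\<Sum>b\<in>B. c (Some b) *\<^sub>C b)"
  have hH: "h \<in> H"
    unfolding h_def using B(1) by (intro csubspace_sum[OF subspace_H] csubspace_scale[OF subspace_H]) auto
  have h: "sr i h = c None" if i: "i \<in> I" for i
  proof -
    have d: "sr i \<in> dual H" using simple_roots roots_dual i by blast
    have "sr i h = (\<Sum>b\<in>B. c (Some b) * sr i b)"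
      unfolding h_def using B(1)
      by (subst dual_sum[OF d]) (auto intro!: sum.cong dual_scale[OF d] csubspace_scale[OF subspace_H])
    moreover have "(\<Sum>b\<in>insert None (Some ` B). c b * a b i) = - c None + (\<Sum>b\<in>B. c (Some b) * sr i b)"
      using fin by (simp add: a_def sum.reindex)
    ultimately show ?thesis using c(2) i by simp
  qed
  have "c None \<noteq> 0"
  proof
    assume "c None = 0"
    then have "h = 0" using h hH by (intro eq_0_of_simple_roots) auto
    moreover obtain b where "b \<in> B" "c (Some b) \<noteq> 0" using c(1) \<open>c None = 0\<close> by auto
    ultimately show False
      using cindependentD[OF B(2) fin subset_refl, of "\<lambda>b. c (Some b)" b] by (simp add: h_def)
  qed
  then have "\<forall>i\<in>I. sr i ((1 / c None) *\<^sub>C h) = 1"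
    using h hH by (simp add: dual_scale[OF roots_dual[OF simple_roots]])
  then show ?thesis using hH csubspace_scale[OF subspace_H] by blast
qed

definition "rho = (SOME \<rho>. \<rho> \<in> H \<and> (\<forall>i\<in>I. sr i \<rho> = 1))"

lemma rho: "rho \<in> H" "i \<in> I \<Longrightarrow> sr i rho = 1"
proof -
  have "rho \<in> H \<and> (\<forall>i\<in>I. sr i rho = 1)"
    unfolding rho_def by (rule someI_ex) (use ex_rho in blast)
  then show "rho \<in> H" "i \<in> I \<Longrightarrow> sr i rho = 1" by auto
qed

text \<open>Self-normalization enters here: what commutes with H normalizes H.\<close>

lemma rs_zero: "rs (\<lambda>_. 0) = H"
proof
  show "rs (\<lambda>_. 0) \<subseteq> H"
  proof
    fix x assume "x \<in> rs (\<lambda>_. 0)"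
    then have "lie h x = 0" if "h \<in> H" for h using that by (simp add: root_space_def)
    then show "x \<in> H" using csubspace_0[OF subspace_H] normalizer_H' by simp
  qed
  show "H \<subseteq> rs (\<lambda>_. 0)" by (auto simp: root_space_def abelian_H)
qed

lemma rs_independent:
  assumes "finite F" "F \<subseteq> dual H" "\<And>\<alpha>. \<alpha> \<in> F \<Longrightarrow> v \<alpha> \<in> rs \<alpha>" "(\<Sum>\<alpha>\<in>F. v \<alpha>) = 0" "\<alpha> \<in> F"
  shows "v \<alpha> = 0"
proof -
  have "v \<alpha> \<in> {0}"
  proof (rule weight_vectors_independent_mod[where Y = H and A = lie and w = "\<lambda>\<alpha>. \<alpha>" and F = F])
    \<comment> \<open>Elements of the dual vanish off H, so two different ones differ at a point of
      H.\<close>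
    show "\<exists>y\<in>H. i y \<noteq> j y" if "i \<in> F" "j \<in> F" "i \<noteq> j" for i j
      using that assms(2) dual_outside by (metis subsetD ext)
  qed (use assms in \<open>auto simp: clinear_lie root_space_def\<close>)
  then show ?thesis by simp
qed

lemma finite_weights: "finite {\<alpha> \<in> dual H. rs \<alpha> \<noteq> {0}}"
proof (rule ccontr)
  obtain B :: "'g set" where B: "finite B" "cspan B = UNIV" by (rule finite_basis)
  assume "infinite {\<alpha> \<in> dual H. rs \<alpha> \<noteq> {0}}"
  then obtain F where F: "finite F" "card F = Suc (card B)" "F \<subseteq> {\<alpha> \<in> dual H. rs \<alpha> \<noteq> {0}}"
    using infinite_arbitrarily_large by blast
  have "\<exists>x. x \<in> rs \<alpha> \<and> x \<noteq> 0" if "\<alpha> \<in> F" for \<alpha>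
    using F(3) that csubspace_0[OF subspace_rs, of \<alpha>] by auto
  then obtain v where v: "\<And>\<alpha>. \<alpha> \<in> F \<Longrightarrow> v \<alpha> \<in> rs \<alpha> \<and> v \<alpha> \<noteq> 0" by metis
  have "\<exists>b\<in>cspan B. v \<alpha> - b \<in> {0}" for \<alpha> using B(2) by (intro bexI[of _ "v \<alpha>"]) auto
  then obtain c where c: "\<exists>i\<in>F. c i \<noteq> 0" "(\<Sum>i\<in>F. c i *\<^sub>C v i) \<in> {0}"
    using dependent_mod[of "{0}" B F v] B F by auto
  then have "c \<alpha> *\<^sub>C v \<alpha> = 0" if "\<alpha> \<in> F" for \<alpha>
    using rs_independent[of F "\<lambda>\<alpha>. c \<alpha> *\<^sub>C v \<alpha>" \<alpha>] F that v csubspace_scale[OF subspace_rs]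
    by auto
  with c v show False by auto
qed

lemma finite_R: "finite R"
  by (rule finite_subset[OF _ finite_weights]) (auto simp: roots_def)

text \<open>Powers of ad x move y through the weights \<alpha> + k \<beta>, which are distinct, and
  only finitely many weight spaces are nonzero.\<close>

lemma ad_nilpotent_weight:
  assumes "x \<in> rs \<beta>" "\<beta> \<in> dual H" "\<beta> \<noteq> (\<lambda>_. 0)" "y \<in> rs \<alpha>" "\<alpha> \<in> dual H"
  shows "\<exists>k. (lie x ^^ k) y = 0"
proof (rule ccontr)
  assume n: "\<nexists>k. (lie x ^^ k) y = 0"
  let ?w = "\<lambda>k h. \<alpha> h + of_nat k * \<beta> h"
  have "(lie x ^^ k) y \<in> rs (?w k)" for k
  proof (induction k)
    case (Suc k)
    have "rs (\<lambda>h. \<beta> h + ?w k h) = rs (?w (Suc k))" by (rule rs_cong) (simp add: algebra_simps)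
    then show ?case using lie_rs[OF assms(1) Suc] by simp
  qed (use assms in simp)
  then have "rs (?w k) \<noteq> {0}" for k using n by (metis singletonD)
  then have "range ?w \<subseteq> {\<alpha> \<in> dual H. rs \<alpha> \<noteq> {0}}"
    using dual_comb[OF assms(5,2)] by auto
  then have "finite (range ?w)" using finite_weights finite_subset by blast
  moreover have "inj ?w"
  proof
    fix k l assume "?w k = ?w l"
    then have kl: "of_nat k * \<beta> h = (of_nat l :: complex) * \<beta> h" for h by (auto dest: fun_cong[where x = h])
    moreover obtain h where "\<beta> h \<noteq> 0" using assms(3) by auto
    ultimately have "(of_nat k :: complex) = of_nat l" using kl[of h] by simp
    then show "k = l" by simp
  qed
  ultimately show False using finite_imageD infinite_UNIV_nat by blast
qed

section \<open>Triples of sl_2 attached to roots\<close>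

definition triple :: "('g \<Rightarrow> complex) \<Rightarrow> 'g \<Rightarrow> 'g \<Rightarrow> 'g \<Rightarrow> bool"
  where "triple \<beta> e f h \<longleftrightarrow> \<beta> \<in> dual H \<and> e \<in> rs \<beta> \<and> f \<in> rs (\<lambda>h. - \<beta> h) \<and> h \<in> H \<and> lie e f = h \<and> \<beta> h = 2"

lemma positive_roots: "\<beta> \<in> Rpos \<Longrightarrow> \<beta> \<in> R" "\<beta> \<in> Rpos \<Longrightarrow> \<beta> \<in> positive_cone D"
  by (simp_all add: positive_roots_def)

lemma triple_positive:
  assumes "\<beta> \<in> Rpos"
  shows "triple \<beta> (xplus D \<beta>) (xminus D \<beta>) (coroot D \<beta>)"
proof -
  note t = triple_data[OF assms]
  have "lie (coroot D \<beta>) (xplus D \<beta>) = \<beta> (coroot D \<beta>) *\<^sub>C xplus D \<beta>"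
    using t unfolding root_space_def by blast
  then have "(\<beta> (coroot D \<beta>) - 2) *\<^sub>C xplus D \<beta> = 0"
    using t by (simp add: complex_vector.scale_left_diff_distrib)
  then have "\<beta> (coroot D \<beta>) = 2" using t by (simp only: complex_vector.scale_eq_0_iff) simp
  then show ?thesis
    using t roots_dual[OF positive_roots(1)[OF assms]] unfolding triple_def by blast
qed

lemma tripleD:
  assumes "triple \<beta> e f h"
  shows "\<beta> \<in> dual H" "e \<in> rs \<beta>" "f \<in> rs (\<lambda>h. - \<beta> h)" "h \<in> H" "lie e f = h" "\<beta> h = 2"
  using assms unfolding triple_def by blast+

text \<open>Attaches a triple to the negative of a positive root, so that a statement about triples
  can be used in both directions of a root string.\<close>

lemma triple_swap: assumes "triple \<beta> e f h" shows "triple (\<lambda>h. - \<beta> h) f e (- h)"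
proof -
  have "lie f e = - h" using lie_anticomm[of f e] tripleD(5)[OF assms] by simp
  moreover have "- \<beta> (- h) = 2" using dual_neg[OF tripleD(1,4)[OF assms]] tripleD(6)[OF assms] by simp
  moreover have "- h \<in> H" by (rule csubspace_neg[OF subspace_H tripleD(4)[OF assms]])
  moreover have "e \<in> rs (\<lambda>h. - (- \<beta> h))" using tripleD(2)[OF assms] by simp
  ultimately show ?thesis
    unfolding triple_def using dual_minus[OF tripleD(1)[OF assms]] tripleD(3)[OF assms] by blast
qed

lemma triple_nonzero: assumes "triple \<beta> e f h" shows "\<beta> \<noteq> (\<lambda>_. 0)" "h \<noteq> 0"
proof -
  show "\<beta> \<noteq> (\<lambda>_. 0)" using tripleD(6)[OF assms] by auto
  have "\<beta> 0 = 0"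
    using dual_scale[OF tripleD(1)[OF assms] csubspace_0[OF subspace_H], of 0] by simp
  then show "h \<noteq> 0" using tripleD(6)[OF assms] by auto
qed

lemma triple_sl2:
  assumes "triple \<beta> e f h"
  shows "lie e (lie f x) - lie f (lie e x) = lie h x"
    and "lie h (lie e x) - lie e (lie h x) = 2 *\<^sub>C lie e x"
    and "lie h (lie f x) - lie f (lie h x) = (- 2) *\<^sub>C lie f x"
proof -
  have *: "lie a (lie b x) - lie b (lie a x) = lie (lie a b) x" for a b
    using lie_lie_left[of a b x] by simp
  have "lie h e = \<beta> h *\<^sub>C e" "lie h f = (- \<beta> h) *\<^sub>C f" "lie e f = h"
    using tripleD[OF assms] unfolding root_space_def by blast+
  then have "lie h e = 2 *\<^sub>C e" "lie h f = (- 2) *\<^sub>C f" "lie e f = h"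
    unfolding tripleD(6)[OF assms] by simp_all
  then show "lie e (lie f x) - lie f (lie e x) = lie h x"
    "lie h (lie e x) - lie e (lie h x) = 2 *\<^sub>C lie e x"
    "lie h (lie f x) - lie f (lie h x) = (- 2) *\<^sub>C lie f x"
    unfolding * by (simp_all only: lie_scaleC_left)
qed

text \<open>As ad e is nilpotent at y, \<open>sl2_eq_0_of_raise_lower\<close> applies. It yields
  that root spaces are one-dimensional and that lowering a root vector of positive weight does not
  give 0.\<close>

lemma triple_kernel:
  assumes t: "triple \<beta> e f h" and y: "y \<in> rs \<alpha>" "\<alpha> \<in> dual H"
    and m: "\<And>j :: nat. \<alpha> h + of_nat j \<noteq> 0" and ef: "lie e (lie f y) = 0"
  shows "y = 0"
proof -
  obtain k where k: "(lie e ^^ k) y = 0"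
    using ad_nilpotent_weight[OF tripleD(2,1)[OF t] triple_nonzero(1)[OF t] y] by blast
  have hy: "lie h y - \<alpha> h *\<^sub>C y \<in> {0}"
    using y tripleD(4)[OF t] by (simp add: root_space_def)
  have "y \<in> {0}"
    by (rule sl2_eq_0_of_raise_lower[OF csubspace_single_0 clinear_lie clinear_lie clinear_lie
          _ _ triple_sl2(1,2)[OF t] hy, where k = k]) (use k ef m in auto)
  then show ?thesis by simp
qed

text \<open>After a suitable multiple of e is added to y, \<beta> vanishes on [f, y], so this
  element of H commutes with e and \<open>triple_kernel\<close> applies.\<close>

lemma triple_root_space:
  assumes t: "triple \<beta> e f h" and y: "y \<in> rs \<beta>"
  shows "\<exists>c. y = c *\<^sub>C e"
proof -
  \<comment> \<open>Since [f, e] = -h and \<beta>(h) = 2, adding c e to y changes \<beta>([f, y]) by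
    -2c.\<close>
  define c where "c = \<beta> (lie f y) / 2"
  define y' where "y' = y + c *\<^sub>C e"
  note t' = tripleD[OF t]
  have H: "lie f y \<in> H"
    using lie_rs[OF t'(3) y] rs_zero by simp
  have fy': "lie f y' = lie f y - c *\<^sub>C h"
    using lie_anticomm[of f e] by (simp add: y'_def lie_add_right lie_scaleC_right t'(5))
  have ch: "c *\<^sub>C h \<in> H" using t'(4) csubspace_scale[OF subspace_H] by blast
  then have H': "lie f y' \<in> H" unfolding fy' by (intro csubspace_diff[OF subspace_H] H)
  have "\<beta> (lie f y + (- c) *\<^sub>C h) = 0"
    using H t' csubspace_scale[OF subspace_H t'(4), of "- c"]
    by (simp add: dual_add dual_scale c_def del: complex_vector.scale_minus_left)
  then have "\<beta> (lie f y') = 0" by (simp add: fy')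
  then have "lie (lie f y') e = 0" using t'(2) H' by (simp add: root_space_def)
  then have "lie e (lie f y') = 0" using lie_anticomm[of e "lie f y'"] by simp
  moreover have "y' \<in> rs \<beta>"
    unfolding y'_def by (intro csubspace_add[OF subspace_rs] csubspace_scale[OF subspace_rs] y t')
  moreover have "\<beta> h + of_nat j \<noteq> 0" for j
  proof -
    have "\<beta> h + of_nat j = of_nat (Suc (Suc j))" by (simp add: t'(6))
    then show ?thesis by (simp only: of_nat_eq_0_iff)
  qed
  ultimately have "y' = 0" using triple_kernel[OF t, of y' \<beta>] t'(1) by blast
  then show ?thesis by (intro exI[of _ "- c"]) (simp add: y'_def add_eq_0_iff)
qed

lemma triple_string_aux:
  assumes t: "triple \<beta> e f h" and \<alpha>: "\<alpha> \<in> dual H" and v: "v \<in> rs \<alpha>" "v \<noteq> 0"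
  shows "\<exists>n::int. \<alpha> h = of_int n \<and> (n \<ge> 0 \<longrightarrow> rs (\<lambda>x. \<alpha> x - of_int n * \<beta> x) \<noteq> {0})"
proof -
  note t' = tripleD[OF t]
  note nz = triple_nonzero(1)[OF t]
  have e: "(lie e ^^ q) v \<in> rs (\<lambda>x. \<alpha> x + of_nat q * \<beta> x)" for q
  proof (induction q)
    case (Suc q)
    have "rs (\<lambda>x. \<beta> x + (\<alpha> x + of_nat q * \<beta> x)) = rs (\<lambda>x. \<alpha> x + of_nat (Suc q) * \<beta> x)"
      by (rule rs_cong) (simp add: algebra_simps)
    then show ?case using lie_rs[OF t'(2) Suc] by simp
  qed (use v in simp)
  have f: "(lie f ^^ j) ((lie e ^^ q) v) \<in> rs (\<lambda>x. \<alpha> x + (of_nat q - of_nat j) * \<beta> x)" for j q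
  proof (induction j)
    case (Suc j)
    have "rs (\<lambda>x. - \<beta> x + (\<alpha> x + (of_nat q - of_nat j) * \<beta> x)) = rs (\<lambda>x. \<alpha> x + (of_nat q - of_nat (Suc j)) * \<beta> x)"
      by (rule rs_cong) (simp add: algebra_simps)
    then show ?case using lie_rs[OF t'(3) Suc] by simp
  qed (use e in simp)
  have "\<exists>q p. \<alpha> h = of_nat p - 2 * of_nat q \<and> (\<forall>j\<le>p. (lie f ^^ j) ((lie e ^^ q) v) \<notin> {0})"
  proof (rule sl2_string[OF csubspace_single_0 clinear_lie clinear_lie clinear_lie _ _ triple_sl2[OF t]])
    show "lie h v - \<alpha> h *\<^sub>C v \<in> {0}" using v t'(4) by (simp add: root_space_def)
    show "\<exists>k. (lie e ^^ k) v \<in> {0}"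
      using ad_nilpotent_weight[OF t'(2,1) nz v(1) \<alpha>] by simp
    have "(\<lambda>x. - \<beta> x) \<noteq> (\<lambda>_. 0)" using nz by (simp add: fun_eq_iff)
    then show "\<exists>k. (lie f ^^ k) ((lie e ^^ q) v) \<in> {0}" for q
      using ad_nilpotent_weight[OF t'(3) dual_minus[OF t'(1)] _ e dual_comb[OF \<alpha> t'(1)]] by simp
  qed (use v in auto)
  then obtain q p where qp: "\<alpha> h = of_nat p - 2 * of_nat q" "\<forall>j\<le>p. (lie f ^^ j) ((lie e ^^ q) v) \<noteq> 0" by auto
  define n where "n = int p - 2 * int q"
  have n: "\<alpha> h = of_int n" by (simp add: qp(1) n_def)
  moreover have "rs (\<lambda>x. \<alpha> x - of_int n * \<beta> x) \<noteq> {0}" if "n \<ge> 0"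
  proof -
    \<comment> \<open>For n = p - 2q \<ge> 0, going down p - q \<le> p steps from the top of the
      string leads to the reflected weight \<alpha> - n \<beta>.\<close>
    have "(lie f ^^ (p - q)) ((lie e ^^ q) v) \<in> rs (\<lambda>x. \<alpha> x + (of_nat q - of_nat (p - q)) * \<beta> x)"
      by (rule f)
    also have "rs (\<lambda>x. \<alpha> x + (of_nat q - of_nat (p - q)) * \<beta> x) = rs (\<lambda>x. \<alpha> x - of_int n * \<beta> x)"
      using that by (intro rs_cong) (simp add: n_def of_nat_diff algebra_simps)
    finally show ?thesis using qp(2)[rule_format, of "p - q"] by auto
  qed
  ultimately show ?thesis by blast
qed

text \<open>A negative n is handled by the exchanged triple: h and \<beta> both change sign, so n
  \<beta> does not change.\<close>

lemma triple_string:
  assumes t: "triple \<beta> e f h" and \<alpha>: "\<alpha> \<in> dual H" "rs \<alpha> \<noteq> {0}"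
  shows "\<exists>n::int. \<alpha> h = of_int n \<and> rs (\<lambda>x. \<alpha> x - of_int n * \<beta> x) \<noteq> {0}"
proof -
  obtain v where v: "v \<in> rs \<alpha>" "v \<noteq> 0"
    using \<alpha>(2) csubspace_0[OF subspace_rs, of \<alpha>] by blast
  obtain n where n: "\<alpha> h = of_int n" "n \<ge> 0 \<longrightarrow> rs (\<lambda>x. \<alpha> x - of_int n * \<beta> x) \<noteq> {0}"
    using triple_string_aux[OF t \<alpha>(1) v] by blast
  obtain n' where n': "\<alpha> (- h) = of_int n'" "n' \<ge> 0 \<longrightarrow> rs (\<lambda>x. \<alpha> x - of_int n' * (- \<beta> x)) \<noteq> {0}"
    using triple_string_aux[OF triple_swap[OF t] \<alpha>(1) v] by blast
  have "of_int n' = (of_int (- n) :: complex)"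
    using dual_neg[OF \<alpha>(1) tripleD(4)[OF t]] n(1) n'(1) by simp
  then have "n' = - n" by (simp only: of_int_eq_iff)
  with n' have "- n \<ge> 0 \<longrightarrow> rs (\<lambda>x. \<alpha> x - of_int n * \<beta> x) \<noteq> {0}" by simp
  with n show ?thesis by (cases "n \<ge> 0") auto
qed

lemma root_integer: "triple \<beta> e f h \<Longrightarrow> \<alpha> \<in> R \<Longrightarrow> \<exists>n::int. \<alpha> h = of_int n"
  using triple_string[of \<beta> e f h \<alpha>] unfolding roots_def by blast

lemma root_reflection:
  assumes "triple \<beta> e f h" "\<alpha> \<in> R"
  shows "(\<lambda>x. \<alpha> x - \<alpha> h * \<beta> x) \<in> R"
proof -
  obtain n where n: "\<alpha> h = of_int n" "rs (\<lambda>x. \<alpha> x - of_int n * \<beta> x) \<noteq> {0}"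
    using triple_string[OF assms(1), of \<alpha>] assms(2) unfolding roots_def by blast
  have "(\<lambda>x. \<alpha> x - \<alpha> h * \<beta> x) \<in> dual H"
    using dual_comb[OF roots_dual[OF assms(2)] tripleD(1)[OF assms(1)], of "- \<alpha> h"] by simp
  moreover have "(\<lambda>x. \<alpha> x - \<alpha> h * \<beta> x) \<noteq> (\<lambda>_. 0)"
  proof
    assume *: "(\<lambda>x. \<alpha> x - \<alpha> h * \<beta> x) = (\<lambda>_. 0)"
    from fun_cong[OF this, of h] have "\<alpha> h = 0" using tripleD(6)[OF assms(1)] by simp
    with * have "\<alpha> = (\<lambda>_. 0)" by simp
    with assms(2) show False using roots_nonzero by blast
  qed
  ultimately show ?thesis using n by (simp add: roots_def)
qed

end

lemma lie_subalgebra_hull: "lie_subalgebra (lie_subalgebra hull X)"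
  by (rule hull_in) (auto simp: lie_subalgebra_def intro!: csubspace_Inter)

lemma
  shows hull_subspace: "csubspace (lie_subalgebra hull X)"
    and hull_lie: "x \<in> lie_subalgebra hull X \<Longrightarrow> y \<in> lie_subalgebra hull X \<Longrightarrow> lie x y \<in> lie_subalgebra hull X"
  using lie_subalgebra_hull[of X] by (auto simp: lie_subalgebra_def)

lemma lie_subalgebra_hull_induct [consumes 1, case_names base subspace lie]:
  assumes "x \<in> lie_subalgebra hull X"
    and "\<And>x. x \<in> X \<Longrightarrow> P x" and "csubspace {x. P x}"
    and "\<And>x y. P x \<Longrightarrow> P y \<Longrightarrow> P (lie x y)"
  shows "P x"
proof -
  have "lie_subalgebra hull X \<subseteq> {x. P x}"
    by (rule hull_minimal) (use assms in \<open>auto simp: lie_subalgebra_def\<close>)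
  with assms(1) show ?thesis by blast
qed

context cartan_setting
begin

section \<open>Positive roots and their heights\<close>

lemma positive_cone_obtain:
  assumes "\<beta> \<in> positive_cone D"
  obtains c :: "nat \<Rightarrow> nat" where "\<beta> = (\<lambda>h. \<Sum>i\<in>I. of_nat (c i) * sr i h)"
  using assms unfolding positive_cone_def by blast

lemma positive_cone_rho:
  assumes "\<beta> \<in> positive_cone D"
  obtains n :: nat where "\<beta> rho = of_nat n"
proof -
  obtain c where "\<beta> = (\<lambda>h. \<Sum>i\<in>I. of_nat (c i) * sr i h)"
    using assms by (rule positive_cone_obtain)
  then have "\<beta> rho = of_nat (\<Sum>i\<in>I. c i)" by (simp add: rho)
  with that show thesis by blast
qed

lemma simple_roots_positive: assumes "i \<in> I" shows "sr i \<in> Rpos"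
proof -
  have "sr i = (\<lambda>h. \<Sum>j\<in>I. of_nat (if j = i then 1 else 0) * sr j h)"
  proof
    fix h
    have "(\<Sum>j\<in>I. of_nat (if j = i then 1 else 0) * sr j h) = (\<Sum>j\<in>I. if j = i then sr i h else 0)"
      by (rule sum.cong) auto
    then show "sr i h = (\<Sum>j\<in>I. of_nat (if j = i then 1 else 0) * sr j h)" using assms by simp
  qed
  then have "sr i \<in> positive_cone D"
    unfolding positive_cone_def by (intro CollectI exI[of _ "\<lambda>j. if j = i then 1 else 0"])
  with simple_roots[OF assms] show ?thesis by (simp add: positive_roots_def)
qed

abbreviation "xp i \<equiv> xplus D (sr i)"
abbreviation "xm i \<equiv> xminus D (sr i)"
abbreviation "hc i \<equiv> coroot D (sr i)"

lemma triple_simple: "i \<in> I \<Longrightarrow> triple (sr i) (xp i) (xm i) (hc i)"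
  by (rule triple_positive[OF simple_roots_positive])

lemma triple_roots:
  assumes "triple \<beta> e f h" shows "\<beta> \<in> R"
proof -
  have "e \<noteq> 0"
    using tripleD(5)[OF assms] triple_nonzero(2)[OF assms] by auto
  then show ?thesis using rootsI[OF tripleD(1)[OF assms] triple_nonzero(1)[OF assms] tripleD(2)[OF assms]] by blast
qed

lemma positive_roots_neg: "\<beta> \<in> Rpos \<Longrightarrow> (\<lambda>h. - \<beta> h) \<in> R"
  using triple_roots[OF triple_swap[OF triple_positive]] .

section \<open>The form on the Cartan subalgebra and what it says about positive roots\<close>

definition form :: "'g \<Rightarrow> 'g \<Rightarrow> complex"
  where "form h h' = (\<Sum>\<alpha>\<in>R. \<alpha> h * \<alpha> h')"

lemma form_commute: "form h h' = form h' h"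
  by (simp add: form_def mult.commute)

lemma form_sum:
  assumes "\<And>i. i \<in> A \<Longrightarrow> g i \<in> H"
  shows "form h (\<Sum>i\<in>A. c i *\<^sub>C g i) = (\<Sum>i\<in>A. c i * form h (g i))"
proof -
  have "\<alpha> (\<Sum>i\<in>A. c i *\<^sub>C g i) = (\<Sum>i\<in>A. c i * \<alpha> (g i))" if "\<alpha> \<in> R" for \<alpha>
    using assms csubspace_scale[OF subspace_H]
    by (subst dual_sum[OF roots_dual[OF that]]) (auto simp: dual_scale[OF roots_dual[OF that]])
  then have "form h (\<Sum>i\<in>A. c i *\<^sub>C g i) = (\<Sum>\<alpha>\<in>R. \<Sum>i\<in>A. c i * (\<alpha> h * \<alpha> (g i)))"
    unfolding form_def
  proof (intro sum.cong refl)
    fix \<alpha> assume "\<alpha> \<in> R"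
    then show "\<alpha> h * \<alpha> (\<Sum>i\<in>A. c i *\<^sub>C g i) = (\<Sum>i\<in>A. c i * (\<alpha> h * \<alpha> (g i)))"
      using \<open>\<And>\<alpha>. \<alpha> \<in> R \<Longrightarrow> _\<close>[of \<alpha>] by (simp add: sum_distrib_left mult.left_commute)
  qed
  also have "\<dots> = (\<Sum>i\<in>A. c i * form h (g i))"
    by (subst sum.swap) (simp add: form_def sum_distrib_left)
  finally show ?thesis .
qed

text \<open>Invariance of the form under the reflection attached to \<open>\<beta>\<close>, which permutes the roots.\<close>

lemma form_coroot:
  assumes t: "triple \<beta> e f hh"
  shows "2 * form h hh = \<beta> h * form hh hh"
proof -
  define s where "s \<alpha> = (\<lambda>x. \<alpha> x - \<alpha> hh * \<beta> x)" for \<alpha> :: "'g \<Rightarrow> complex"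
  have ss: "s (s \<alpha>) = \<alpha>" for \<alpha>
    using tripleD(6)[OF t] by (simp add: s_def fun_eq_iff algebra_simps)
  have sR: "s \<alpha> \<in> R" if "\<alpha> \<in> R" for \<alpha>
    unfolding s_def by (rule root_reflection[OF t that])
  have "bij_betw s R R"
    by (rule bij_betw_byWitness[where f' = s]) (auto simp: ss sR)
  then have "form h hh = (\<Sum>\<alpha>\<in>R. s \<alpha> h * s \<alpha> hh)"
    unfolding form_def by (rule sum.reindex_bij_betw[symmetric])
  also have "\<dots> = (\<Sum>\<alpha>\<in>R. \<beta> h * (\<alpha> hh * \<alpha> hh) - \<alpha> h * \<alpha> hh)"
    using tripleD(6)[OF t] by (intro sum.cong refl) (simp add: s_def algebra_simps)
  also have "\<dots> = \<beta> h * form hh hh - form h hh"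
    by (simp add: sum_subtractf form_def sum_distrib_left)
  finally show ?thesis by simp
qed

text \<open>Roots take integer values at the coroot, so the form there is a sum of squares of
  integers, to which \<beta> itself contributes 4.\<close>

lemma form_coroot_positive:
  assumes t: "triple \<beta> e f hh"
  shows "\<exists>r::real. r > 0 \<and> form hh hh = of_real r"
proof -
  obtain n :: "('g \<Rightarrow> complex) \<Rightarrow> int" where n: "\<And>\<alpha>. \<alpha> \<in> R \<Longrightarrow> \<alpha> hh = of_int (n \<alpha>)"
    using root_integer[OF t] by metis
  have "form hh hh = of_real (\<Sum>\<alpha>\<in>R. (of_int (n \<alpha>))\<^sup>2)"
    unfolding form_def of_real_sum by (intro sum.cong refl) (simp add: n power2_eq_square)
  moreover have "(\<Sum>\<alpha>\<in>R. (of_int (n \<alpha>) :: real)\<^sup>2) > 0"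
  proof (rule sum_pos2[OF finite_R triple_roots[OF t]])
    have "n \<beta> \<noteq> 0" using n[OF triple_roots[OF t]] tripleD(6)[OF t] by auto
    then show "0 < (of_int (n \<beta>) :: real)\<^sup>2" by simp
  qed simp
  ultimately show ?thesis by blast
qed

text \<open>Otherwise \<open>form_coroot\<close>, used for \<beta> and for each simple root, would
  make every simple root nonpositive at the coroot of \<beta>. As \<beta> is a nonnegative
  combination of simple roots, this contradicts its value 2 there.\<close>

lemma simple_coroot_positive:
  assumes \<beta>: "\<beta> \<in> Rpos"
  shows "\<exists>j\<in>I. \<exists>n::int. n > 0 \<and> \<beta> (hc j) = of_int n"
proof (rule ccontr)
  assume neg: "\<not> ?thesis"
  note t = triple_positive[OF \<beta>]
  let ?h = "coroot D \<beta>"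
  obtain n :: "nat \<Rightarrow> int" where n: "\<And>j. j \<in> I \<Longrightarrow> \<beta> (hc j) = of_int (n j)"
    using root_integer[OF triple_simple positive_roots(1)[OF \<beta>]] by metis
  have n0: "n j \<le> 0" if "j \<in> I" for j using neg n[OF that] that by (metis not_le)
  obtain r where r: "r > 0" "form ?h ?h = of_real r" using form_coroot_positive[OF t] by blast
  obtain q where q: "\<And>j. j \<in> I \<Longrightarrow> q j > (0::real) \<and> form (hc j) (hc j) = of_real (q j)"
    using form_coroot_positive[OF triple_simple] by metis
  have sj: "sr j ?h = of_real (of_int (n j) * r / q j)" if j: "j \<in> I" for j
  proof -
    \<comment> \<open>Both products are twice the form of the two coroots.\<close>
    have "sr j ?h * of_real (q j) = of_int (n j) * of_real r"
      using form_coroot[OF triple_simple[OF j], of ?h] form_coroot[OF t, of "hc j"] form_commute[of ?h "hc j"]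
        q[OF j] r n[OF j] by simp
    then show ?thesis using q[OF j] by (simp add: field_simps)
  qed
  obtain c :: "nat \<Rightarrow> nat" where c: "\<beta> = (\<lambda>h. \<Sum>i\<in>I. of_nat (c i) * sr i h)"
    using positive_roots(2)[OF \<beta>] by (rule positive_cone_obtain)
  have "\<beta> ?h = (\<Sum>i\<in>I. of_nat (c i) * sr i ?h)" by (subst c) (rule refl)
  also have "\<dots> = of_real (\<Sum>i\<in>I. of_nat (c i) * (of_int (n i) * r / q i))"
    by (simp add: sj)
  finally have "of_real (\<Sum>i\<in>I. of_nat (c i) * (of_int (n i) * r / q i)) = (of_real 2 :: complex)"
    using tripleD(6)[OF t] by simp
  then have "(\<Sum>i\<in>I. of_nat (c i) * (of_int (n i) * r / q i)) = 2" by (simp only: of_real_eq_iff)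
  moreover have "(\<Sum>i\<in>I. of_nat (c i) * (of_int (n i) * r / q i)) \<le> 0"
  proof (rule sum_nonpos)
    fix i assume "i \<in> I"
    then have "of_int (n i) \<le> (0::real)" "q i > 0" using n0 q by auto
    then have "of_int (n i) * r / q i \<le> 0"
      using mult_nonpos_nonneg[of "of_int (n i)" r] r by (simp only: divide_nonpos_pos less_imp_le)
    then show "of_nat (c i) * (of_int (n i) * r / q i) \<le> 0"
      by (rule mult_nonneg_nonpos[OF of_nat_0_le_iff])
  qed
  ultimately show False by simp
qed

lemma of_int_pos_add: "n > 0 \<Longrightarrow> (of_int n :: complex) + of_nat j \<noteq> 0"
  by (metis add_pos_nonneg of_int_add of_int_eq_0_iff of_int_of_nat_eq of_nat_0_le_iff less_irrefl)

text \<open>[x, [z, e]] is a multiple of e because root spaces are one-dimensional, and it is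
  nonzero by \<open>triple_kernel\<close>, since \<beta> is positive at k.\<close>

lemma root_lowering:
  assumes t: "triple \<beta> e f h" and t': "triple \<alpha> x z k" and n: "n > 0" "\<beta> k = of_int n"
  shows "lie z e \<in> rs (\<lambda>h. \<beta> h - \<alpha> h)" "lie z e \<noteq> 0"
    "\<exists>d. e = d *\<^sub>C lie x (lie z e)"
proof -
  have "rs (\<lambda>h. - \<alpha> h + \<beta> h) = rs (\<lambda>h. \<beta> h - \<alpha> h)" by simp
  then show 1: "lie z e \<in> rs (\<lambda>h. \<beta> h - \<alpha> h)"
    using lie_rs[OF tripleD(3)[OF t'] tripleD(2)[OF t]] by simp
  have "e \<noteq> 0" using tripleD(5)[OF t] triple_nonzero(2)[OF t] by auto
  then have nz: "lie x (lie z e) \<noteq> 0"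
    using triple_kernel[OF t' tripleD(2,1)[OF t]] n of_int_pos_add by metis
  then show "lie z e \<noteq> 0" by auto
  have "lie x (lie z e) \<in> rs \<beta>"
    using lie_rs[OF tripleD(2)[OF t'] 1] by simp
  then obtain c where c: "lie x (lie z e) = c *\<^sub>C e" using triple_root_space[OF t] by blast
  with nz have "c \<noteq> 0" by auto
  then show "\<exists>d. e = d *\<^sub>C lie x (lie z e)"
    by (intro exI[of _ "1 / c"]) (simp add: c scaleC_scaleC scaleC_one)
qed

text \<open>Were \<beta> - \<alpha>_j negative, comparing coefficients in \<beta> + (\<alpha>_j -
  \<beta>) = \<alpha>_j would leave only \<beta> = \<alpha>_j. The statement for
  \<open>xminus\<close> comes from the exchanged triples.\<close>

lemma positive_root_step:
  assumes \<beta>: "\<beta> \<in> Rpos" and j: "j \<in> I" "\<beta> \<noteq> sr j" and n: "n > 0" "\<beta> (hc j) = of_int n"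
  shows "(\<lambda>h. \<beta> h - sr j h) \<in> Rpos"
    and "\<exists>a. xplus D \<beta> = a *\<^sub>C lie (xp j) (xplus D (\<lambda>h. \<beta> h - sr j h))"
    and "\<exists>a. xminus D \<beta> = a *\<^sub>C lie (xm j) (xminus D (\<lambda>h. \<beta> h - sr j h))"
proof -
  let ?\<gamma> = "\<lambda>h. \<beta> h - sr j h"
  note t = triple_positive[OF \<beta>] and tj = triple_simple[OF j(1)]
  note low = root_lowering[OF t tj n]
  have "?\<gamma> \<in> dual H" using dual_comb[OF tripleD(1)[OF t] tripleD(1)[OF tj], of "-1"] by simp
  moreover have "?\<gamma> \<noteq> (\<lambda>_. 0)" using j(2) by (auto simp: fun_eq_iff)
  ultimately have \<gamma>R: "?\<gamma> \<in> R" using rootsI low by blast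
  have "(\<lambda>h. - ?\<gamma> h) \<notin> positive_cone D"
  proof
    assume "(\<lambda>h. - ?\<gamma> h) \<in> positive_cone D"
    then obtain b :: "nat \<Rightarrow> nat" where b: "(\<lambda>h. - ?\<gamma> h) = (\<lambda>h. \<Sum>i\<in>I. of_nat (b i) * sr i h)"
      by (rule positive_cone_obtain)
    obtain c :: "nat \<Rightarrow> nat" where c: "\<beta> = (\<lambda>h. \<Sum>i\<in>I. of_nat (c i) * sr i h)"
      using positive_roots(2)[OF \<beta>] by (rule positive_cone_obtain)
    have sum0: "(\<Sum>i\<in>I. (of_nat (c i) + of_nat (b i) - (if i = j then 1 else 0)) * sr i h) = 0" for h
    proof -
      have "(\<Sum>i\<in>I. (of_nat (c i) + of_nat (b i) - (if i = j then 1 else 0)) * sr i h)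
        = (\<Sum>i\<in>I. of_nat (c i) * sr i h) + (\<Sum>i\<in>I. of_nat (b i) * sr i h) - sr j h"
        using j(1) by (simp add: algebra_simps sum.distrib sum_subtractf if_distrib[of "\<lambda>x. _ * x"] sum.delta cong: if_cong)
      also have "(\<Sum>i\<in>I. of_nat (b i) * sr i h) = sr j h - \<beta> h" using fun_cong[OF b, of h] by simp
      also have "(\<Sum>i\<in>I. of_nat (c i) * sr i h) = \<beta> h" using fun_cong[OF c, of h] by simp
      finally show ?thesis by simp
    qed
    have cb: "c i + b i = (if i = j then 1 else 0)" if "i \<in> I" for i
    proof -
      have "of_nat (c i) + of_nat (b i) - (if i = j then 1 else 0) = (0::complex)"
        by (rule simple_roots_independent[OF sum0 that])
      then have "of_nat (c i + b i) = (of_nat (if i = j then 1 else 0) :: complex)" by simp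
      then show ?thesis by (simp only: of_nat_eq_iff)
    qed
    have "c j \<noteq> 0"
    proof
      assume "c j = 0"
      then have "c i = 0" if "i \<in> I" for i using cb[OF that] by (cases "i = j") auto
      then have "\<beta> = (\<lambda>_. 0)" unfolding c by simp
      then show False using roots_nonzero positive_roots(1)[OF \<beta>] by blast
    qed
    then have "c i = (if i = j then 1 else 0)" if "i \<in> I" for i using cb[OF that] cb[OF j(1)] by (auto split: if_splits)
    then have "(\<Sum>i\<in>I. of_nat (c i) * sr i h) = (\<Sum>i\<in>I. if i = j then sr j h else 0)" for h
      by (intro sum.cong) auto
    then have "\<beta> = sr j" unfolding c using j(1) by (simp add: fun_eq_iff)
    with j(2) show False ..
  qed
  with \<gamma>R roots_signed[OF \<gamma>R] show \<gamma>: "?\<gamma> \<in> Rpos" by (simp add: positive_roots_def)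
  note t\<gamma> = triple_positive[OF \<gamma>]
  obtain c where c: "lie (xm j) (xplus D \<beta>) = c *\<^sub>C xplus D ?\<gamma>" using triple_root_space[OF t\<gamma> low(1)] ..
  obtain d where "xplus D \<beta> = d *\<^sub>C lie (xp j) (lie (xm j) (xplus D \<beta>))" using low(3) ..
  then have "xplus D \<beta> = (d * c) *\<^sub>C lie (xp j) (xplus D ?\<gamma>)" by (simp only: c lie_scaleC_right scaleC_scaleC)
  then show "\<exists>a. xplus D \<beta> = a *\<^sub>C lie (xp j) (xplus D ?\<gamma>)" ..
  have "- \<beta> (- hc j) = of_int n"
    using n(2) dual_neg[OF tripleD(1)[OF t] tripleD(4)[OF tj]] by simp
  note low' = root_lowering[OF triple_swap[OF t] triple_swap[OF tj] n(1) this]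
  have "rs (\<lambda>h. - \<beta> h - - sr j h) = rs (\<lambda>h. - ?\<gamma> h)" by (rule rs_cong) simp
  then have "lie (xp j) (xminus D \<beta>) \<in> rs (\<lambda>h. - ?\<gamma> h)" using low'(1) by (simp only:)
  from triple_root_space[OF triple_swap[OF t\<gamma>] this]
  obtain c where c: "lie (xp j) (xminus D \<beta>) = c *\<^sub>C xminus D ?\<gamma>" ..
  obtain d where "xminus D \<beta> = d *\<^sub>C lie (xm j) (lie (xp j) (xminus D \<beta>))" using low'(3) ..
  then have "xminus D \<beta> = (d * c) *\<^sub>C lie (xm j) (xminus D ?\<gamma>)" by (simp only: c lie_scaleC_right scaleC_scaleC)
  then show "\<exists>a. xminus D \<beta> = a *\<^sub>C lie (xm j) (xminus D ?\<gamma>)" ..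
qed

section \<open>Root vectors generated by the simple ones, and opposite roots\<close>

definition "npos = lie_subalgebra hull (xp ` I)"
definition "nneg = lie_subalgebra hull (xm ` I)"

lemma root_vectors_generated:
  assumes "\<beta> \<in> Rpos" shows "xplus D \<beta> \<in> npos \<and> xminus D \<beta> \<in> nneg"
proof -
  obtain n :: nat where "\<beta> rho = of_nat n" using positive_cone_rho positive_roots(2)[OF assms] by blast
  with assms show ?thesis
  \<comment> \<open>Induction on the height, which drops by 1 when a simple root is
    subtracted.\<close>
  proof (induction n arbitrary: \<beta> rule: less_induct)
    case (less n)
    show ?case
    proof (cases "\<exists>j\<in>I. \<beta> = sr j")
      case True
      then obtain j where "j \<in> I" "\<beta> = sr j" by blast
      then show ?thesis unfolding npos_def nneg_def by (auto intro!: hull_inc)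
    next
      case False
      obtain j m where j: "j \<in> I" "(m::int) > 0" "\<beta> (hc j) = of_int m"
        using simple_coroot_positive[OF less.prems(1)] by blast
      let ?\<gamma> = "\<lambda>h. \<beta> h - sr j h"
      have "\<beta> \<noteq> sr j" using False j by blast
      note step = positive_root_step[OF less.prems(1) j(1) this j(2,3)]
      obtain k :: nat where k: "?\<gamma> rho = of_nat k"
        using positive_cone_rho[OF positive_roots(2)[OF step(1)]] by blast
      then have "of_nat n = (of_nat (Suc k) :: complex)" using less.prems(2) rho(2)[OF j(1)] by (simp add: diff_eq_eq)
      then have "k < n" by (simp only: of_nat_eq_iff)
      then have IH: "xplus D ?\<gamma> \<in> npos" "xminus D ?\<gamma> \<in> nneg" using less.IH[OF _ step(1) k] by auto
      have "xp j \<in> npos" "xm j \<in> nneg" using j(1) by (auto simp: npos_def nneg_def intro: hull_inc)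
      with IH have "lie (xp j) (xplus D ?\<gamma>) \<in> npos" "lie (xm j) (xminus D ?\<gamma>) \<in> nneg"
        unfolding npos_def nneg_def by (auto intro: hull_lie)
      then have "a *\<^sub>C lie (xp j) (xplus D ?\<gamma>) \<in> npos" "a *\<^sub>C lie (xm j) (xminus D ?\<gamma>) \<in> nneg" for a
        unfolding npos_def nneg_def by (auto intro: csubspace_scale[OF hull_subspace])
      with step(2,3) show ?thesis by metis
    qed
  qed
qed

text \<open>A root \<open>\<xi>\<close> of minimal height among the negative roots whose opposites are not roots would be
  dominant, and then the form would be nonpositive on the vector \<open>t\<close> representing \<open>-\<xi>\<close>.\<close>

lemma roots_symmetric:
  assumes "\<alpha> \<in> R" shows "\<alpha> \<in> Rpos \<or> (\<lambda>h. - \<alpha> h) \<in> Rpos"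
proof (rule ccontr)
  \<comment> \<open>By \<open>roots_signed\<close>, the negative of a bad root lies in the positive
    cone without being a root.\<close>
  define bad where "bad \<xi> \<longleftrightarrow> \<xi> \<in> R \<and> \<xi> \<notin> Rpos \<and> (\<lambda>h. - \<xi> h) \<notin> Rpos" for \<xi>
  have bad_cone: "(\<lambda>h. - \<xi> h) \<in> positive_cone D \<and> (\<lambda>h. - \<xi> h) \<notin> R" if "bad \<xi>" for \<xi>
    using that roots_signed[of \<xi>] unfolding bad_def positive_roots_def by blast
  assume "\<not> ?thesis"
  then have "bad \<alpha>" using assms by (simp add: bad_def)
  then have "\<exists>n::nat. \<exists>\<xi>. bad \<xi> \<and> - \<xi> rho = of_nat n"
    using positive_cone_rho bad_cone by metis
  then obtain n :: nat where "\<exists>\<xi>. bad \<xi> \<and> - \<xi> rho = of_nat n"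
    and min: "\<And>m. m < n \<Longrightarrow> \<nexists>\<xi>. bad \<xi> \<and> - \<xi> rho = of_nat m"
    using exists_least_iff[of "\<lambda>n. \<exists>\<xi>. bad \<xi> \<and> - \<xi> rho = of_nat n"] by blast
  then obtain \<xi> where \<xi>: "bad \<xi>" "- \<xi> rho = of_nat n" by blast
  have \<xi>R: "\<xi> \<in> R" using \<xi> by (simp add: bad_def)
  \<comment> \<open>The reflection in a simple root maps \<xi> to a bad root and adds \<xi>(h_i) to
    the height of -\<xi>; minimality makes this number nonnegative.\<close>
  have dominant: "\<exists>m::nat. \<xi> (hc i) = of_nat m" if i: "i \<in> I" for i
  proof -
    note t = triple_simple[OF i]
    obtain m where m: "\<xi> (hc i) = of_int m" using root_integer[OF t \<xi>R] by blast
    let ?\<sigma> = "\<lambda>h. \<xi> h - \<xi> (hc i) * sr i h"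
    have \<sigma>R: "?\<sigma> \<in> R" by (rule root_reflection[OF t \<xi>R])
    have \<sigma>neg: "(\<lambda>h. - ?\<sigma> h) \<notin> R"
    proof
      assume "(\<lambda>h. - ?\<sigma> h) \<in> R"
      from root_reflection[OF t this] have "(\<lambda>h. - \<xi> h) \<in> R"
        using tripleD(6)[OF t] by (simp add: algebra_simps)
      with bad_cone[OF \<xi>(1)] show False by blast
    qed
    then have bad\<sigma>: "bad ?\<sigma>"
      using \<sigma>R positive_roots_neg[of ?\<sigma>] positive_roots(1)[of "\<lambda>h. - ?\<sigma> h"] unfolding bad_def by blast
    obtain k :: nat where k: "- ?\<sigma> rho = of_nat k"
      using positive_cone_rho[OF conjunct1[OF bad_cone[OF bad\<sigma>]]] by blast
    have "\<exists>\<xi>. bad \<xi> \<and> - \<xi> rho = of_nat k"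
      by (intro exI[of _ ?\<sigma>] conjI) (fact bad\<sigma>, fact k)
    then have "k \<ge> n" using min[of k] by (cases "k < n") auto
    moreover have "of_int (int k) = (of_int (int n + m) :: complex)"
      using k[symmetric] \<xi>(2)[symmetric] m rho(2)[OF i] by (simp add: algebra_simps)
    then have "int k = int n + m" by (simp only: of_int_eq_iff)
    ultimately have "m = int (k - n)" by simp
    with m show ?thesis by (intro exI[of _ "k - n"]) simp
  qed
  obtain m :: "nat \<Rightarrow> nat" where m: "\<And>i. i \<in> I \<Longrightarrow> \<xi> (hc i) = of_nat (m i)" using dominant by metis
  obtain c :: "nat \<Rightarrow> nat" where c: "(\<lambda>h. - \<xi> h) = (\<lambda>h. \<Sum>i\<in>I. of_nat (c i) * sr i h)"
    using bad_cone[OF \<xi>(1)] positive_cone_obtain by blast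
  obtain q where q: "\<And>j. j \<in> I \<Longrightarrow> q j > (0::real) \<and> form (hc j) (hc j) = of_real (q j)"
    using form_coroot_positive[OF triple_simple] by metis
  \<comment> \<open>By \<open>form_coroot\<close> the vector (2 / q_i) h_i represents the i-th
    simple root, so t represents -\<xi>.\<close>
  define t where "t = (\<Sum>i\<in>I. of_real (2 * of_nat (c i) / q i) *\<^sub>C hc i)"
  have hcH: "hc i \<in> H" if "i \<in> I" for i using tripleD(4)[OF triple_simple[OF that]] .
  have tH: "t \<in> H"
    unfolding t_def by (intro csubspace_sum[OF subspace_H] csubspace_scale[OF subspace_H] hcH)
  have form_t: "form h t = - \<xi> h" for h
  proof -
    have "form h t = (\<Sum>i\<in>I. of_real (2 * of_nat (c i) / q i) * form h (hc i))"
      unfolding t_def by (rule form_sum[OF hcH])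
    also have "\<dots> = (\<Sum>i\<in>I. of_nat (c i) * sr i h)"
    proof (intro sum.cong refl)
      fix i assume i: "i \<in> I"
      then show "of_real (2 * of_nat (c i) / q i) * form h (hc i) = of_nat (c i) * sr i h"
        using form_coroot[OF triple_simple[OF i], of h] q[OF i] by (simp add: field_simps)
    qed
    also have "\<dots> = - \<xi> h" using fun_cong[OF c, of h] by simp
    finally show ?thesis .
  qed
  have val_t: "\<beta> t = (\<Sum>i\<in>I. of_real (2 * of_nat (c i) / q i) * \<beta> (hc i))" if "\<beta> \<in> R" for \<beta>
    unfolding t_def using hcH csubspace_scale[OF subspace_H]
    by (subst dual_sum[OF roots_dual[OF that]]) (auto simp: dual_scale[OF roots_dual[OF that]])
  have "\<exists>x::real. \<beta> t = of_real x" if \<beta>R: "\<beta> \<in> R" for \<beta>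
  proof -
    obtain k :: "nat \<Rightarrow> int" where k: "\<And>i. i \<in> I \<Longrightarrow> \<beta> (hc i) = of_int (k i)"
      using root_integer[OF triple_simple \<beta>R] by metis
    have "\<beta> t = of_real (\<Sum>i\<in>I. 2 * of_nat (c i) / q i * of_int (k i))"
      unfolding val_t[OF \<beta>R] by (simp add: k)
    then show ?thesis by blast
  qed
  then obtain x :: "('g \<Rightarrow> complex) \<Rightarrow> real" where x: "\<And>\<beta>. \<beta> \<in> R \<Longrightarrow> \<beta> t = of_real (x \<beta>)" by metis
  \<comment> \<open>\<open>form t t\<close> is a sum of real squares and equals -\<xi>(t), which is
    nonpositive because \<xi> is dominant. So every root vanishes at t.\<close>
  have "of_real (\<Sum>\<beta>\<in>R. (x \<beta>)\<^sup>2) = form t t"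
    unfolding form_def of_real_sum by (intro sum.cong refl) (simp add: x power2_eq_square)
  also have "\<dots> = of_real (- (\<Sum>i\<in>I. 2 * of_nat (c i) / q i * of_nat (m i)))"
    unfolding form_t val_t[OF \<xi>R] by (simp add: m)
  finally have "(\<Sum>\<beta>\<in>R. (x \<beta>)\<^sup>2) = - (\<Sum>i\<in>I. 2 * of_nat (c i) / q i * of_nat (m i))"
    by (simp only: of_real_eq_iff)
  moreover have "(\<Sum>i\<in>I. 2 * of_nat (c i) / q i * of_nat (m i)) \<ge> 0"
  proof (rule sum_nonneg)
    fix i assume "i \<in> I"
    then have "q i > 0" using q by blast
    then show "0 \<le> 2 * of_nat (c i) / q i * of_nat (m i)" by simp
  qed
  ultimately have "(\<Sum>\<beta>\<in>R. (x \<beta>)\<^sup>2) \<le> 0" by linarith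
  moreover have "(\<Sum>\<beta>\<in>R. (x \<beta>)\<^sup>2) \<ge> 0" by (rule sum_nonneg) simp
  ultimately have "(\<Sum>\<beta>\<in>R. (x \<beta>)\<^sup>2) = 0" by linarith
  then have "\<forall>\<beta>\<in>R. (x \<beta>)\<^sup>2 = 0" by (subst (asm) sum_nonneg_eq_0_iff[OF finite_R]) auto
  then have "form h t = 0" for h by (simp add: form_def x)
  then have "\<xi> = (\<lambda>_. 0)" using form_t by (simp add: fun_eq_iff)
  then show False using roots_nonzero \<xi>R by blast
qed

lemma roots_triple:
  assumes "\<mu> \<in> R"
  obtains e f h where "triple \<mu> e f h" "e \<in> npos \<or> e \<in> nneg"
proof (cases "\<mu> \<in> Rpos")
  case True
  with that triple_positive root_vectors_generated show thesis by metis
next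
  case False
  then have neg: "(\<lambda>h. - \<mu> h) \<in> Rpos" using roots_symmetric[OF assms] by blast
  have "triple (\<lambda>h. - (- \<mu> h)) (xminus D (\<lambda>h. - \<mu> h)) (xplus D (\<lambda>h. - \<mu> h)) (- coroot D (\<lambda>h. - \<mu> h))"
    by (rule triple_swap[OF triple_positive[OF neg]])
  then show thesis using that root_vectors_generated[OF neg] by simp
qed

section \<open>Diagonal action of the Cartan subalgebra\<close>

definition "root_sum = cspan (H \<union> (\<Union>\<alpha>\<in>R. rs \<alpha>))"

lemma root_sum_weight_induct [consumes 1, case_names weight subspace]:
  assumes "x \<in> root_sum" "\<And>\<alpha> x. \<alpha> \<in> dual H \<Longrightarrow> x \<in> rs \<alpha> \<Longrightarrow> P x" "csubspace {x. P x}"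
  shows "P x"
proof (rule cspan_induct[OF assms(1)[unfolded root_sum_def], where P = P])
  show "csubspace (Collect P)" by (rule assms(3))
  fix x assume "x \<in> H \<union> (\<Union>\<alpha>\<in>R. rs \<alpha>)"
  then obtain \<alpha> where "\<alpha> \<in> dual H" "x \<in> rs \<alpha>"
    using rs_zero dual_zero roots_dual by blast
  then show "P x" by (rule assms(2))
qed

lemma subspace_root_sum: "csubspace root_sum"
  unfolding root_sum_def by (rule csubspace_span)

lemma rs_root_sum: assumes "\<alpha> \<in> dual H" "x \<in> rs \<alpha>" shows "x \<in> root_sum"
proof (cases "\<alpha> = (\<lambda>_. 0) \<or> x = 0")
  case True
  then have "x \<in> H" using assms rs_zero csubspace_0[OF subspace_H] by auto
  then show ?thesis unfolding root_sum_def by (intro cspan_base) blast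
next
  case False
  then have "\<alpha> \<in> R" using rootsI assms by blast
  then show ?thesis using assms(2) unfolding root_sum_def by (intro cspan_base) blast
qed

lemma lie_H_root_sum: assumes "h \<in> H" "x \<in> root_sum" shows "lie h x \<in> root_sum"
  using assms(2)
proof (induction rule: root_sum_weight_induct)
  case (weight \<alpha> x)
  then have "lie h x = \<alpha> h *\<^sub>C x" using assms(1) by (simp add: root_space_def)
  then show ?case
    using rs_root_sum[OF weight] by (simp add: csubspace_scale[OF subspace_root_sum])
next
  case subspace
  show ?case
    using csubspace_0[OF subspace_root_sum] csubspace_add[OF subspace_root_sum]
      csubspace_scale[OF subspace_root_sum]
    by (intro csubspaceI) (auto simp: lie_add_right lie_scaleC_right)
qed

text \<open>Q is a product of operators ad k - \<nu>(k), one for each \<nu> in F, with k in H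
  separating \<nu> from \<mu>; c is the product of the numbers \<mu>(k) - \<nu>(k).\<close>

lemma weight_projection:
  assumes "finite F" "F \<subseteq> dual H" "\<mu> \<in> dual H" "\<mu> \<notin> F" "\<And>h. h \<in> H \<Longrightarrow> lie h y - \<mu> h *\<^sub>C y \<in> root_sum"
  shows "\<exists>Q c. clinear Q \<and> (\<forall>h\<in>H. \<forall>x. Q (lie h x) = lie h (Q x)) \<and> (\<forall>\<nu>\<in>F. \<forall>x\<in>rs \<nu>. Q x = 0) \<and>
    c \<noteq> 0 \<and> Q y - c *\<^sub>C y \<in> root_sum"
  using assms
proof (induction F rule: finite_induct)
  case empty
  show ?case
    by (rule exI[of _ "\<lambda>x. x"], rule exI[of _ 1])
      (simp add: clinear_def scaleC_one csubspace_0[OF subspace_root_sum])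
next
  case (insert \<nu> F)
  then obtain Q c where Q: "clinear Q" "\<And>h x. h \<in> H \<Longrightarrow> Q (lie h x) = lie h (Q x)"
    "\<And>\<nu> x. \<nu> \<in> F \<Longrightarrow> x \<in> rs \<nu> \<Longrightarrow> Q x = 0" "c \<noteq> 0" "Q y - c *\<^sub>C y \<in> root_sum" by auto
  have "\<nu> \<noteq> \<mu>" "\<nu> \<in> dual H" using insert.prems by auto
  then obtain k where k: "k \<in> H" "\<mu> k \<noteq> \<nu> k" using insert.prems(2) dual_outside by (metis ext)
  let ?P = "\<lambda>x. lie k (Q x) - \<nu> k *\<^sub>C Q x"
  let ?r = "Q y - c *\<^sub>C y"
  have "clinear ?P"
    by (rule clinearI) (simp_all add: clinear_add[OF Q(1)] clinear_scale[OF Q(1)] lie_add_right lie_scaleC_right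
        scaleC_add_right complex_vector.scale_right_diff_distrib scaleC_scaleC mult.commute)
  moreover have "?P (lie h x) = lie h (?P x)" if "h \<in> H" for h x
  proof -
    have "lie k (lie h (Q x)) = lie h (lie k (Q x))"
      using lie_lie_left[of k h "Q x"] abelian_H[OF k(1) that] by simp
    then show ?thesis
      by (simp add: Q(2)[OF that] clinear_diff[OF clinear_lie] lie_scaleC_right)
  qed
  moreover have "?P x = 0" if "\<alpha> \<in> insert \<nu> F" "x \<in> rs \<alpha>" for \<alpha> x
  proof (cases "\<alpha> \<in> F")
    case True
    then show ?thesis using Q(3) that by simp
  next
    case False
    then have "x \<in> rs \<nu>" using that by auto
    then have "lie k x = \<nu> k *\<^sub>C x" using k(1) by (simp add: root_space_def)
    then have "lie k (Q x) = \<nu> k *\<^sub>C Q x" using Q(2)[OF k(1), of x] by (simp add: clinear_scale[OF Q(1)])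
    then show ?thesis by simp
  qed
  moreover have "?P y - (c * (\<mu> k - \<nu> k)) *\<^sub>C y \<in> root_sum"
  proof -
    have "?P y - (c * (\<mu> k - \<nu> k)) *\<^sub>C y = (lie k ?r - \<nu> k *\<^sub>C ?r) + c *\<^sub>C (lie k y - \<mu> k *\<^sub>C y)"
      by (simp add: clinear_diff[OF clinear_lie] lie_scaleC_right complex_vector.scale_right_diff_distrib
          complex_vector.scale_left_diff_distrib right_diff_distrib scaleC_scaleC mult.commute)
    moreover have "lie k ?r - \<nu> k *\<^sub>C ?r \<in> root_sum"
      by (intro csubspace_diff[OF subspace_root_sum]
          csubspace_scale[OF subspace_root_sum] lie_H_root_sum k Q(5))
    moreover have "c *\<^sub>C (lie k y - \<mu> k *\<^sub>C y) \<in> root_sum"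
      by (rule csubspace_scale[OF subspace_root_sum insert.prems(4)[OF k(1)]])
    ultimately show ?thesis by (simp only: csubspace_add[OF subspace_root_sum])
  qed
  moreover have "c * (\<mu> k - \<nu> k) \<noteq> 0" using Q(4) k(2) by simp
  ultimately show ?case by blast
qed

text \<open>After projecting \<open>y\<close> so that \<open>[h, y] - \<mu>(h) y\<close> lies in the \<open>\<mu>\<close>-root space, the bracket with the
  opposite root vector normalizes \<open>H\<close>, hence lies in \<open>H\<close> and commutes with \<open>H\<close>; this kills the error term.\<close>

lemma eigenvector_in_root_sum:
  assumes \<mu>: "\<mu> \<in> dual H" and y: "\<And>h. h \<in> H \<Longrightarrow> lie h y - \<mu> h *\<^sub>C y \<in> root_sum"
  shows "y \<in> root_sum"
proof -
  \<comment> \<open>All weights other than \<mu>: the projection then maps \<open>root_sum\<close>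
    into the \<mu>-root space.\<close>
  let ?F = "{\<alpha> \<in> dual H. rs \<alpha> \<noteq> {0}} - {\<mu>}"
  have "finite ?F" "?F \<subseteq> dual H" "\<mu> \<notin> ?F" using finite_weights by auto
  then have "\<exists>Q c. clinear Q \<and> (\<forall>h\<in>H. \<forall>x. Q (lie h x) = lie h (Q x)) \<and> (\<forall>\<nu>\<in>?F. \<forall>x\<in>rs \<nu>. Q x = 0) \<and>
    c \<noteq> 0 \<and> Q y - c *\<^sub>C y \<in> root_sum"
    using \<mu> y by (intro weight_projection)
  then obtain Q c where "clinear Q \<and> (\<forall>h\<in>H. \<forall>x. Q (lie h x) = lie h (Q x)) \<and> (\<forall>\<nu>\<in>?F. \<forall>x\<in>rs \<nu>. Q x = 0) \<and>
    c \<noteq> 0 \<and> Q y - c *\<^sub>C y \<in> root_sum" by (elim exE)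
  then have Q: "clinear Q" "\<And>h x. h \<in> H \<Longrightarrow> Q (lie h x) = lie h (Q x)"
    "\<And>\<nu> x. \<nu> \<in> ?F \<Longrightarrow> x \<in> rs \<nu> \<Longrightarrow> Q x = 0" "c \<noteq> 0" "Q y - c *\<^sub>C y \<in> root_sum" by blast+
  have QS: "Q x \<in> rs \<mu>" if "x \<in> root_sum" for x
    using that
  proof (induction rule: root_sum_weight_induct)
    case (weight \<alpha> x)
    show ?case
    proof (cases "\<alpha> = \<mu>")
      case True
      then have "lie h (Q x) = \<mu> h *\<^sub>C Q x" if "h \<in> H" for h
        using weight(2) Q(2)[OF that, of x] that by (simp add: root_space_def clinear_scale[OF Q(1)])
      then show ?thesis by (simp add: root_space_def)
    next
      case False
      then have "Q x = 0" using Q(3)[of \<alpha> x] weight clinear_0[OF Q(1)] by (cases "x = 0") auto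
      then show ?thesis using csubspace_0[OF subspace_rs] by simp
    qed
  next
    case subspace
    show ?case
      by (intro csubspaceI)
        (auto simp: clinear_add[OF Q(1)] clinear_scale[OF Q(1)] clinear_0[OF Q(1)] csubspace_0[OF subspace_rs]
          intro: csubspace_add[OF subspace_rs] csubspace_scale[OF subspace_rs])
  qed
  have y': "lie h (Q y) - \<mu> h *\<^sub>C Q y \<in> rs \<mu>" if "h \<in> H" for h
    using QS[OF y[OF that]] by (simp add: clinear_diff[OF Q(1)] clinear_scale[OF Q(1)] Q(2)[OF that])
  have "Q y \<in> root_sum"
  proof (cases "\<mu> \<in> R")
    case True
    then obtain e f hh where t: "triple \<mu> e f hh" by (rule roots_triple)
    have "lie h (Q y) - \<mu> h *\<^sub>C Q y = 0" if h: "h \<in> H" for h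
    proof -
      have brack: "\<exists>c. lie g (lie f (Q y)) = c *\<^sub>C hh \<and> lie g (Q y) - \<mu> g *\<^sub>C Q y = (- c) *\<^sub>C e" if g: "g \<in> H" for g
      proof -
        obtain c where "lie g (Q y) - \<mu> g *\<^sub>C Q y = c *\<^sub>C e" using triple_root_space[OF t y'[OF g]] by blast
        then have c: "lie g (Q y) = \<mu> g *\<^sub>C Q y + c *\<^sub>C e" by (simp add: algebra_simps)
        have "lie g f = - \<mu> g *\<^sub>C f" using tripleD(3)[OF t] g by (simp add: root_space_def)
        moreover have "lie f e = - hh" using tripleD(5)[OF t] lie_anticomm[of f e] by simp
        ultimately have "lie g (lie f (Q y)) = (- c) *\<^sub>C hh"
          using lie_lie_left[of g f "Q y"] by (simp add: c lie_scaleC_left lie_scaleC_right lie_add_right lie_minus_left)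
        with c show ?thesis by (intro exI[of _ "- c"]) simp
      qed
      have "lie f (Q y) \<in> H"
      proof (rule normalizer_H')
        fix g assume "g \<in> H"
        then show "lie g (lie f (Q y)) \<in> H"
          using brack csubspace_scale[OF subspace_H tripleD(4)[OF t]] by metis
      qed
      then have "lie h (lie f (Q y)) = 0" by (rule abelian_H[OF h])
      moreover obtain c where "lie h (lie f (Q y)) = c *\<^sub>C hh" "lie h (Q y) - \<mu> h *\<^sub>C Q y = (- c) *\<^sub>C e"
        using brack[OF h] by blast
      ultimately show ?thesis using triple_nonzero(2)[OF t] by simp
    qed
    then have "Q y \<in> rs \<mu>" by (simp add: root_space_def)
    then show ?thesis by (rule rs_root_sum[OF \<mu>])
  next
    case False
    show ?thesis
    proof (cases "\<mu> = (\<lambda>_. 0)")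
      case True
      then have "lie h (Q y) \<in> H" if "h \<in> H" for h using y'[OF that] rs_zero by simp
      then have "Q y \<in> rs (\<lambda>_. 0)" unfolding rs_zero by (rule normalizer_H')
      then show ?thesis by (rule rs_root_sum[OF dual_zero])
    next
      case nz: False
      then have "rs \<mu> = {0}"
        using False \<mu> csubspace_0[OF subspace_rs, of \<mu>] unfolding roots_def by blast
      then have "Q y \<in> rs \<mu>" using y' by (simp add: root_space_def[of H \<mu>] del: singleton_iff) auto
      then show ?thesis by (rule rs_root_sum[OF \<mu>])
    qed
  qed
  then have "Q y - (Q y - c *\<^sub>C y) \<in> root_sum"
    using Q(5) by (rule csubspace_diff[OF subspace_root_sum])
  moreover have "Q y - (Q y - c *\<^sub>C y) = c *\<^sub>C y" by simp
  ultimately have "c *\<^sub>C y \<in> root_sum" by (simp only:)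
  then have "(1 / c) *\<^sub>C c *\<^sub>C y \<in> root_sum" by (rule csubspace_scale[OF subspace_root_sum])
  then show ?thesis using Q(4) by (simp add: scaleC_scaleC scaleC_one)
qed

text \<open>If something were left outside, the commuting operators ad h would have a common
  eigenvector modulo \<open>root_sum\<close>. Its eigenvalues form a functional on H, so
  \<open>eigenvector_in_root_sum\<close> puts the vector back into \<open>root_sum\<close>.\<close>

lemma root_sum_UNIV: "root_sum = UNIV"
proof (rule ccontr)
  assume "root_sum \<noteq> UNIV"
  obtain B :: "'g set" where B: "finite B" "cspan B = UNIV" by (rule finite_basis)
  obtain Y where Y: "Y \<subseteq> H" "cindependent Y" "H \<subseteq> cspan Y"
    using complex_vector.basis_exists[of H] by metis
  have fin: "finite Y" using Y finite_independent by blast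
  have "\<exists>x \<mu>. x \<notin> root_sum \<and> (\<forall>y\<in>Y. lie y x - \<mu> y *\<^sub>C x \<in> root_sum)"
  proof (rule common_eigenvector_mod[OF B subspace_root_sum])
    fix y z x assume "y \<in> Y" "z \<in> Y"
    then show "lie y (lie z x) = lie z (lie y x)"
      using lie_lie_left[of y z x] abelian_H Y(1) by (simp add: subset_iff)
  qed (use Y(1) lie_H_root_sum fin \<open>root_sum \<noteq> UNIV\<close> in \<open>auto simp: clinear_lie\<close>)
  then obtain x \<mu> where x: "x \<notin> root_sum" "\<And>y. y \<in> Y \<Longrightarrow> lie y x - \<mu> y *\<^sub>C x \<in> root_sum" by blast
  \<comment> \<open>Eigenvalues are known at the basis Y of H. Their existence passes to the span,
    and uniqueness then makes them linear.\<close>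
  have ex: "\<exists>m. lie h x - m *\<^sub>C x \<in> root_sum" if "h \<in> H" for h
  proof -
    have "h \<in> cspan Y" using that Y(3) by blast
    then show ?thesis
    proof (rule cspan_induct)
      show "csubspace {h. \<exists>m. lie h x - m *\<^sub>C x \<in> root_sum}"
      proof (rule csubspaceI)
        show "0 \<in> {h. \<exists>m. lie h x - m *\<^sub>C x \<in> root_sum}"
          using csubspace_0[OF subspace_root_sum] by (auto intro!: exI[of _ 0])
      next
        fix g h assume "g \<in> {h. \<exists>m. lie h x - m *\<^sub>C x \<in> root_sum}" "h \<in> {h. \<exists>m. lie h x - m *\<^sub>C x \<in> root_sum}"
        then obtain m n where "lie g x - m *\<^sub>C x \<in> root_sum" "lie h x - n *\<^sub>C x \<in> root_sum" by blast
        then have "(lie g x - m *\<^sub>C x) + (lie h x - n *\<^sub>C x) \<in> root_sum"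
          by (rule csubspace_add[OF subspace_root_sum])
        then have "lie (g + h) x - (m + n) *\<^sub>C x \<in> root_sum" by (simp add: lie_add_left scaleC_add_left algebra_simps)
        then show "g + h \<in> {h. \<exists>m. lie h x - m *\<^sub>C x \<in> root_sum}" by blast
      next
        fix c h assume "h \<in> {h. \<exists>m. lie h x - m *\<^sub>C x \<in> root_sum}"
        then obtain m where "lie h x - m *\<^sub>C x \<in> root_sum" by blast
        then have "c *\<^sub>C (lie h x - m *\<^sub>C x) \<in> root_sum" by (rule csubspace_scale[OF subspace_root_sum])
        then have "lie (c *\<^sub>C h) x - (c * m) *\<^sub>C x \<in> root_sum"
          by (simp add: lie_scaleC_left complex_vector.scale_right_diff_distrib scaleC_scaleC)
        then show "c *\<^sub>C h \<in> {h. \<exists>m. lie h x - m *\<^sub>C x \<in> root_sum}" by blast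
      qed
    qed (use x(2) in blast)
  qed
  have uniq: "m = n" if "lie h x - m *\<^sub>C x \<in> root_sum" "lie h x - n *\<^sub>C x \<in> root_sum" for h m n
  proof (rule ccontr)
    assume "m \<noteq> n"
    have "(lie h x - n *\<^sub>C x) - (lie h x - m *\<^sub>C x) \<in> root_sum"
      by (rule csubspace_diff[OF subspace_root_sum that(2,1)])
    then have "(m - n) *\<^sub>C x \<in> root_sum" by (simp add: complex_vector.scale_left_diff_distrib)
    then have "(1 / (m - n)) *\<^sub>C (m - n) *\<^sub>C x \<in> root_sum" by (rule csubspace_scale[OF subspace_root_sum])
    with \<open>m \<noteq> n\<close> x(1) show False by (simp add: scaleC_scaleC scaleC_one)
  qed
  define \<nu> where "\<nu> h = (if h \<in> H then SOME m. lie h x - m *\<^sub>C x \<in> root_sum else 0)" for h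
  have \<nu>: "lie h x - \<nu> h *\<^sub>C x \<in> root_sum" if "h \<in> H" for h
    using someI_ex[OF ex[OF that]] that by (simp add: \<nu>_def)
  have "\<nu> \<in> dual H"
    unfolding dual_def
  proof (intro CollectI conjI ballI allI impI)
    fix g h assume gh: "g \<in> H" "h \<in> H"
    then have "(lie g x - \<nu> g *\<^sub>C x) + (lie h x - \<nu> h *\<^sub>C x) \<in> root_sum"
      using \<nu> by (intro csubspace_add[OF subspace_root_sum])
    then have "lie (g + h) x - (\<nu> g + \<nu> h) *\<^sub>C x \<in> root_sum" by (simp add: lie_add_left scaleC_add_left algebra_simps)
    with \<nu>[OF csubspace_add[OF subspace_H gh]] show "\<nu> (g + h) = \<nu> g + \<nu> h" by (rule uniq)
  next
    fix c h assume h: "h \<in> H"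
    then have "c *\<^sub>C (lie h x - \<nu> h *\<^sub>C x) \<in> root_sum"
      using \<nu> by (intro csubspace_scale[OF subspace_root_sum])
    then have "lie (c *\<^sub>C h) x - (c * \<nu> h) *\<^sub>C x \<in> root_sum"
      by (simp add: lie_scaleC_left complex_vector.scale_right_diff_distrib scaleC_scaleC)
    with \<nu>[OF csubspace_scale[OF subspace_H h]] show "\<nu> (c *\<^sub>C h) = c * \<nu> h" by (rule uniq)
  qed (simp add: \<nu>_def)
  from eigenvector_in_root_sum[OF this \<nu>] x(1) show False by blast
qed

lemma triangular_decomposition: "cspan (H \<union> npos \<union> nneg) = UNIV"
proof -
  have "H \<union> (\<Union>\<alpha>\<in>R. rs \<alpha>) \<subseteq> cspan (H \<union> npos \<union> nneg)"
  proof
    fix x assume "x \<in> H \<union> (\<Union>\<alpha>\<in>R. rs \<alpha>)"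
    then consider "x \<in> H" | \<alpha> where "\<alpha> \<in> R" "x \<in> rs \<alpha>" by blast
    then show "x \<in> cspan (H \<union> npos \<union> nneg)"
    proof cases
      case 1
      then show ?thesis by (intro cspan_base) blast
    next
      case (2 \<alpha>)
      obtain e f h where t: "triple \<alpha> e f h" "e \<in> npos \<or> e \<in> nneg" using roots_triple[OF 2(1)] .
      obtain c where "x = c *\<^sub>C e" using triple_root_space[OF t(1) 2(2)] by blast
      with t(2) show ?thesis by (auto intro: cspan_scale cspan_base)
    qed
  qed
  then have "root_sum \<subseteq> cspan (H \<union> npos \<union> nneg)"
    unfolding root_sum_def by (rule cspan_minimal[OF _ csubspace_span])
  then show ?thesis by (simp add: root_sum_UNIV top.extremum_unique)
qed

section \<open>The highest root, and generation by the simple root vectors\<close>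

lemma index_set_nonempty: "I \<noteq> {}"
proof
  assume "I = {}"
  then have cone: "\<beta> = (\<lambda>_. 0)" if "\<beta> \<in> positive_cone D" for \<beta>
    using that by (auto simp: positive_cone_def)
  have "highest_root D \<in> R" using cartan_data by (simp add: is_cartan_data_def)
  then have "highest_root D = (\<lambda>_. 0) \<or> (\<lambda>h. - highest_root D h) = (\<lambda>_. 0)"
    using roots_signed cone by blast
  then have "highest_root D = (\<lambda>_. 0)" by (auto simp: fun_eq_iff)
  with \<open>highest_root D \<in> R\<close> show False using roots_nonzero by blast
qed

text \<open>The highest root minus a simple root lies in the positive cone, and adding the simple
  root back stays there. So its root vectors form a triple.\<close>

lemma highest_root_positive: "highest_root D \<in> Rpos"
proof -
  have R: "highest_root D \<in> R"
    and dom: "\<And>\<beta>. \<beta> \<in> R \<Longrightarrow> (\<lambda>h. highest_root D h - \<beta> h) \<in> positive_cone D"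
    using cartan_data by (simp_all add: is_cartan_data_def)
  obtain i where i: "i \<in> I" using index_set_nonempty by blast
  obtain c :: "nat \<Rightarrow> nat" where c: "(\<lambda>h. highest_root D h - sr i h) = (\<lambda>h. \<Sum>j\<in>I. of_nat (c j) * sr j h)"
    using dom[OF simple_roots[OF i]] by (rule positive_cone_obtain)
  have "highest_root D = (\<lambda>h. \<Sum>j\<in>I. of_nat (c j + (if j = i then 1 else 0)) * sr j h)"
  proof
    fix h
    have "(\<Sum>j\<in>I. of_nat (c j + (if j = i then 1 else 0)) * sr j h)
      = (\<Sum>j\<in>I. of_nat (c j) * sr j h + (if j = i then sr i h else 0))"
      by (rule sum.cong) (auto simp: algebra_simps)
    also have "\<dots> = highest_root D h" using fun_cong[OF c, of h, symmetric] i by (simp add: sum.distrib)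
    finally show "highest_root D h = (\<Sum>j\<in>I. of_nat (c j + (if j = i then 1 else 0)) * sr j h)" ..
  qed
  then have "highest_root D \<in> positive_cone D" unfolding positive_cone_def
    by (intro CollectI exI[of _ "\<lambda>j. c j + (if j = i then 1 else 0)"])
  with R show ?thesis by (simp add: positive_roots_def)
qed

text \<open>The generators are weight vectors, so the subalgebra is stable under ad H. It contains
  \<open>npos\<close> and \<open>nneg\<close>, hence it is an ideal by the triangular decomposition,
  and simplicity applies.\<close>

lemma generated_by_simple_root_vectors: "lie_subalgebra hull (xp ` I \<union> xm ` I) = UNIV"
proof -
  let ?G = "lie_subalgebra hull (xp ` I \<union> xm ` I)"
  have gen: "xp i \<in> ?G" "xm i \<in> ?G" if "i \<in> I" for i using that by (auto intro: hull_inc)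
  have sub: "npos \<subseteq> ?G" "nneg \<subseteq> ?G" unfolding npos_def nneg_def by (auto intro!: hull_mono)
  have H: "lie h y \<in> ?G" if "h \<in> H" "y \<in> ?G" for h y
  proof -
    have "y \<in> ?G \<and> lie h y \<in> ?G"
      using that(2)
    proof (induction rule: lie_subalgebra_hull_induct)
      case (base x)
      then obtain i where i: "i \<in> I" "x = xp i \<or> x = xm i" by auto
      then have "\<exists>c. lie h x = c *\<^sub>C x"
        using tripleD(2,3)[OF triple_simple[OF i(1)]] that(1) unfolding root_space_def by blast
      moreover have "x \<in> ?G" using gen i by blast
      ultimately show ?case by (metis csubspace_scale hull_subspace)
    next
      case subspace
      show ?case
        by (rule csubspaceI)
          (auto simp: lie_add_right lie_scaleC_right csubspace_0[OF hull_subspace]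
            intro: csubspace_add[OF hull_subspace] csubspace_scale[OF hull_subspace])
    next
      case (lie x y)
      then show ?case
        unfolding lie_lie_left[of h x y]
        by (auto intro!: csubspace_add[OF hull_subspace] hull_lie)
    qed
    then show ?thesis ..
  qed
  have "lie x y \<in> ?G" if y: "y \<in> ?G" for x y
  proof -
    have "x \<in> cspan (H \<union> npos \<union> nneg)" by (simp add: triangular_decomposition)
    then show ?thesis
    proof (rule cspan_induct)
      show "csubspace {x. lie x y \<in> ?G}"
        by (rule csubspaceI)
          (auto simp: lie_add_left lie_scaleC_left csubspace_0[OF hull_subspace]
            intro: csubspace_add[OF hull_subspace] csubspace_scale[OF hull_subspace])
    qed (use H y sub in \<open>auto intro: hull_lie\<close>)
  qed
  then have "lie_ideal ?G" by (simp add: lie_ideal_def hull_subspace)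
  moreover have "?G \<noteq> {0}"
  proof -
    obtain i where i: "i \<in> I" using index_set_nonempty by blast
    then have "xp i \<noteq> 0" using triple_data[OF simple_roots_positive[OF i]] by simp
    with gen(1)[OF i] show ?thesis by blast
  qed
  ultimately show ?thesis using simple by (auto simp: simple_lie_def)
qed

lemma ad_nilpotent_root:
  assumes "\<beta> \<in> R" "x \<in> rs \<beta>"
  shows "\<exists>k. (lie x ^^ k) y = 0"
proof -
  have "y \<in> root_sum" by (simp add: root_sum_UNIV)
  then show ?thesis
  proof (induction rule: root_sum_weight_induct)
    case (weight \<alpha> y)
    then show ?case using ad_nilpotent_weight[OF assms(2) roots_dual roots_nonzero] assms(1) by blast
  next
    case subspace
    have lin: "clinear (lie x ^^ n)" for n by (rule clinear_funpow[OF clinear_lie])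
    have mono: "(lie x ^^ (k + l)) y = 0" if "(lie x ^^ k) y = 0" for k l y
      using that by (simp only: add.commute[of k l] funpow_add o_apply) (simp add: clinear_0[OF lin])
    show ?case
    proof (rule csubspaceI)
      fix y z assume "y \<in> {y. \<exists>k. (lie x ^^ k) y = 0}" "z \<in> {y. \<exists>k. (lie x ^^ k) y = 0}"
      then obtain k l where "(lie x ^^ k) y = 0" "(lie x ^^ l) z = 0" by blast
      then have "(lie x ^^ (k + l)) (y + z) = 0"
        using mono[of k y l] mono[of l z k] by (simp add: clinear_add[OF lin] add.commute[of l k])
      then show "y + z \<in> {y. \<exists>k. (lie x ^^ k) y = 0}" by blast
    qed (auto simp: clinear_0[OF lin] clinear_scale[OF lin])
  qed
qed

end

section \<open>Locally nilpotent elements on cyclic modules\<close>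

lemma left_ideal_subspace:
  fixes J :: "'u::complex_algebra_1 set"
  assumes "left_ideal J" shows "csubspace J"
proof (rule csubspaceI)
  fix c x assume "x \<in> J"
  then have "(c *\<^sub>C 1) * x \<in> J" using assms by (auto simp: left_submodule_def)
  then show "c *\<^sub>C x \<in> J" by (simp add: mult_scaleC_left)
qed (use assms in \<open>auto simp: left_submodule_def\<close>)

lemma left_ideal_mult: "left_ideal J \<Longrightarrow> x \<in> J \<Longrightarrow> r * x \<in> J"
  by (simp add: left_submodule_def)

section \<open>Nilpotency at a vector of a cyclic module\<close>

definition commutator :: "'u::complex_algebra_1 \<Rightarrow> 'u \<Rightarrow> 'u"
  where "commutator x y = x * y - y * x"

lemma clinear_commutator: "clinear (commutator x)"
  by (rule clinearI) (simp_all add: commutator_def algebra_simps mult_scaleC_left mult_scaleC_right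
      complex_vector.scale_right_diff_distrib)

text \<open>Nilpotency of x at the vector u + J of the quotient by J; for a left ideal this depends
  on u.\<close>

definition nilpotent_at :: "'u::complex_algebra_1 set \<Rightarrow> 'u \<Rightarrow> 'u \<Rightarrow> bool"
  where "nilpotent_at J x u \<longleftrightarrow> (\<exists>k. x ^ k * u \<in> J)"

lemma power_mult_mono:
  assumes "left_ideal J" "x ^ k * u \<in> J" "k \<le> n" shows "x ^ n * u \<in> J"
proof -
  have "x ^ (n - k) * (x ^ k * u) \<in> J" by (rule left_ideal_mult[OF assms(1,2)])
  then show ?thesis using assms(3) by (simp flip: power_add mult.assoc)
qed

lemma nilpotent_at_add:
  assumes "left_ideal J" "nilpotent_at J x u" "nilpotent_at J x v"
  shows "nilpotent_at J x (u + v)"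
proof -
  obtain k l where "x ^ k * u \<in> J" "x ^ l * v \<in> J" using assms by (auto simp: nilpotent_at_def)
  then have "x ^ max k l * u \<in> J" "x ^ max k l * v \<in> J" using power_mult_mono[OF assms(1)] by auto
  then have "x ^ max k l * (u + v) \<in> J"
    using csubspace_add[OF left_ideal_subspace[OF assms(1)]] by (simp add: distrib_left)
  then show ?thesis unfolding nilpotent_at_def by blast
qed

lemma nilpotent_at_scale:
  assumes "left_ideal J" "nilpotent_at J x u" shows "nilpotent_at J x (c *\<^sub>C u)"
proof -
  obtain k where "x ^ k * u \<in> J" using assms by (auto simp: nilpotent_at_def)
  then have "x ^ k * (c *\<^sub>C u) \<in> J"
    using csubspace_scale[OF left_ideal_subspace[OF assms(1)]] by (simp add: mult_scaleC_right)
  then show ?thesis unfolding nilpotent_at_def by blast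
qed

text \<open>In x (y u) = y (x u) + [x, y] u, fewer powers of x are needed to kill x u, and [x, y]
  has smaller ad-nilpotency than y; whence the double induction.\<close>

lemma nilpotent_at_mult:
  assumes J: "left_ideal J" and N: "(commutator x ^^ N) y = 0" and u: "nilpotent_at J x u"
  shows "nilpotent_at J x (y * u)"
  using N u
proof (induction N arbitrary: y u)
  case 0
  then show ?case using J by (simp add: nilpotent_at_def left_submodule_def)
next
  case (Suc N)
  obtain k where "x ^ k * u \<in> J" using Suc.prems by (auto simp: nilpotent_at_def)
  then show ?case
  proof (induction k arbitrary: u)
    case 0
    then have "x ^ 0 * (y * u) \<in> J" using left_ideal_mult[OF J] by simp
    then show ?case unfolding nilpotent_at_def by blast
  next
    case (Suc k)
    have "x ^ k * (x * u) \<in> J" using Suc.prems by (simp add: power_commutes flip: mult.assoc)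
    then have 1: "nilpotent_at J x (y * (x * u))" by (rule Suc.IH)
    have "(commutator x ^^ N) (commutator x y) = 0"
      using \<open>(commutator x ^^ Suc N) y = 0\<close> by (simp only: funpow_Suc_right o_apply)
    moreover have "nilpotent_at J x u" using Suc.prems unfolding nilpotent_at_def by blast
    ultimately have "nilpotent_at J x (commutator x y * u)" by (rule \<open>\<And>y u. _ \<Longrightarrow> _ \<Longrightarrow> nilpotent_at J x (y * u)\<close>)
    from nilpotent_at_add[OF J 1 this] have "nilpotent_at J x (x * (y * u))"
      by (simp add: commutator_def algebra_simps)
    then obtain m where "x ^ m * (x * (y * u)) \<in> J" unfolding nilpotent_at_def by blast
    then have "x ^ Suc m * (y * u) \<in> J" by (simp only: power_Suc2 mult.assoc)
    then show ?case unfolding nilpotent_at_def by blast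
  qed
qed

section \<open>Exponentials of locally nilpotent elements\<close>

definition divided_power :: "'u::complex_algebra_1 \<Rightarrow> nat \<Rightarrow> 'u"
  where "divided_power e m = (1 / fact m) *\<^sub>C e ^ m"

definition divided_ad :: "'u::complex_algebra_1 \<Rightarrow> 'u \<Rightarrow> nat \<Rightarrow> 'u"
  where "divided_ad e z j = (1 / fact j) *\<^sub>C (commutator e ^^ j) z"

lemma divided_power_Suc: "e * divided_power e m = of_nat (Suc m) *\<^sub>C divided_power e (Suc m)"
  and divided_power_Suc': "of_nat (Suc m) *\<^sub>C divided_power e (Suc m) = e * divided_power e m"
  by (simp_all add: divided_power_def mult_scaleC_right scaleC_scaleC fact_Suc del: of_nat_Suc)

lemma divided_ad_Suc: "e * divided_ad e z j = of_nat (Suc j) *\<^sub>C divided_ad e z (Suc j) + divided_ad e z j * e"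
proof -
  have "of_nat (Suc j) *\<^sub>C divided_ad e z (Suc j) = (1 / fact j) *\<^sub>C commutator e ((commutator e ^^ j) z)"
    by (simp add: divided_ad_def scaleC_scaleC fact_Suc del: of_nat_Suc)
  then show ?thesis
    by (simp add: divided_ad_def commutator_def complex_vector.scale_right_diff_distrib mult_scaleC_left mult_scaleC_right)
qed

text \<open>Leibniz rule; the factorials absorb the binomial coefficients. In the induction step
  both sides are multiplied by m + 1, which splits as j + (m + 1 - j) in the j-th term.\<close>

lemma divided_power_mult:
  "divided_power e m * z = (\<Sum>j\<le>m. divided_ad e z j * divided_power e (m - j))"
proof (induction m)
  case 0
  then show ?case by (simp add: divided_power_def divided_ad_def scaleC_one)
next
  case (Suc m)
  let ?A = "divided_ad e z" and ?E = "divided_power e"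
  have "of_nat (Suc m) *\<^sub>C (?E (Suc m) * z) = e * (?E m * z)"
    by (simp only: mult_scaleC_left[symmetric] divided_power_Suc' mult.assoc)
  also have "\<dots> = (\<Sum>j\<le>m. (e * ?A j) * ?E (m - j))"
    by (simp only: Suc sum_distrib_left mult.assoc)
  also have "\<dots> = (\<Sum>j\<le>m. of_nat (Suc j) *\<^sub>C (?A (Suc j) * ?E (m - j))) + (\<Sum>j\<le>m. ?A j * (e * ?E (m - j)))"
    by (simp only: divided_ad_Suc distrib_right sum.distrib mult_scaleC_left mult.assoc)
  also have "(\<Sum>j\<le>m. of_nat (Suc j) *\<^sub>C (?A (Suc j) * ?E (m - j)))
      = (\<Sum>j\<le>Suc m. of_nat j *\<^sub>C (?A j * ?E (Suc m - j)))"
    by (subst sum.atMost_Suc_shift) simp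
  also have "(\<Sum>j\<le>m. ?A j * (e * ?E (m - j))) = (\<Sum>j\<le>Suc m. of_nat (Suc m - j) *\<^sub>C (?A j * ?E (Suc m - j)))"
    by (simp add: divided_power_Suc mult_scaleC_right Suc_diff_le del: of_nat_Suc of_nat_diff)
  also have "(\<Sum>j\<le>Suc m. of_nat j *\<^sub>C (?A j * ?E (Suc m - j))) + \<dots>
      = of_nat (Suc m) *\<^sub>C (\<Sum>j\<le>Suc m. ?A j * ?E (Suc m - j))"
    unfolding complex_vector.scale_sum_right sum.distrib[symmetric]
    by (intro sum.cong refl) (simp flip: scaleC_add_left of_nat_add del: of_nat_Suc of_nat_diff)
  finally have eq: "of_nat (Suc m) *\<^sub>C (?E (Suc m) * z) = of_nat (Suc m) *\<^sub>C (\<Sum>j\<le>Suc m. ?A j * ?E (Suc m - j))" .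
  show ?case by (rule complex_vector.scale_left_imp_eq[OF _ eq]) (simp del: of_nat_Suc)
qed

text \<open>\<open>exp_image J e u u'\<close> expresses \<open>u' = exp e \<cdot> u\<close> in the quotient by \<open>J\<close>, where the exponential
  series is a finite sum.\<close>

definition exp_image :: "'u::complex_algebra_1 set \<Rightarrow> 'u \<Rightarrow> 'u \<Rightarrow> 'u \<Rightarrow> bool"
  where "exp_image J e u u' \<longleftrightarrow> (\<exists>n0. \<forall>n\<ge>n0. (\<Sum>m<n. divided_power e m) * u - u' \<in> J)"

lemma exp_image_trunc:
  assumes J: "left_ideal J" and n0: "e ^ n0 * u \<in> J"
  shows "exp_image J e u ((\<Sum>m<n0. divided_power e m) * u)"
  unfolding exp_image_def
proof (intro exI[of _ n0] allI impI)
  fix n assume "n0 \<le> n"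
  then have "(\<Sum>m<n. divided_power e m) * u - (\<Sum>m<n0. divided_power e m) * u
      = (\<Sum>m\<in>{n0..<n}. divided_power e m * u)"
    by (simp add: sum_distrib_right sum_diff_nat_ivl[of 0 n0 n, unfolded atLeast0LessThan] flip: left_diff_distrib)
  also have "\<dots> \<in> J"
    using power_mult_mono[OF J n0]
    by (intro csubspace_sum[OF left_ideal_subspace[OF J]])
      (simp add: divided_power_def mult_scaleC_left csubspace_scale[OF left_ideal_subspace[OF J]])
  finally show "(\<Sum>m<n. divided_power e m) * u - (\<Sum>m<n0. divided_power e m) * u \<in> J" .
qed

lemma exp_image_diff:
  assumes J: "left_ideal J" and "exp_image J e u u'" "exp_image J e v v'"
  shows "exp_image J e (u - v) (u' - v')"
proof -
  obtain n m where nm: "\<And>k. k \<ge> n \<Longrightarrow> (\<Sum>m<k. divided_power e m) * u - u' \<in> J"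
    "\<And>k. k \<ge> m \<Longrightarrow> (\<Sum>m<k. divided_power e m) * v - v' \<in> J"
    using assms unfolding exp_image_def by blast
  show ?thesis
    unfolding exp_image_def
  proof (intro exI[of _ "max n m"] allI impI)
    fix k assume "max n m \<le> k"
    then have "n \<le> k" "m \<le> k" by auto
    from csubspace_diff[OF left_ideal_subspace[OF J] nm(1)[OF this(1)] nm(2)[OF this(2)]]
    show "(\<Sum>m<k. divided_power e m) * (u - v) - (u' - v') \<in> J" by (simp add: algebra_simps)
  qed
qed

text \<open>exp(e) u' - u' is killed by a lower power of e than u', so by induction it has a
  preimage v under exp(e), and u' - v is a preimage of u'.\<close>

lemma exp_image_surj:
  assumes J: "left_ideal J" and n: "e ^ n * u' \<in> J"
  shows "\<exists>u. exp_image J e u u'"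
  using n
proof (induction n arbitrary: u')
  case 0
  then have "- u' \<in> J" using csubspace_neg[OF left_ideal_subspace[OF J]] by simp
  then show ?case by (intro exI[of _ 0]) (simp add: exp_image_def)
next
  case (Suc n)
  let ?w = "(\<Sum>m<Suc n. divided_power e m) * u'"
  have "?w - u' = (\<Sum>m<n. divided_power e (Suc m) * u')"
    by (subst sum.lessThan_Suc_shift) (simp add: distrib_right sum_distrib_right divided_power_def scaleC_one)
  then have "e ^ n * (?w - u') = (\<Sum>m<n. e ^ n * (divided_power e (Suc m) * u'))"
    by (simp only: sum_distrib_left)
  also have "\<dots> \<in> J"
  proof (rule csubspace_sum[OF left_ideal_subspace[OF J]])
    fix m
    have "e ^ n * (divided_power e (Suc m) * u') = (1 / fact (Suc m)) *\<^sub>C (e ^ (n + Suc m) * u')"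
      by (simp only: divided_power_def mult_scaleC_left mult_scaleC_right power_add mult.assoc)
    also have "\<dots> \<in> J"
      by (intro csubspace_scale[OF left_ideal_subspace[OF J]] power_mult_mono[OF J Suc.prems]) simp
    finally show "e ^ n * (divided_power e (Suc m) * u') \<in> J" .
  qed
  finally obtain v where "exp_image J e v (?w - u')" using Suc.IH by blast
  from exp_image_diff[OF J exp_image_trunc[OF J Suc.prems] this]
  have "exp_image J e (u' - v) u'" by simp
  then show ?case by blast
qed

lemma sum_triangle: "(\<Sum>m<n. \<Sum>j\<le>m. f j (m - j)) = (\<Sum>j<n. \<Sum>k<n - j. f j k)"
  for f :: "nat \<Rightarrow> nat \<Rightarrow> 'a::comm_monoid_add"
proof (induction n)
  case (Suc n)
  have "(\<Sum>j<Suc n. \<Sum>k<Suc n - j. f j k) = (\<Sum>j<n. (\<Sum>k<n - j. f j k) + f j (n - j)) + f n 0"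
    by (simp add: Suc_diff_le)
  also have "\<dots> = (\<Sum>m<n. \<Sum>j\<le>m. f j (m - j)) + (\<Sum>j\<le>n. f j (n - j))"
    by (simp add: sum.distrib Suc add.assoc lessThan_Suc_atMost[of n, symmetric])
  finally show ?case by simp
qed simp

text \<open>exp(e) z u = exp(ad e)(z) exp(e) u. Both series are finite: the one in ad e stops before
  N, the other one stabilizes modulo J.\<close>

lemma exp_image_mult:
  assumes J: "left_ideal J" and N: "\<And>j. j \<ge> N \<Longrightarrow> divided_ad e z j = 0" and u: "exp_image J e u u'"
  shows "exp_image J e (z * u) ((\<Sum>j<N. divided_ad e z j) * u')"
proof -
  obtain n0 where n0: "\<And>n. n \<ge> n0 \<Longrightarrow> (\<Sum>m<n. divided_power e m) * u - u' \<in> J"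
    using u unfolding exp_image_def by blast
  show ?thesis
    unfolding exp_image_def
  \<comment> \<open>For j < N the inner sums then still have n - j \<ge> n0 terms, enough to
    represent u'.\<close>
  proof (intro exI[of _ "n0 + N"] allI impI)
    fix n assume n: "n0 + N \<le> n"
    have "divided_power e m * (z * u) = (\<Sum>j\<le>m. divided_ad e z j * (divided_power e (m - j) * u))" for m
    proof -
      have "divided_power e m * (z * u) = (divided_power e m * z) * u" by (simp only: mult.assoc)
      then show ?thesis by (simp only: divided_power_mult[of e m z] sum_distrib_right mult.assoc)
    qed
    then have "(\<Sum>m<n. divided_power e m) * (z * u) = (\<Sum>m<n. \<Sum>j\<le>m. divided_ad e z j * (divided_power e (m - j) * u))"
      by (simp only: sum_distrib_right)
    also have "\<dots> = (\<Sum>j<n. divided_ad e z j * ((\<Sum>k<n - j. divided_power e k) * u))"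
      using sum_triangle[of "\<lambda>j k. divided_ad e z j * (divided_power e k * u)" n]
      by (simp only: sum_distrib_right sum_distrib_left)
    also have "\<dots> = (\<Sum>j<N. divided_ad e z j * ((\<Sum>k<n - j. divided_power e k) * u))"
      using n N by (intro sum.mono_neutral_right) auto
    finally have "(\<Sum>m<n. divided_power e m) * (z * u) - (\<Sum>j<N. divided_ad e z j) * u'
      = (\<Sum>j<N. divided_ad e z j * ((\<Sum>k<n - j. divided_power e k) * u - u'))"
      by (simp add: sum_distrib_right sum_subtractf right_diff_distrib)
    also have "\<dots> \<in> J"
      using n by (intro csubspace_sum[OF left_ideal_subspace[OF J]] left_ideal_mult[OF J] n0) auto
    finally show "(\<Sum>m<n. divided_power e m) * (z * u) - (\<Sum>j<N. divided_ad e z j) * u' \<in> J" .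
  qed
qed

text \<open>\<open>exp (ad e) z = exp e \<cdot> z \<cdot> exp (-e)\<close> is locally nilpotent with \<open>z\<close>.\<close>

lemma nilpotent_exp_ad:
  assumes J: "left_ideal J" and e: "\<And>u. nilpotent_at J e u" and z: "\<And>u. nilpotent_at J z u"
    and N: "(commutator e ^^ N) z = 0"
  shows "nilpotent_at J (\<Sum>j<N. divided_ad e z j) u'"
proof -
  have N': "divided_ad e z j = 0" if "j \<ge> N" for j
  proof -
    have "(commutator e ^^ (j - N + N)) z = (commutator e ^^ (j - N)) ((commutator e ^^ N) z)"
      by (simp only: funpow_add o_apply)
    then show ?thesis
      using that N clinear_0[OF clinear_funpow[OF clinear_commutator]] by (simp add: divided_ad_def)
  qed
  obtain u where u: "exp_image J e u u'" using exp_image_surj[OF J] e unfolding nilpotent_at_def by blast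
  obtain k where k: "z ^ k * u \<in> J" using z unfolding nilpotent_at_def by blast
  \<comment> \<open>Since exp(e) u = u', the k-th power of exp(ad e)(z) kills u' as soon as z^k
    kills u.\<close>
  have "exp_image J e (z ^ k * u) ((\<Sum>j<N. divided_ad e z j) ^ k * u')"
  proof (induction k)
    case (Suc k)
    then show ?case using exp_image_mult[OF J N' Suc] by (simp add: mult.assoc)
  qed (use u in simp)
  then obtain n where "(\<Sum>m<n. divided_power e m) * (z ^ k * u) - (\<Sum>j<N. divided_ad e z j) ^ k * u' \<in> J"
    unfolding exp_image_def by blast
  from csubspace_diff[OF left_ideal_subspace[OF J] left_ideal_mult[OF J k, of "\<Sum>m<n. divided_power e m"] this]
  have "(\<Sum>j<N. divided_ad e z j) ^ k * u' \<in> J" by simp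
  then show ?thesis unfolding nilpotent_at_def by blast
qed

text \<open>Replacing t by 2t and subtracting 2^N times the curve removes the top coefficient and
  multiplies the j-th one by 2^j - 2^N, which is nonzero.\<close>

lemma polynomial_curve_coeff:
  fixes v :: "nat \<Rightarrow> 'a::complex_vector"
  assumes S: "csubspace S" and "\<And>t. (\<Sum>j<N. t ^ j *\<^sub>C v j) \<in> S" and "j < N"
  shows "v j \<in> S"
  using assms(2,3)
proof (induction N arbitrary: v j)
  case 0
  then show ?case by simp
next
  case (Suc N)
  have low: "v j \<in> S" if "j < N" for j
  proof -
    let ?w = "\<lambda>j. (2 ^ j - 2 ^ N) *\<^sub>C v j"
    have "?w j \<in> S"
    proof (rule Suc.IH[OF _ that])
      fix t :: complex
      have "(\<Sum>j<Suc N. (2 * t) ^ j *\<^sub>C v j) - 2 ^ N *\<^sub>C (\<Sum>j<Suc N. t ^ j *\<^sub>C v j) \<in> S"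
        by (intro csubspace_diff[OF S] csubspace_scale[OF S] Suc.prems(1))
      moreover have "(\<Sum>j<Suc N. (2 * t) ^ j *\<^sub>C v j) - 2 ^ N *\<^sub>C (\<Sum>j<Suc N. t ^ j *\<^sub>C v j)
          = (\<Sum>j<Suc N. t ^ j *\<^sub>C ?w j)"
        unfolding complex_vector.scale_sum_right sum_subtractf[symmetric]
        by (intro sum.cong refl)
          (simp add: scaleC_scaleC power_mult_distrib algebra_simps flip: complex_vector.scale_left_diff_distrib)
      ultimately show "(\<Sum>j<N. t ^ j *\<^sub>C ?w j) \<in> S" by simp
    qed
    then have "(1 / (2 ^ j - 2 ^ N)) *\<^sub>C ?w j \<in> S" by (rule csubspace_scale[OF S])
    moreover have "(2 :: complex) ^ j \<noteq> 2 ^ N"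
    proof
      assume "(2 :: complex) ^ j = 2 ^ N"
      then have "of_nat (2 ^ j) = (of_nat (2 ^ N) :: complex)" by simp
      then have "(2::nat) ^ j = 2 ^ N" by (simp only: of_nat_eq_iff)
      with that show False by simp
    qed
    ultimately show ?thesis by (simp add: scaleC_scaleC scaleC_one)
  qed
  show ?case
  proof (cases "j = N")
    case True
    have "(\<Sum>j<Suc N. 1 ^ j *\<^sub>C v j) - (\<Sum>j<N. v j) \<in> S"
      using low by (intro csubspace_diff[OF S Suc.prems(1)] csubspace_sum[OF S]) auto
    then show ?thesis using True by (simp add: scaleC_one)
  qed (use low Suc.prems in auto)
qed

section \<open>A finiteness criterion\<close>

text \<open>Ordered monomials span, as in the Poincare-Birkhoff-Witt theorem.\<close>

definition word_span :: "(nat \<Rightarrow> 'u::complex_algebra_1) \<Rightarrow> nat \<Rightarrow> 'u set \<Rightarrow> nat \<Rightarrow> 'u set"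
  where "word_span z d J r =
    cspan ({prod_list (map z l) | l. set l \<subseteq> {..<d} \<and> length l \<le> r} \<union> J)"

lemma word_span_word: "set l \<subseteq> {..<d} \<Longrightarrow> length l \<le> r \<Longrightarrow> prod_list (map z l) \<in> word_span z d J r"
  unfolding word_span_def by (intro cspan_base) blast

lemma word_span_J: "x \<in> J \<Longrightarrow> x \<in> word_span z d J r"
  unfolding word_span_def by (intro cspan_base) blast

lemma subspace_word_span: "csubspace (word_span z d J r)"
  unfolding word_span_def by (rule csubspace_span)

lemma clinear_span_induct:
  assumes f: "clinear f" and S: "csubspace S" and x: "x \<in> cspan A"
    and A: "\<And>a. a \<in> A \<Longrightarrow> f a \<in> S"
  shows "f x \<in> S"
proof (rule cspan_induct[OF x, where P = "\<lambda>x. f x \<in> S"])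
  show "csubspace (Collect (\<lambda>x. f x \<in> S))"
    using csubspace_0[OF S] csubspace_add[OF S] csubspace_scale[OF S]
    by (intro csubspaceI) (auto simp: clinear_0[OF f] clinear_add[OF f] clinear_scale[OF f])
qed (rule A)

lemma word_span_mult:
  assumes J: "left_ideal J" and i: "i < d" and x: "x \<in> word_span z d J r"
  shows "z i * x \<in> word_span z d J (Suc r)"
proof (rule clinear_span_induct[OF clinear_mult subspace_word_span x[unfolded word_span_def]])
  fix a assume "a \<in> {prod_list (map z l) | l. set l \<subseteq> {..<d} \<and> length l \<le> r} \<union> J"
  then show "z i * a \<in> word_span z d J (Suc r)"
  proof
    assume "a \<in> {prod_list (map z l) | l. set l \<subseteq> {..<d} \<and> length l \<le> r}"
    then obtain l where "a = prod_list (map z l)" "set l \<subseteq> {..<d}" "length l \<le> r" by blast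
    then show ?thesis using word_span_word[of "i # l" d "Suc r" z J] i by simp
  qed (auto intro: word_span_J left_ideal_mult[OF J])
qed

lemma clinear_mult_right: "clinear (\<lambda>x. x * (u :: 'u::complex_algebra_1))"
  by (simp add: clinear_def distrib_right mult_scaleC_left)

text \<open>Commutators lie in the span of the letters up to elements that annihilate the whole
  module U/J, not only its generator; in \<open>finite_mod_ideal\<close> these come from the x
  \<otimes> t^s F.\<close>

context
  fixes J :: "'u::complex_algebra_1 set" and z :: "nat \<Rightarrow> 'u" and d :: nat
  assumes J: "left_ideal J"
    and comm: "\<And>i j. i < d \<Longrightarrow> j < d \<Longrightarrow>
      \<exists>w\<in>cspan (z ` {..<d}). \<exists>k. (\<forall>u. k * u \<in> J) \<and> commutator (z i) (z j) = w + k"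
    and nil: "\<And>i u. i < d \<Longrightarrow> nilpotent_at J (z i) u"
begin

text \<open>Exchanging two adjacent letters costs their commutator, which contributes shorter words
  and an element of J.\<close>

lemma word_insort:
  "set l \<subseteq> {..<d} \<Longrightarrow> a < d \<Longrightarrow>
    prod_list (map z (a # l)) - prod_list (map z (insort a l)) \<in> word_span z d J (length l)"
proof (induction l)
  case Nil
  then show ?case using csubspace_0[OF subspace_word_span] by simp
next
  case (Cons b l)
  show ?case
  proof (cases "a \<le> b")
    case True
    then show ?thesis using csubspace_0[OF subspace_word_span] by simp
  next
    case False
    let ?p = "prod_list (map z l)"
    have b: "b < d" using Cons.prems by simp
    obtain w k where wk: "w \<in> cspan (z ` {..<d})" "\<And>u. k * u \<in> J" "commutator (z a) (z b) = w + k"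
      using comm[OF Cons.prems(2) b] by blast
    have 1: "w * ?p \<in> word_span z d J (Suc (length l))"
    proof (rule clinear_span_induct[OF clinear_mult_right subspace_word_span wk(1)])
      fix x assume "x \<in> z ` {..<d}"
      then obtain i where "i < d" "x = z i" by auto
      then show "x * ?p \<in> word_span z d J (Suc (length l))"
        using word_span_word[of "i # l" d "Suc (length l)" z J] Cons.prems by simp
    qed
    have 2: "k * ?p \<in> word_span z d J (Suc (length l))" by (rule word_span_J[OF wk(2)])
    have 3: "z b * (z a * ?p - prod_list (map z (insort a l))) \<in> word_span z d J (Suc (length l))"
      using word_span_mult[OF J b] Cons by simp
    have "z a * z b = z b * z a + (w + k)" using wk(3) by (simp add: commutator_def algebra_simps)
    then have "z a * (z b * ?p) = z b * (z a * ?p) + w * ?p + k * ?p"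
      by (metis mult.assoc distrib_right add.assoc)
    then have "prod_list (map z (a # b # l)) - prod_list (map z (insort a (b # l)))
        = z b * (z a * ?p - prod_list (map z (insort a l))) + w * ?p + k * ?p"
      using False by (simp add: right_diff_distrib)
    with csubspace_add[OF subspace_word_span csubspace_add[OF subspace_word_span 3 1] 2]
    show ?thesis by (simp only: list.size add_0_right add_Suc_right One_nat_def)
  qed
qed

lemma word_sort:
  "set l \<subseteq> {..<d} \<Longrightarrow> length l \<le> Suc r \<Longrightarrow>
    prod_list (map z l) - prod_list (map z (sort l)) \<in> word_span z d J r"
proof (induction l arbitrary: r)
  case Nil
  then show ?case using csubspace_0[OF subspace_word_span] by simp
next
  case (Cons a l)
  have mono: "word_span z d J (length l) \<subseteq> word_span z d J r"
    unfolding word_span_def using Cons.prems by (intro cspan_mono) auto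
  have "z a * (prod_list (map z l) - prod_list (map z (sort l))) \<in> word_span z d J r"
  proof (cases r)
    case 0
    then show ?thesis using Cons.prems csubspace_0[OF subspace_word_span] by simp
  next
    case (Suc r')
    then show ?thesis using word_span_mult[OF J, of a d _ z r'] Cons by simp
  qed
  moreover have "prod_list (map z (a # sort l)) - prod_list (map z (insort a (sort l))) \<in> word_span z d J r"
    using word_insort[of "sort l" a] Cons.prems mono by auto
  ultimately have "z a * (prod_list (map z l) - prod_list (map z (sort l))) +
      (prod_list (map z (a # sort l)) - prod_list (map z (insort a (sort l)))) \<in> word_span z d J r"
    by (rule csubspace_add[OF subspace_word_span])
  then show ?case by (simp add: right_diff_distrib)
qed

text \<open>A sorted word is z_k^a times a sorted word in later letters. The latter lies in the span
  of finitely many b modulo J, and z_k is nilpotent at each of them, so finitely many exponents a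
  matter.\<close>

lemma sorted_words_finite:
  assumes "k \<le> d"
  shows "\<exists>B. finite B \<and> (\<forall>l. sorted l \<and> set l \<subseteq> {k..<d} \<longrightarrow> prod_list (map z l) \<in> cspan (B \<union> J))"
  using assms
proof (induction k rule: inc_induct)
  case base
  have "1 \<in> cspan ({1} \<union> J)" by (intro cspan_base) blast
  then show ?case by (intro exI[of _ "{1}"]) auto
next
  case (step k)
  then obtain B where B: "finite B"
    "\<And>l. sorted l \<Longrightarrow> set l \<subseteq> {Suc k..<d} \<Longrightarrow> prod_list (map z l) \<in> cspan (B \<union> J)" by blast
  have "\<exists>n. z k ^ n * b \<in> J" for b using nil step.hyps unfolding nilpotent_at_def by blast
  then obtain n where n: "\<And>b. z k ^ n b * b \<in> J" by metis
  define M where "M = (\<Sum>b\<in>B. n b)"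
  have M: "z k ^ a * b \<in> J" if "b \<in> B" "M \<le> a" for a b
  proof (rule power_mult_mono[OF J n])
    show "n b \<le> a" using that B(1) member_le_sum[of b B n] by (auto simp: M_def)
  qed
  define C where "C = (\<lambda>(a, b). z k ^ a * b) ` ({..<M} \<times> B)"
  have "prod_list (map z l) \<in> cspan (C \<union> J)" if l: "sorted l" "set l \<subseteq> {k..<d}" for l
  proof -
    define l' where "l' = filter (\<lambda>i. i \<noteq> k) l"
    have split: "\<exists>a. l = replicate a k @ l'" using l unfolding l'_def
    proof (induction l)
      case (Cons i l)
      show ?case
      proof (cases "i = k")
        case True
        obtain a where "l = replicate a k @ filter (\<lambda>i. i \<noteq> k) l" using Cons by auto
        then show ?thesis using True by (intro exI[of _ "Suc a"]) simp
      next
        case False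
        then have "filter (\<lambda>i. i \<noteq> k) l = l" using Cons.prems by (auto simp: filter_id_conv)
        then show ?thesis using False by (intro exI[of _ 0]) simp
      qed
    qed simp
    then obtain a where a: "l = replicate a k @ l'" by blast
    have "sorted l'" "set l' \<subseteq> {Suc k..<d}" using l unfolding l'_def by (auto simp: sorted_wrt_filter)
    from B(2)[OF this] have "z k ^ a * prod_list (map z l') \<in> cspan (C \<union> J)"
    proof (rule clinear_span_induct[OF clinear_mult csubspace_span])
      fix b assume "b \<in> B \<union> J"
      then show "z k ^ a * b \<in> cspan (C \<union> J)"
      proof
        assume b: "b \<in> B"
        then have "z k ^ a * b \<in> C \<union> J"
          using M[OF b] by (cases "a < M") (auto simp: C_def)
        then show ?thesis by (rule cspan_base)
      next
        assume "b \<in> J"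
        then show ?thesis using left_ideal_mult[OF J] by (intro cspan_base) auto
      qed
    qed
    then show ?thesis by (simp add: a)
  qed
  moreover have "finite C" using B(1) by (simp add: C_def)
  ultimately show ?case by blast
qed

lemma words_finite:
  "\<exists>B. finite B \<and> (\<forall>l. set l \<subseteq> {..<d} \<longrightarrow> prod_list (map z l) \<in> cspan (B \<union> J))"
proof -
  obtain B where B: "finite B"
    "\<And>l. sorted l \<Longrightarrow> set l \<subseteq> {..<d} \<Longrightarrow> prod_list (map z l) \<in> cspan (B \<union> J)"
    using sorted_words_finite[of 0] by (auto simp: atLeast0LessThan)
  have words: "prod_list (map z l) \<in> cspan (B \<union> J)" if "set l \<subseteq> {..<d}" "length l \<le> n" for l n
    using that
  proof (induction n arbitrary: l)
    case 0
    then show ?case using B(2)[of l] by simp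
  next
    case (Suc n)
    have "word_span z d J n \<subseteq> cspan (B \<union> J)"
      unfolding word_span_def
      using Suc.IH cspan_base[of _ "B \<union> J"]
      by (intro cspan_minimal[OF _ csubspace_span]) auto
    then have "prod_list (map z l) - prod_list (map z (sort l)) \<in> cspan (B \<union> J)"
      using word_sort[OF Suc.prems] by blast
    moreover have "prod_list (map z (sort l)) \<in> cspan (B \<union> J)"
      using Suc.prems by (intro B(2)) auto
    ultimately show ?case using cspan_add by fastforce
  qed
  from B(1) words[OF _ order_refl] show ?thesis by blast
qed

end

text \<open>Each factor from L is replaced by a combination of elements of W plus an annihilator of
  the module. Closure of L under commutators supplies the hypothesis of
  \<open>words_finite\<close>.\<close>

lemma products_finite:
  fixes J :: "'u::complex_algebra_1 set"
  assumes J: "left_ideal J" and W: "finite W" "W \<subseteq> L"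
    and nil: "\<And>w u. w \<in> W \<Longrightarrow> nilpotent_at J w u"
    and L: "\<And>x. x \<in> L \<Longrightarrow> \<exists>w\<in>cspan W. \<exists>k. (\<forall>u. k * u \<in> J) \<and> x = w + k"
    and comm: "\<And>x y. x \<in> L \<Longrightarrow> y \<in> L \<Longrightarrow> commutator x y \<in> L"
  shows "\<exists>B. finite B \<and> (\<forall>l. set l \<subseteq> L \<longrightarrow> prod_list l \<in> cspan (B \<union> J))"
proof -
  obtain z :: "nat \<Rightarrow> 'u" and d where z: "W = z ` {..<d}"
    using finite_imp_nat_seg_image_inj_on[OF W(1)] by (metis lessThan_def)
  have "\<exists>B. finite B \<and> (\<forall>l. set l \<subseteq> {..<d} \<longrightarrow> prod_list (map z l) \<in> cspan (B \<union> J))"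
  proof (rule words_finite[OF J])
    show "\<exists>w\<in>cspan (z ` {..<d}). \<exists>k. (\<forall>u. k * u \<in> J) \<and> commutator (z i) (z j) = w + k"
      if "i < d" "j < d" for i j
      unfolding z[symmetric] using that W(2) z by (intro L comm) auto
    show "nilpotent_at J (z i) u" if "i < d" for i u using that nil z by blast
  qed
  then obtain B where B: "finite B"
    "\<And>l. set l \<subseteq> {..<d} \<Longrightarrow> prod_list (map z l) \<in> cspan (B \<union> J)" by blast
  let ?S = "cspan ({prod_list (map z l) | l. set l \<subseteq> {..<d}} \<union> J)"
  have "prod_list l \<in> ?S" if "set l \<subseteq> L" for l
    using that
  proof (induction l)
    case Nil
    have "prod_list (map z []) \<in> ?S" by (intro cspan_base UnI1 CollectI exI[of _ "[]"]) simp
    then show ?case by simp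
  next
    case (Cons x l)
    then obtain w k where wk: "w \<in> cspan W" "\<And>u. k * u \<in> J" "x = w + k"
      using L[of x] by auto
    have step: "z i * p \<in> ?S" if "i < d" "p \<in> ?S" for i p
    proof (rule clinear_span_induct[OF clinear_mult csubspace_span that(2)])
      fix a assume "a \<in> {prod_list (map z l) | l. set l \<subseteq> {..<d}} \<union> J"
      then have "z i * a \<in> {prod_list (map z l) | l. set l \<subseteq> {..<d}} \<union> J"
      proof
        assume "a \<in> {prod_list (map z l) | l. set l \<subseteq> {..<d}}"
        then obtain l where "a = prod_list (map z l)" "set l \<subseteq> {..<d}" by blast
        then have "z i * a = prod_list (map z (i # l))" "set (i # l) \<subseteq> {..<d}" using that by auto
        then show ?thesis by blast
      qed (use left_ideal_mult[OF J] in auto)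
      then show "z i * a \<in> ?S" by (rule cspan_base)
    qed
    have "w * prod_list l \<in> ?S"
    proof (rule clinear_span_induct[OF clinear_mult_right csubspace_span wk(1)])
      fix a assume "a \<in> W"
      then obtain i where "i < d" "a = z i" using z by auto
      then show "a * prod_list l \<in> ?S" using step Cons by simp
    qed
    moreover have "k * prod_list l \<in> ?S" using wk(2) by (intro cspan_base UnI2)
    ultimately show ?case by (simp add: wk(3) distrib_right cspan_add)
  qed
  moreover have "?S \<subseteq> cspan (B \<union> J)"
    using B(2) cspan_base[of _ "B \<union> J"]
    by (intro cspan_minimal[OF _ csubspace_span]) auto
  ultimately show ?thesis using B(1) by blast
qed

section \<open>Cyclic modules for loop algebras\<close>

text \<open>The ring \<open>'u\<close> is generated by the images \<open>X x m\<close> of the elements \<open>x \<otimes> t^m\<close> and by \<open>Ds\<close>, which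
  is empty for the loop algebra and consists of the degree derivation for its extension.\<close>

locale loop_rep = cartan_setting D
  for D :: "'g::complex_lie_algebra cartan_data" +
  fixes X :: "'g \<Rightarrow> int \<Rightarrow> 'u::complex_algebra_1" and Ds :: "'u set"
  assumes X_add: "X (x + y) m = X x m + X y m"
    and X_scale: "X (c *\<^sub>C x) m = c *\<^sub>C X x m"
    and X_lie: "commutator (X x m) (X y n) = X (lie x y) (m + n)"
    and Ds: "d \<in> Ds \<Longrightarrow> commutator d (X x m) = of_int m *\<^sub>C X x m"
    and generated: "P 1 \<Longrightarrow> (\<And>u v. P u \<Longrightarrow> P v \<Longrightarrow> P (u + v)) \<Longrightarrow> (\<And>c u. P u \<Longrightarrow> P (c *\<^sub>C u)) \<Longrightarrow>
      (\<And>x m u. P u \<Longrightarrow> P (X x m * u)) \<Longrightarrow> (\<And>d u. d \<in> Ds \<Longrightarrow> P u \<Longrightarrow> P (d * u)) \<Longrightarrow> P u"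
begin

lemma clinear_X: "clinear (\<lambda>x. X x m)"
  by (simp add: clinear_def X_add X_scale)

lemma X_0 [simp]: "X 0 m = 0"
  using clinear_0[OF clinear_X] .

lemma X_mult: "X x m * X y n = X y n * X x m + X (lie x y) (m + n)"
  using X_lie[of x m y n] by (simp add: commutator_def algebra_simps)

lemma commutator_funpow: "(commutator (X x m) ^^ k) (X y n) = X ((lie x ^^ k) y) (int k * m + n)"
  by (induction k) (simp_all add: X_lie algebra_simps)

lemma X_span: "x \<in> cspan Z \<Longrightarrow> X x m \<in> cspan ((\<lambda>z. X z m) ` Z)"
  by (rule clinear_span_induct[OF clinear_X csubspace_span]) (auto intro: cspan_base)

end

text \<open>J is the annihilator of the generator of a cyclic module. It will be the annihilator of
  1 \<otimes> 1 in W(\<pi>) and the defining left ideal of W(\<lambda>).\<close>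

locale loop_module = loop_rep D X Ds
  for D :: "'g::complex_lie_algebra cartan_data" and X :: "'g \<Rightarrow> int \<Rightarrow> 'u::complex_algebra_1" and Ds +
  fixes J :: "'u set"
  assumes left_ideal_J: "left_ideal J"
    and xp_J: "i \<in> I \<Longrightarrow> X (xp i) m \<in> J"
    and xm_nil: "i \<in> I \<Longrightarrow> nilpotent_at J (X (xm i) 0) 1"
begin

lemma subspace_J: "csubspace J"
  by (rule left_ideal_subspace[OF left_ideal_J])

text \<open>Nilpotency spreads from the generator by \<open>nilpotent_at_mult\<close>. The degree
  derivation is covered too: its commutator with \<open>X x m\<close> is a multiple of
  \<open>X x m\<close>, so the double commutator vanishes.\<close>

lemma nilpotent_at_of_1:
  assumes ad: "\<And>y. \<exists>k. (lie x ^^ k) y = 0" and 1: "nilpotent_at J (X x m) 1"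
  shows "nilpotent_at J (X x m) u"
proof (rule generated)
  fix y n u assume "nilpotent_at J (X x m) u"
  moreover obtain k where "(lie x ^^ k) y = 0" using ad by blast
  then have "(commutator (X x m) ^^ k) (X y n) = 0" by (simp add: commutator_funpow)
  ultimately show "nilpotent_at J (X x m) (X y n * u)" using nilpotent_at_mult[OF left_ideal_J] by blast
next
  fix d u assume d: "d \<in> Ds" and u: "nilpotent_at J (X x m) u"
  have "commutator (X x m) d = - of_int m *\<^sub>C X x m"
    using Ds[OF d, of x m] by (simp add: commutator_def algebra_simps)
  then have "(commutator (X x m) ^^ 2) d = (- of_int m) *\<^sub>C commutator (X x m) (X x m)"
    by (simp add: numeral_2_eq_2 clinear_scale[OF clinear_commutator] clinear_minus[OF clinear_commutator])
  then have "(commutator (X x m) ^^ 2) d = 0" by (simp add: commutator_def)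
  then show "nilpotent_at J (X x m) (d * u)" using nilpotent_at_mult[OF left_ideal_J _ u] by blast
qed (auto intro: 1 nilpotent_at_add[OF left_ideal_J] nilpotent_at_scale[OF left_ideal_J])

lemma ad_nilpotent_xp: "i \<in> I \<Longrightarrow> \<exists>k. (lie (xp i) ^^ k) y = 0"
  and ad_nilpotent_xm: "i \<in> I \<Longrightarrow> \<exists>k. (lie (xm i) ^^ k) y = 0"
  using ad_nilpotent_root[OF simple_roots tripleD(2)[OF triple_simple]]
    ad_nilpotent_root[OF triple_roots[OF triple_swap[OF triple_simple]] tripleD(3)[OF triple_simple]] by blast+

lemma nilpotent_at_J: "X x m \<in> J \<Longrightarrow> nilpotent_at J (X x m) 1"
  unfolding nilpotent_at_def by (intro exI[of _ 1]) simp

lemma nilpotent_xp: "i \<in> I \<Longrightarrow> nilpotent_at J (X (xp i) m) u"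
  by (rule nilpotent_at_of_1[OF ad_nilpotent_xp nilpotent_at_J[OF xp_J]])

lemma nilpotent_xm: "i \<in> I \<Longrightarrow> nilpotent_at J (X (xm i) 0) u"
  by (rule nilpotent_at_of_1[OF ad_nilpotent_xm xm_nil])

text \<open>A sum of locally nilpotent elements need not be locally nilpotent, hence the passage to
  the span below.\<close>

definition "nil_set m = {z. \<forall>u. nilpotent_at J (X z m) u}"

text \<open>The derivative at \<open>t = 0\<close> of the curve \<open>exp (t ad e) z\<close> of locally nilpotent elements.\<close>

lemma lie_nil_set:
  assumes e: "e \<in> nil_set 0" and ad: "\<And>y. \<exists>k. (lie e ^^ k) y = 0" and z: "z \<in> nil_set m"
  shows "lie e z \<in> cspan (nil_set m)"
proof -
  obtain k where k: "(lie e ^^ k) z = 0" using ad by blast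
  \<comment> \<open>At least two terms, so that the coefficient of t is present even for k =
    0.\<close>
  let ?N = "Suc (Suc k)"
  have N: "(lie e ^^ ?N) z = 0" using k by simp
  let ?v = "\<lambda>j. (1 / fact j) *\<^sub>C (lie e ^^ j) z"
  have "(\<Sum>j<?N. t ^ j *\<^sub>C ?v j) \<in> cspan (nil_set m)" for t
  proof (rule cspan_base)
    let ?e = "X (t *\<^sub>C e) 0"
    have pow: "(lie (t *\<^sub>C e) ^^ j) z = t ^ j *\<^sub>C (lie e ^^ j) z" for j
      by (induction j) (simp_all add: lie_scaleC_left lie_scaleC_right scaleC_scaleC scaleC_one mult.commute)
    have div: "divided_ad ?e (X z m) j = X (t ^ j *\<^sub>C ?v j) m" for j
      unfolding divided_ad_def commutator_funpow pow by (simp add: X_scale scaleC_scaleC mult.commute)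
    have nil_e: "nilpotent_at J ?e u" for u
    proof -
      obtain n where "X e 0 ^ n * u \<in> J" using e unfolding nil_set_def nilpotent_at_def by blast
      then have "t ^ n *\<^sub>C (X e 0 ^ n * u) \<in> J" by (rule csubspace_scale[OF subspace_J])
      moreover have "X (t *\<^sub>C e) 0 ^ n = t ^ n *\<^sub>C X e 0 ^ n"
        by (induction n) (simp_all add: X_scale scaleC_one mult_scaleC_left mult_scaleC_right scaleC_scaleC)
      ultimately show ?thesis unfolding nilpotent_at_def by (intro exI[of _ n]) (simp add: mult_scaleC_left)
    qed
    have "(commutator ?e ^^ ?N) (X z m) = 0"
      unfolding commutator_funpow pow N by simp
    then have "nilpotent_at J (\<Sum>j<?N. divided_ad ?e (X z m) j) u" for u
      using z by (intro nilpotent_exp_ad[OF left_ideal_J nil_e]) (auto simp: nil_set_def)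
    moreover have "(\<Sum>j<?N. divided_ad ?e (X z m) j) = X (\<Sum>j<?N. t ^ j *\<^sub>C ?v j) m"
      by (simp only: div clinear_sum[OF clinear_X])
    ultimately have "nilpotent_at J (X (\<Sum>j<?N. t ^ j *\<^sub>C ?v j) m) u" for u by (simp only:)
    then show "(\<Sum>j<?N. t ^ j *\<^sub>C ?v j) \<in> nil_set m" unfolding nil_set_def by blast
  qed
  from polynomial_curve_coeff[OF csubspace_span this, of 1]
  show ?thesis by (simp add: scaleC_one)
qed

text \<open>The x for which ad x preserves the span form a subalgebra. It contains the generators of
  the Lie algebra, so the span is an ideal.\<close>

lemma span_nil_set: "cspan (nil_set m) = UNIV"
proof -
  let ?S = "cspan (nil_set m)"
  have step: "lie e y \<in> ?S" if "e \<in> nil_set 0" "\<And>y. \<exists>k. (lie e ^^ k) y = 0" "y \<in> ?S" for e y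
    by (rule clinear_span_induct[OF clinear_lie csubspace_span that(3)])
      (rule lie_nil_set[OF that(1,2)])
  have all: "\<forall>y\<in>?S. lie x y \<in> ?S" for x
  proof -
    have "x \<in> lie_subalgebra hull (xp ` I \<union> xm ` I)" by (simp only: generated_by_simple_root_vectors UNIV_I)
    then show ?thesis
    proof (induction rule: lie_subalgebra_hull_induct)
      case (base x)
      then consider i where "i \<in> I" "x = xp i" | i where "i \<in> I" "x = xm i" by blast
      then show ?case
      proof cases
        case 1
        then show ?thesis
          using nilpotent_xp[OF 1(1)] by (intro ballI step ad_nilpotent_xp[OF 1(1), folded 1(2)]) (auto simp: nil_set_def)
      next
        case 2
        then show ?thesis
          using nilpotent_xm[OF 2(1)] by (intro ballI step ad_nilpotent_xm[OF 2(1), folded 2(2)]) (auto simp: nil_set_def)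
      qed
    next
      case subspace
      show ?case
        by (rule csubspaceI)
          (auto simp: lie_add_left lie_scaleC_left cspan_zero
            intro: cspan_add cspan_scale)
    next
      case (lie a b)
      show ?case
      proof
        fix y assume y: "y \<in> ?S"
        have "lie (lie a b) y = lie a (lie b y) - lie b (lie a y)" using lie_lie_left[of a b y] by simp
        then show "lie (lie a b) y \<in> ?S" using lie y by (simp add: cspan_diff)
      qed
    qed
  qed
  then have "lie_ideal ?S" by (simp add: lie_ideal_def csubspace_span)
  moreover have "?S \<noteq> {0}"
  proof -
    obtain i where i: "i \<in> I" using index_set_nonempty by blast
    then have "xp i \<in> nil_set m" unfolding nil_set_def using nilpotent_xp by blast
    then have "xp i \<in> ?S" by (rule cspan_base)
    moreover have "xp i \<noteq> 0" using triple_data[OF simple_roots_positive[OF i]] by simp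
    ultimately show ?thesis by blast
  qed
  ultimately show ?thesis using simple by (auto simp: simple_lie_def)
qed

lemma finite_nil_spanning:
  obtains Z where "finite Z" "Z \<subseteq> nil_set m" "cspan Z = UNIV"
proof -
  obtain Z where Z: "Z \<subseteq> nil_set m" "cindependent Z" "nil_set m \<subseteq> cspan Z"
    using complex_vector.basis_exists[of "nil_set m"] by metis
  have "cspan (nil_set m) \<subseteq> cspan Z"
    by (rule cspan_minimal[OF Z(3) csubspace_span])
  then have "cspan Z = UNIV" using span_nil_set by blast
  with that Z(1) finite_independent[OF Z(2)] show thesis by blast
qed

text \<open>Finite-dimensionality of what \<gg> \<otimes> 1 generates from the cyclic
  vector.\<close>

lemma products_degree_0_finite:
  "\<exists>B. finite B \<and> (\<forall>l. set l \<subseteq> range (\<lambda>x. X x 0) \<longrightarrow> prod_list l \<in> cspan (B \<union> J))"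
proof -
  obtain Z where Z: "finite Z" "Z \<subseteq> nil_set 0" "cspan Z = UNIV" by (rule finite_nil_spanning)
  show ?thesis
  proof (rule products_finite[OF left_ideal_J, of "(\<lambda>z. X z 0) ` Z"])
    fix x assume "x \<in> range (\<lambda>x. X x 0)"
    then have "x \<in> cspan ((\<lambda>z. X z 0) ` Z)" using X_span Z(3) by auto
    then show "\<exists>w\<in>cspan ((\<lambda>z. X z 0) ` Z). \<exists>k. (\<forall>u. k * u \<in> J) \<and> x = w + k"
      using csubspace_0[OF subspace_J] by (intro bexI[of _ x] exI[of _ 0]) auto
  qed (use Z in \<open>auto simp: nil_set_def X_lie\<close>)
qed

section \<open>The elements x \<otimes> t^s q(t) and reduction modulo a polynomial\<close>

definition poly_X :: "'g \<Rightarrow> complex poly \<Rightarrow> int \<Rightarrow> 'u"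
  where "poly_X x q s = poly_comb q (\<lambda>c. X x (s + int c))"

lemma poly_X_mult: "poly_X x (q * p) s = poly_comb q (\<lambda>c. poly_X x p (s + int c))"
  by (simp add: poly_X_def poly_comb_mult add.assoc)

lemma poly_X_mult_J: "(\<And>s. poly_X x p s \<in> J) \<Longrightarrow> poly_X x (q * p) s \<in> J"
  unfolding poly_X_mult by (intro poly_comb_in_subspace[OF subspace_J])

lemma clinear_poly_X: "clinear (\<lambda>x. poly_X x q s)"
  by (rule clinearI)
    (simp_all add: poly_X_def poly_comb_def X_add X_scale scaleC_add_right sum.distrib complex_vector.scale_sum_right
      scaleC_scaleC mult.commute)

lemma commutator_poly_X: "commutator (poly_X x p s) (X y n) = poly_X (lie x y) p (s + n)"
proof -
  have "commutator (poly_X x p s) (X y n) = - commutator (X y n) (poly_X x p s)" by (simp add: commutator_def)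
  also have "\<dots> = - poly_comb p (\<lambda>c. X (lie y x) (n + (s + int c)))"
    by (simp add: poly_X_def clinear_poly_comb[OF clinear_commutator] X_lie)
  also have "(\<lambda>c. X (lie y x) (n + (s + int c))) = (\<lambda>c. - X (lie x y) (s + n + int c))"
    by (subst lie_anticomm) (simp add: clinear_minus[OF clinear_X] add_ac)
  also have "- poly_comb p (\<lambda>c. - X (lie x y) (s + n + int c)) = poly_X (lie x y) p (s + n)"
    by (simp add: poly_comb_def poly_X_def sum_negf)
  finally show ?thesis .
qed

lemma commutator_poly_X_poly_X:
  "commutator (poly_X x p s) (poly_X y q s') = poly_X (lie x y) (q * p) (s + s')"
  unfolding poly_X_mult
  by (subst (2) poly_X_def) (simp add: clinear_poly_comb[OF clinear_commutator] commutator_poly_X add.assoc)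

text \<open>The condition on the constant coefficients lets F be used from both ends: its leading
  coefficient reduces high exponents of t, its constant coefficient reduces negative ones.\<close>

lemma finite_mod_ideal:
  assumes Ds: "Ds = {}"
    and p: "\<And>i. i \<in> I \<Longrightarrow> coeff (p i) 0 \<noteq> 0" "\<And>i s. i \<in> I \<Longrightarrow> poly_X (xm i) (p i) s \<in> J"
  shows "\<exists>B. finite B \<and> cspan (B \<union> J) = UNIV"
proof -
  define f where "f = (\<Prod>i\<in>I. p i)"
  have f0: "coeff f 0 \<noteq> 0"
    unfolding f_def using p(1) by (simp add: coeff_0_prod_list poly_0_coeff_0[symmetric] poly_prod)
  \<comment> \<open>\<open>Q x N\<close> says that x \<otimes> f^N \<complex>[t,t^-1] kills the
    generator; under brackets the exponents N add.\<close>
  define Q where "Q x N \<longleftrightarrow> (\<forall>s. poly_X x (f ^ N) s \<in> J)" for x N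
  have mono: "Q x (M + N)" if "Q x N" for x M N
    using that unfolding Q_def power_add by (intro allI poly_X_mult_J) blast
  have subspace_Q: "csubspace {x. Q x N}" for N
  proof (rule csubspaceI)
    fix x y assume "x \<in> {x. Q x N}" "y \<in> {x. Q x N}"
    then show "x + y \<in> {x. Q x N}"
      by (auto simp: Q_def clinear_add[OF clinear_poly_X] csubspace_add[OF subspace_J])
  qed (auto simp: Q_def clinear_0[OF clinear_poly_X] clinear_scale[OF clinear_poly_X]
      csubspace_0[OF subspace_J] csubspace_scale[OF subspace_J])
  have "\<exists>N. Q x N" for x
  proof -
    have "x \<in> lie_subalgebra hull (xp ` I \<union> xm ` I)" by (simp only: generated_by_simple_root_vectors UNIV_I)
    then show ?thesis
    proof (induction rule: lie_subalgebra_hull_induct)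
      case (base x)
      then consider i where "i \<in> I" "x = xp i" | i where "i \<in> I" "x = xm i" by blast
      then show ?case
      proof cases
        case 1
        then have "Q x 1" unfolding Q_def poly_X_def
          by (intro allI poly_comb_in_subspace[OF subspace_J]) (simp add: xp_J)
        then show ?thesis ..
      next
        case 2
        then have "f = (\<Prod>j\<in>I - {i}. p j) * p i" unfolding f_def
          by (subst prod.remove[of I i]) (auto simp: mult.commute)
        then have "Q x 1" unfolding Q_def using poly_X_mult_J p(2) 2 by simp
        then show ?thesis ..
      qed
    next
      case subspace
      show ?case
      proof (rule csubspaceI)
        show "0 \<in> {x. \<exists>N. Q x N}" using csubspace_0[OF subspace_Q] by auto
      next
        fix x y assume "x \<in> {x. \<exists>N. Q x N}" "y \<in> {x. \<exists>N. Q x N}"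
        then obtain N M where "Q x N" "Q y M" by blast
        then have "Q x (M + N)" "Q y (M + N)" using mono[of x N M] mono[of y M N] by (simp_all add: add.commute)
        then have "Q (x + y) (M + N)" using csubspace_add[OF subspace_Q] by blast
        then show "x + y \<in> {x. \<exists>N. Q x N}" by blast
      next
        fix c x assume "x \<in> {x. \<exists>N. Q x N}"
        then show "c *\<^sub>C x \<in> {x. \<exists>N. Q x N}" using csubspace_scale[OF subspace_Q] by blast
      qed
    next
      case (lie x y)
      then obtain N M where NM: "Q x N" "Q y M" by blast
      have "poly_X (lie x y) (f ^ (M + N)) s \<in> J" for s
      proof -
        have "commutator (poly_X x (f ^ N) s) (poly_X y (f ^ M) 0) \<in> J"
          using NM unfolding commutator_def Q_def
          by (intro csubspace_diff[OF subspace_J] left_ideal_mult[OF left_ideal_J]) auto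
        then show ?thesis by (simp add: commutator_poly_X_poly_X power_add)
      qed
      then show ?case unfolding Q_def by blast
    qed
  qed
  then obtain N where N: "\<And>x. Q x (N x)" by metis
  obtain B :: "'g set" where B: "finite B" "cspan B = UNIV" by (rule finite_basis)
  define F where "F = f ^ (\<Sum>b\<in>B. N b)"
  have FJ: "poly_X x F s \<in> J" for x s
  proof -
    have "Q b (\<Sum>b\<in>B. N b)" if "b \<in> B" for b
      using mono[OF N[of b], of "\<Sum>b\<in>B - {b}. N b"] that B(1) by (simp add: sum.remove[of B b] add.commute)
    then have "B \<subseteq> {x. Q x (\<Sum>b\<in>B. N b)}" by blast
    from cspan_minimal[OF this subspace_Q] show ?thesis using B(2) by (auto simp: F_def Q_def)
  qed
  \<comment> \<open>The annihilator of the whole module, not only of its generator.\<close>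
  define K where "K = {k. \<forall>u. k * u \<in> J}"
  have subspace_K: "csubspace K"
    by (rule csubspaceI)
      (auto simp: K_def distrib_right mult_scaleC_left csubspace_0[OF subspace_J]
        csubspace_add[OF subspace_J] csubspace_scale[OF subspace_J])
  \<comment> \<open>Brackets with any \<open>X y m\<close> preserve the family of the x \<otimes>
    t^s F. As it kills the generator, it kills the whole module.\<close>
  have FK: "poly_X x F s \<in> K" for x s
  proof -
    have "\<forall>x s. poly_X x F s * u \<in> J" for u
    proof (rule generated)
      fix u v assume "\<forall>x s. poly_X x F s * u \<in> J" "\<forall>x s. poly_X x F s * v \<in> J"
      then show "\<forall>x s. poly_X x F s * (u + v) \<in> J"
        by (simp add: distrib_left csubspace_add[OF subspace_J])
    next
      fix y m u assume u: "\<forall>x s. poly_X x F s * u \<in> J"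
      show "\<forall>x s. poly_X x F s * (X y m * u) \<in> J"
      proof (intro allI)
        fix x s
        have "poly_X x F s * (X y m * u) = X y m * (poly_X x F s * u) + poly_X (lie x y) F (s + m) * u"
          unfolding commutator_poly_X[symmetric] by (simp add: commutator_def algebra_simps)
        then show "poly_X x F s * (X y m * u) \<in> J"
          using u by (simp add: csubspace_add[OF subspace_J] left_ideal_mult[OF left_ideal_J])
      qed
    qed (use FJ Ds in \<open>auto simp: mult_scaleC_right csubspace_scale[OF subspace_J]\<close>)
    then show ?thesis by (simp add: K_def)
  qed
  let ?n = "degree F"
  have F0: "coeff F 0 \<noteq> 0" using f0 by (simp add: F_def coeff_0_power)
  then have "F \<noteq> 0" by auto
  then have Fn: "coeff F ?n \<noteq> 0" by simp
  have "\<exists>Z. finite Z \<and> Z \<subseteq> nil_set m \<and> cspan Z = UNIV" for m using finite_nil_spanning by metis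
  then obtain Z where Z: "\<And>m. finite (Z m)" "\<And>m. Z m \<subseteq> nil_set m" "\<And>m. cspan (Z m) = UNIV" by metis
  \<comment> \<open>Locally nilpotent spanning sets in the degrees 0 to deg F - 1, to which all
    degrees reduce modulo K.\<close>
  define W where "W = (\<Union>k<?n. (\<lambda>z. X z (int k)) ` Z (int k))"
  let ?T = "cspan (W \<union> K)"
  have T_small: "X x (int k) \<in> ?T" if "k < ?n" for x k
  proof -
    have "X x (int k) \<in> cspan ((\<lambda>z. X z (int k)) ` Z (int k))" using X_span Z(3) by blast
    moreover have "(\<lambda>z. X z (int k)) ` Z (int k) \<subseteq> W \<union> K" using that by (auto simp: W_def)
    ultimately show ?thesis using cspan_mono by blast
  qed
  have T_K: "poly_X x F s \<in> ?T" for x s by (intro cspan_base UnI2 FK)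
  have T_nonneg: "X x (int m) \<in> ?T" for x m
  proof (induction m rule: less_induct)
    case (less m)
    show ?case
    proof (cases "m < ?n")
      case False
      have "poly_X x F (int (m - ?n)) = (\<Sum>c<?n. coeff F c *\<^sub>C X x (int (m - ?n) + int c)) + coeff F ?n *\<^sub>C X x (int m)"
        using False by (simp add: poly_X_def poly_comb_def lessThan_Suc_atMost[symmetric] of_nat_diff)
      moreover have "(\<Sum>c<?n. coeff F c *\<^sub>C X x (int (m - ?n) + int c)) \<in> ?T"
        using False less.IH by (intro cspan_sum cspan_scale) (simp flip: of_nat_add del: of_nat_diff)
      then have "poly_X x F (int (m - ?n)) - (\<Sum>c<?n. coeff F c *\<^sub>C X x (int (m - ?n) + int c)) \<in> ?T"
        by (rule cspan_diff[OF T_K])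
      ultimately have "coeff F ?n *\<^sub>C X x (int m) \<in> ?T" by (simp only: add_diff_cancel_left')
      then have "(1 / coeff F ?n) *\<^sub>C coeff F ?n *\<^sub>C X x (int m) \<in> ?T" by (rule cspan_scale)
      then show ?thesis using Fn by (simp add: scaleC_scaleC scaleC_one)
    qed (rule T_small)
  qed
  have T_neg: "X x (- int m) \<in> ?T" for x m
  proof (induction m rule: less_induct)
    case (less m)
    show ?case
    proof (cases "m = 0")
      case True
      then show ?thesis using T_nonneg[of x 0] by simp
    next
      case False
      have "poly_X x F (- int m) = coeff F 0 *\<^sub>C X x (- int m) + (\<Sum>c<?n. coeff F (Suc c) *\<^sub>C X x (- int m + int (Suc c)))"
        unfolding poly_X_def poly_comb_def lessThan_Suc_atMost[symmetric] by (subst sum.lessThan_Suc_shift) simp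
      moreover have "X x (- int m + int (Suc c)) \<in> ?T" for c
      proof (cases "Suc c \<le> m")
        case True
        then have "- int m + int (Suc c) = - int (m - Suc c)" by (simp add: of_nat_diff)
        moreover have "m - Suc c < m" using False by simp
        ultimately show ?thesis using less.IH by (simp only:)
      next
        case False
        then have "- int m + int (Suc c) = int (Suc c - m)" by (simp add: of_nat_diff)
        then show ?thesis using T_nonneg by (simp only:)
      qed
      then have "(\<Sum>c<?n. coeff F (Suc c) *\<^sub>C X x (- int m + int (Suc c))) \<in> ?T"
        by (intro cspan_sum cspan_scale)
      then have "poly_X x F (- int m) - (\<Sum>c<?n. coeff F (Suc c) *\<^sub>C X x (- int m + int (Suc c))) \<in> ?T"
        by (rule cspan_diff[OF T_K])
      ultimately have "coeff F 0 *\<^sub>C X x (- int m) \<in> ?T" by (simp only: add_diff_cancel_right')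
      then have "(1 / coeff F 0) *\<^sub>C coeff F 0 *\<^sub>C X x (- int m) \<in> ?T" by (rule cspan_scale)
      then show ?thesis using F0 by (simp add: scaleC_scaleC scaleC_one)
    qed
  qed
  have T: "X x m \<in> ?T" for x m
    using T_nonneg[of x "nat m"] T_neg[of x "nat (- m)"] by (cases "m \<ge> 0") auto
  define L where "L = {X x m | x m. True}"
  have "\<exists>B. finite B \<and> (\<forall>l. set l \<subseteq> L \<longrightarrow> prod_list l \<in> cspan (B \<union> J))"
  proof (rule products_finite[OF left_ideal_J, of W])
    show "finite W" using Z(1) by (auto simp: W_def)
    show "W \<subseteq> L" by (auto simp: W_def L_def)
    show "nilpotent_at J w u" if "w \<in> W" for w u using that Z(2) by (auto simp: W_def nil_set_def)
    show "\<exists>w\<in>cspan W. \<exists>k. (\<forall>u. k * u \<in> J) \<and> x = w + k" if "x \<in> L" for x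
    proof -
      have "x \<in> ?T" using that T by (auto simp: L_def)
      then obtain w k where "w \<in> cspan W" "k \<in> cspan K" "x = w + k"
        by (auto simp: cspan_Un)
      moreover from this have "k \<in> K" using cspan_eq_iff[of K, THEN iffD2, OF subspace_K] by simp
      ultimately show ?thesis by (auto simp: K_def)
    qed
    show "commutator x y \<in> L" if "x \<in> L" "y \<in> L" for x y
      using that unfolding L_def by (clarsimp simp: X_lie) blast
  qed
  then obtain C where C: "finite C" "\<And>l. set l \<subseteq> L \<Longrightarrow> prod_list l \<in> cspan (C \<union> J)" by blast
  have "u \<in> cspan {prod_list l | l. set l \<subseteq> L}" for u
  proof (rule generated)
    show "1 \<in> cspan {prod_list l | l. set l \<subseteq> L}"
      by (intro cspan_base CollectI exI[of _ "[]"]) simp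
  next
    fix x m u assume "u \<in> cspan {prod_list l | l. set l \<subseteq> L}"
    then show "X x m * u \<in> cspan {prod_list l | l. set l \<subseteq> L}"
    proof (rule clinear_span_induct[OF clinear_mult csubspace_span])
      fix a assume "a \<in> {prod_list l | l. set l \<subseteq> L}"
      then obtain l where "a = prod_list l" "set l \<subseteq> L" by blast
      then show "X x m * a \<in> cspan {prod_list l | l. set l \<subseteq> L}"
        by (intro cspan_base CollectI exI[of _ "X x m # l"]) (auto simp: L_def)
    qed
  qed (auto intro: cspan_add cspan_scale simp: Ds)
  moreover have "cspan {prod_list l | l. set l \<subseteq> L} \<subseteq> cspan (C \<union> J)"
    using C(2) by (intro cspan_minimal[OF _ csubspace_span]) auto
  ultimately show ?thesis using C(1) by blast
qed

end

section \<open>Enveloping algebras of loop algebras\<close>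

lemma uea_of_add: "uea_of (x + y) = uea_of x + uea_of y"
proof transfer
  fix x y :: 'a
  have "free_gen (x + y) - free_gen x - free_gen y \<in> uea_ideal"
    unfolding uea_ideal_def by (rule hull_inc) (auto simp: uea_relations_def)
  then show "free_gen (x + y) - (free_gen x + free_gen y) \<in> uea_ideal" by (simp add: diff_diff_eq)
qed

lemma uea_of_scaleC: "uea_of (c *\<^sub>C x) = c *\<^sub>C uea_of x"
proof transfer
  fix c and x :: 'a
  show "free_gen (c *\<^sub>C x) - c *\<^sub>C free_gen x \<in> uea_ideal"
    unfolding uea_ideal_def by (rule hull_inc) (auto simp: uea_relations_def)
qed

lemma uea_of_lie: "commutator (uea_of x) (uea_of y) = uea_of (lie x y)"
  unfolding commutator_def
proof transfer
  fix x y :: 'a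
  show "free_gen x * free_gen y - free_gen y * free_gen x - free_gen (lie x y) \<in> uea_ideal"
    unfolding uea_ideal_def by (rule hull_inc) (auto simp: uea_relations_def)
qed

lemma uea_induct [case_names one add scale mult]:
  assumes one: "P 1" and add: "\<And>u v. P u \<Longrightarrow> P v \<Longrightarrow> P (u + v)" and scale: "\<And>c u. P u \<Longrightarrow> P (c *\<^sub>C u)"
    and mult: "\<And>x u. P u \<Longrightarrow> P (uea_of x * u)"
  shows "P (u :: 'l::complex_lie_algebra uea)"
proof (induct u rule: uea.abs_induct)
  fix p :: "'l free_algebra"
  show "P (abs_uea p)"
  proof (induction p rule: poly_mapping_additive_induct)
    case (single w c)
    have word: "P (abs_uea (Poly_Mapping.single (Word ls) c))" for ls
    proof (induction ls)
      case Nil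
      have "c *\<^sub>C (1 :: 'l uea) = abs_uea (c *\<^sub>C 1)"
        unfolding one_uea_def by (rule scaleC_uea.abs_eq)
      also have "c *\<^sub>C (1 :: 'l free_algebra) = Poly_Mapping.single (Word []) c"
        by (simp add: scaleC_free_algebra zero_word_def)
      finally show ?case using scale[OF one, of c] by simp
    next
      case (Cons a ls)
      have "uea_of a * abs_uea (Poly_Mapping.single (Word ls) c) = abs_uea (free_gen a * Poly_Mapping.single (Word ls) c)"
        by (simp add: uea_of_def times_uea.abs_eq)
      also have "free_gen a * Poly_Mapping.single (Word ls) c = Poly_Mapping.single (Word (a # ls)) c"
        by (simp add: free_gen_def mult_single plus_word_def)
      finally show ?case using mult[OF Cons, of a] by simp
    qed
    then show ?case by (cases w) simp
  next
    case (add p q)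
    then show ?case using assms(2)[of "abs_uea p" "abs_uea q"] by (simp add: plus_uea.abs_eq)
  qed
qed

context cartan_setting
begin

lemma loop_rep_loop: "loop_rep D (loop_gen :: 'g \<Rightarrow> int \<Rightarrow> 'g loop uea) {}"
proof unfold_locales
  fix x y :: 'g and m n :: int and c
  show "loop_gen (x + y) m = (loop_gen x m + loop_gen y m :: 'g loop uea)"
    by (simp add: loop_gen_def loop_elt_def single_add uea_of_add)
  show "loop_gen (c *\<^sub>C x) m = (c *\<^sub>C loop_gen x m :: 'g loop uea)"
    by (simp add: loop_gen_def loop_elt_def uea_of_scaleC flip: scaleC_single)
  show "commutator (loop_gen x m) (loop_gen y n) = (loop_gen (lie x y) (m + n) :: 'g loop uea)"
    by (simp add: loop_gen_def loop_elt_def uea_of_lie lie_single_single)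
next
  fix P :: "'g loop uea \<Rightarrow> bool" and u
  assume P: "P 1" "\<And>u v. P u \<Longrightarrow> P v \<Longrightarrow> P (u + v)" "\<And>c u. P u \<Longrightarrow> P (c *\<^sub>C u)"
    "\<And>x m u. P u \<Longrightarrow> P (loop_gen x m * u)"
  show "P u"
  proof (induction u rule: uea_induct)
    case (mult x u)
    show ?case
    proof (induction x rule: poly_mapping_additive_induct)
      case (single k x)
      then show ?case using P(4)[OF mult, of x k] by (simp add: loop_gen_def loop_elt_def)
    qed (simp add: uea_of_add distrib_right P)
  qed (use P in auto)
qed auto

lemma ext_elt_add: "ext_elt (x + y) m = ext_elt x m + ext_elt y m"
  by transfer (simp add: loop_elt_def single_add)

lemma ext_elt_scaleC: "ext_elt (c *\<^sub>C x) m = c *\<^sub>C ext_elt x m"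
  by transfer (simp add: loop_elt_def scaleC_single)

lemma lie_ext_elt: "lie (ext_elt x m) (ext_elt y n) = ext_elt (lie x y) (m + n)"
  by transfer (simp add: loop_elt_def lie_single_single)

lemma lie_deg_d: "lie deg_d (ext_elt x m) = of_int m *\<^sub>C ext_elt x m"
  by transfer (simp add: loop_elt_def loop_deriv_single scaleC_single scaleC_one)

lemma ext_loop_induct [case_names elt deg_d add]:
  assumes "\<And>x m. P (ext_elt x m)" "\<And>c. P (c *\<^sub>C deg_d)" "\<And>x y. P x \<Longrightarrow> P y \<Longrightarrow> P (x + y)"
  shows "P (y :: 'g ext_loop)"
proof -
  obtain f c where y: "y = Abs_ext_loop (f, c)" by (cases y) auto
  have "P (Abs_ext_loop (f, 0))"
  proof (induction f rule: poly_mapping_additive_induct)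
    case (single k x)
    then show ?case using assms(1)[of x k] by (simp add: ext_elt_def loop_elt_def)
  next
    case (add f g)
    then show ?case using assms(3) by (fastforce simp: plus_ext_loop.abs_eq)
  qed
  moreover have "y = Abs_ext_loop (f, 0) + c *\<^sub>C deg_d"
    by (simp add: y deg_d_def plus_ext_loop.abs_eq scaleC_ext_loop.abs_eq)
  ultimately show ?thesis using assms(2,3) by simp
qed

lemma loop_rep_ext: "loop_rep D (ext_gen :: 'g \<Rightarrow> int \<Rightarrow> 'g ext_loop uea) {uea_of deg_d}"
proof unfold_locales
  fix x y :: 'g and m n :: int and c
  show "ext_gen (x + y) m = (ext_gen x m + ext_gen y m :: 'g ext_loop uea)"
    by (simp add: ext_gen_def ext_elt_add uea_of_add)
  show "ext_gen (c *\<^sub>C x) m = (c *\<^sub>C ext_gen x m :: 'g ext_loop uea)"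
    by (simp add: ext_gen_def uea_of_scaleC ext_elt_scaleC)
  show "commutator (ext_gen x m) (ext_gen y n) = (ext_gen (lie x y) (m + n) :: 'g ext_loop uea)"
    by (simp add: ext_gen_def uea_of_lie lie_ext_elt)
next
  fix d :: "'g ext_loop uea" and x m
  assume "d \<in> {uea_of deg_d}"
  then show "commutator d (ext_gen x m) = of_int m *\<^sub>C ext_gen x m"
    by (simp add: ext_gen_def uea_of_lie lie_deg_d uea_of_scaleC)
next
  fix P :: "'g ext_loop uea \<Rightarrow> bool" and u
  assume P: "P 1" "\<And>u v. P u \<Longrightarrow> P v \<Longrightarrow> P (u + v)" "\<And>c u. P u \<Longrightarrow> P (c *\<^sub>C u)"
    "\<And>x m u. P u \<Longrightarrow> P (ext_gen x m * u)" "\<And>d u. d \<in> {uea_of deg_d} \<Longrightarrow> P u \<Longrightarrow> P (d * u)"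
  show "P u"
  proof (induction u rule: uea_induct)
    case (mult x u)
    show ?case
    proof (induction x rule: ext_loop_induct)
      case (elt x m)
      then show ?case using P(4)[OF mult] by (simp add: ext_gen_def)
    next
      case (deg_d c)
      then show ?case using P(3)[OF P(5)[OF _ mult]] by (simp add: uea_of_scaleC mult_scaleC_left)
    qed (simp add: uea_of_add distrib_right P)
  qed (use P in auto)
qed

end

section \<open>The defining relations of Weyl modules\<close>

lemma subalgebra_hull: "subalgebra (subalgebra hull S)"
  by (rule hull_in) (auto simp: subalgebra_def intro!: csubspace_Inter)

lemma commute_mult: "a * g = g * a \<Longrightarrow> b * g = g * b \<Longrightarrow> a * b * g = g * (a * b)"
  for a b g :: "'a::semigroup_mult"
  by (metis mult.assoc)

lemma left_ideal_hull: "left_ideal (left_ideal hull S)"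
  by (rule hull_in) (auto simp: left_submodule_def)

lemma fps_nth_power_in_subalgebra:
  assumes A: "subalgebra A" and b: "\<And>n. fps_nth b n \<in> A"
  shows "fps_nth (b ^ k) n \<in> A"
proof (induction k arbitrary: n)
  case 0
  have "(0 :: 'a) \<in> A" "1 \<in> A" using A csubspace_0 by (auto simp: subalgebra_def)
  then show ?case by simp
next
  case (Suc k)
  have "(\<Sum>i=0..n. fps_nth b i * fps_nth (b ^ k) (n - i)) \<in> A"
    using A b Suc by (intro csubspace_sum) (auto simp: subalgebra_def)
  then show ?case by (simp add: fps_mult_nth)
qed

text \<open>Stated for any subalgebra because it is used twice: for U(0), and for the commutant of
  \<open>X h k\<close>.\<close>

lemma Lam_series_in_subalgebra:
  assumes A: "subalgebra A" and X: "\<And>k. k \<noteq> 0 \<Longrightarrow> X (simple_coroot D i) k \<in> A" and s: "s \<noteq> 0"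
  shows "fps_nth (Lam_series D X i s) n \<in> A"
proof -
  have sub: "csubspace A" and one: "1 \<in> A" and mult: "\<And>x y. x \<in> A \<Longrightarrow> y \<in> A \<Longrightarrow> x * y \<in> A"
    using A by (auto simp: subalgebra_def)
  let ?b = "Abs_fps (\<lambda>k. if k = 0 then 0 else - ((1 / of_nat k) *\<^sub>C X (simple_coroot D i) (s * int k)))"
  have "fps_nth ?b n \<in> A" for n
    using X[of "s * int n"] s csubspace_0[OF sub]
    by (auto intro!: csubspace_neg[OF sub] csubspace_scale[OF sub])
  then have "fps_nth (?b ^ k) n \<in> A" for k n by (intro fps_nth_power_in_subalgebra[OF A])
  then show ?thesis
    unfolding Lam_series_def fps_compose_nth
    by (intro csubspace_sum[OF sub] mult)
      (auto simp: of_complex_def intro: csubspace_scale[OF sub one])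
qed

context loop_rep
begin

lemma subalgebra_U0: "subalgebra (U0 D X)"
  unfolding U0_def by (rule subalgebra_hull)

lemma
  shows U0_mult: "f \<in> U0 D X \<Longrightarrow> g \<in> U0 D X \<Longrightarrow> f * g \<in> U0 D X"
    and U0_one: "1 \<in> U0 D X" and subspace_U0: "csubspace (U0 D X)"
  using subalgebra_U0 by (auto simp: subalgebra_def)

lemma Lam_series_U0:
  assumes "i \<in> I" "s \<noteq> 0" shows "fps_nth (Lam_series D X i s) n \<in> U0 D X"
proof (rule Lam_series_in_subalgebra[OF subalgebra_U0 _ assms(2)])
  fix k :: int assume "k \<noteq> 0"
  then show "X (simple_coroot D i) k \<in> U0 D X"
    unfolding U0_def simple_coroot_def using simple_roots_positive[OF assms(1)] by (intro hull_inc) blast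
qed

lemma Lam_commute_cartan:
  assumes "i \<in> I" "h \<in> H" shows "Lam D X i m * X h k = X h k * Lam D X i m"
proof -
  let ?A = "{x. x * X h k = X h k * x}"
  have "subalgebra ?A"
    unfolding subalgebra_def
  proof (intro conjI)
    show "csubspace ?A"
      by (rule csubspaceI) (auto simp: algebra_simps mult_scaleC_left mult_scaleC_right)
    show "\<forall>x\<in>?A. \<forall>y\<in>?A. x * y \<in> ?A"
      by (auto simp: mult.assoc) (metis mult.assoc)
  qed simp
  moreover have "X (simple_coroot D i) n \<in> ?A" for n
    using X_mult[of "simple_coroot D i" n h k] abelian_H[of "simple_coroot D i" h] assms
      tripleD(4)[OF triple_simple] by (simp add: simple_coroot_def)
  ultimately have "fps_nth (Lam_series D X i s) n \<in> ?A" if "s \<noteq> 0" for s n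
    using Lam_series_in_subalgebra that by blast
  then show ?thesis by (simp add: Lam_def)
qed

text \<open>This makes W(\<lambda>) a right U(0)-module. A right factor
  \<open>X (coroot D \<alpha>) k\<close> commutes with the Cartan and \<Lambda> relations, passes an
  \<open>xp\<close> relation at the cost of another one, and is absorbed into f in the last two
  families.\<close>

lemma weyl_ideal_right_mult:
  assumes x: "x \<in> left_ideal hull weyl_relations D X lam" and f: "f \<in> U0 D X"
  shows "x * f \<in> left_ideal hull weyl_relations D X lam"
proof -
  let ?I = "left_ideal hull weyl_relations D X lam"
  note sub = left_ideal_subspace[OF left_ideal_hull]
  have gen: "x * X (coroot D \<alpha>) k \<in> ?I" if \<alpha>: "\<alpha> \<in> Rpos" "k \<noteq> 0" and x: "x \<in> ?I" for x \<alpha> k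
  proof -
    let ?g = "X (coroot D \<alpha>) k"
    have cH: "coroot D \<alpha> \<in> H" using tripleD(4)[OF triple_positive[OF \<alpha>(1)]] .
    have gU: "?g \<in> U0 D X" unfolding U0_def using \<alpha> by (intro hull_inc) blast
    have fg: "f * ?g \<in> U0 D X" if "f \<in> U0 D X" for f using U0_mult[OF that gU] .
    have rel: "r * ?g \<in> ?I" if r: "r \<in> weyl_relations D X lam" for r
    proof -
      have left: "?g * r \<in> ?I" by (intro left_ideal_mult[OF left_ideal_hull] hull_inc r)
      from r[unfolded weyl_relations_def] show ?thesis
      proof (elim UnE)
        assume "r \<in> {X (xp i) m | i m. i \<in> I}"
        then obtain i m where i: "i \<in> I" "r = X (xp i) m" by blast
        have "lie (xp i) (coroot D \<alpha>) = - sr i (coroot D \<alpha>) *\<^sub>C xp i"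
          using lie_anticomm[of "xp i" "coroot D \<alpha>"] tripleD(2)[OF triple_simple[OF i(1)]] cH
          by (simp add: root_space_def)
        then have "r * ?g = ?g * r + (- sr i (coroot D \<alpha>)) *\<^sub>C X (xp i) (m + k)"
          unfolding i(2) by (subst X_mult) (simp add: X_scale[symmetric])
        moreover have "X (xp i) (m + k) \<in> ?I"
          by (rule hull_inc) (use i in \<open>auto simp: weyl_relations_def\<close>)
        ultimately show ?thesis
          using left csubspace_add[OF sub] csubspace_scale[OF sub] by metis
      next
        assume "r \<in> {X h 0 - of_complex (lam (ext_elt h 0)) | h. h \<in> H}"
        then obtain h where h: "h \<in> H" "r = X h 0 - of_complex (lam (ext_elt h 0))" by blast
        have "r * ?g = ?g * r"
          unfolding h(2) using X_mult[of h 0 "coroot D \<alpha>" k] abelian_H[OF h(1) cH]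
          by (simp add: of_complex_def algebra_simps mult_scaleC_left mult_scaleC_right)
        then show ?thesis using left by simp
      next
        assume "r \<in> {Lam D X i m | i m. i \<in> I \<and> int (weight_label D lam i) < \<bar>m\<bar>}"
        then have "r * ?g = ?g * r" using Lam_commute_cartan cH by blast
        then show ?thesis using left by simp
      next
        assume "r \<in> {Lam D X i (int (weight_label D lam i)) * Lam D X i (- m) - Lam D X i (int (weight_label D lam i) - m) | i m.
          i \<in> I \<and> 1 \<le> m \<and> m \<le> int (weight_label D lam i)}"
        then obtain i m where i: "i \<in> I"
          "r = Lam D X i (int (weight_label D lam i)) * Lam D X i (- m) - Lam D X i (int (weight_label D lam i) - m)" by blast
        then have "r * ?g = ?g * r"
          by (simp only: left_diff_distrib right_diff_distrib Lam_commute_cartan[OF i(1) cH] commute_mult)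
        then show ?thesis using left by simp
      next
        assume "r \<in> {(\<Sum>k = 0..weight_label D lam i. X (xm i) (m - 1 - int k) * Lam D X i (int k)) * f | i m f.
          i \<in> I \<and> f \<in> U0 D X}"
        then obtain i m f where "i \<in> I" "f \<in> U0 D X"
          "r = (\<Sum>k = 0..weight_label D lam i. X (xm i) (m - 1 - int k) * Lam D X i (int k)) * f" by blast
        then have "r * ?g \<in> weyl_relations D X lam"
          using fg unfolding weyl_relations_def by (simp only: mult.assoc) blast
        then show ?thesis by (rule hull_inc)
      next
        assume "r \<in> {fps_nth (Xminus_series D X i ^ r * Lam_series D X i 1) m * f | i r m f.
          i \<in> I \<and> r \<ge> 1 \<and> m > weight_label D lam i \<and> f \<in> U0 D X}"
        then obtain i q m f where "i \<in> I" "q \<ge> 1" "m > weight_label D lam i" "f \<in> U0 D X"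
          "r = fps_nth (Xminus_series D X i ^ q * Lam_series D X i 1) m * f" by blast
        then have "r * ?g \<in> weyl_relations D X lam"
          using fg unfolding weyl_relations_def by (simp only: mult.assoc) blast
        then show ?thesis by (rule hull_inc)
      qed
    qed
    have "left_ideal {x. x * ?g \<in> ?I}"
      using left_ideal_hull[of "weyl_relations D X lam"] by (auto simp: left_submodule_def distrib_right mult.assoc)
    moreover have "weyl_relations D X lam \<subseteq> {x. x * ?g \<in> ?I}" using rel by blast
    ultimately have "?I \<subseteq> {x. x * ?g \<in> ?I}" by (intro hull_minimal)
    then show ?thesis using x by blast
  qed
  let ?A = "{f. \<forall>x\<in>?I. x * f \<in> ?I}"
  have "subalgebra ?A"
    unfolding subalgebra_def
  proof (intro conjI)
    show "csubspace ?A"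
      by (rule csubspaceI)
        (auto simp: distrib_left mult_scaleC_right csubspace_0[OF sub]
          csubspace_add[OF sub] csubspace_scale[OF sub])
    show "\<forall>x\<in>?A. \<forall>y\<in>?A. x * y \<in> ?A" by (simp flip: mult.assoc)
  qed simp
  then have "U0 D X \<subseteq> ?A" unfolding U0_def by (rule hull_minimal[rotated]) (use gen in blast)
  with x f show ?thesis by blast
qed

lemma xp_weyl_relations: "i \<in> I \<Longrightarrow> X (xp i) m \<in> weyl_relations D X lam"
  unfolding weyl_relations_def by blast

text \<open>The lowest coefficient of the \<open>r\<close>-th power of \<open>X\<^sup>-(u)\<close> is \<open>x\<^sup>-\<^sub>i\<^sup>r\<close>.\<close>

lemma xm_power_weyl_relations:
  assumes "i \<in> I"
  shows "X (xm i) 0 ^ Suc (weight_label D lam i) \<in> weyl_relations D X lam"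
proof -
  let ?r = "Suc (weight_label D lam i)" and ?s = "Xminus_series D X i"
  have s: "fps_nth ?s 0 = 0" "fps_nth ?s 1 = X (xm i) 0" by (simp_all add: Xminus_series_def)
  have low: "(\<forall>n<r. fps_nth (?s ^ r) n = 0) \<and> fps_nth (?s ^ r) r = X (xm i) 0 ^ r" for r
  proof (induction r)
    case (Suc r)
    have "fps_nth (?s ^ Suc r) n = 0" if "n < Suc r" for n
      unfolding power_Suc fps_mult_nth
    proof (rule sum.neutral, rule ballI)
      fix k assume "k \<in> {0..n}"
      then show "fps_nth ?s k * fps_nth (?s ^ r) (n - k) = 0" using Suc s(1) that by (cases "k = 0") auto
    qed
    moreover have "fps_nth (?s ^ Suc r) (Suc r) = (\<Sum>k\<in>{1::nat}. fps_nth ?s k * fps_nth (?s ^ r) (Suc r - k))"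
      unfolding power_Suc fps_mult_nth
    proof (rule sum.mono_neutral_right)
      show "\<forall>k\<in>{0..Suc r} - {1}. fps_nth ?s k * fps_nth (?s ^ r) (Suc r - k) = 0"
      proof
        fix k assume "k \<in> {0..Suc r} - {1}"
        then show "fps_nth ?s k * fps_nth (?s ^ r) (Suc r - k) = 0" using Suc s(1) by (cases "k = 0") auto
      qed
    qed auto
    ultimately show ?case using Suc s by simp
  qed simp
  \<comment> \<open>Only the lowest coefficient of the power contributes in degree r, and it meets
    the constant coefficient 1 of \<open>Lam_series\<close>.\<close>
  have "fps_nth (?s ^ ?r * Lam_series D X i 1) ?r = (\<Sum>k\<in>{?r}. fps_nth (?s ^ ?r) k * fps_nth (Lam_series D X i 1) (?r - k))"
    unfolding fps_mult_nth
  proof (rule sum.mono_neutral_right)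
    show "\<forall>k\<in>{0..?r} - {?r}. fps_nth (?s ^ ?r) k * fps_nth (Lam_series D X i 1) (?r - k) = 0"
    proof
      fix k assume "k \<in> {0..?r} - {?r}"
      then have "k < ?r" by auto
      then have "fps_nth (?s ^ ?r) k = 0" using low[of ?r] by blast
      then show "fps_nth (?s ^ ?r) k * fps_nth (Lam_series D X i 1) (?r - k) = 0" by simp
    qed
  qed auto
  also have "\<dots> = X (xm i) 0 ^ ?r"
    using low[of ?r] by (simp add: Lam_series_def fps_compose_nth of_complex_def scaleC_one del: power_Suc)
  finally have "X (xm i) 0 ^ ?r = fps_nth (?s ^ ?r * Lam_series D X i 1) ?r * 1" by simp
  then show ?thesis
    unfolding weyl_relations_def using assms U0_one
    by (intro UnI2 CollectI exI[of _ i] exI[of _ ?r] exI[of _ 1] conjI) simp_all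
qed

end

section \<open>Quotient modules\<close>

lemma additive_subgroup_hull: "additive_subgroup (additive_subgroup hull S)"
  by (rule hull_in) (auto simp: additive_subgroup_def)

lemma
  assumes "additive_subgroup J"
  shows additive_subgroup_0: "0 \<in> J"
    and additive_subgroup_diff: "x \<in> J \<Longrightarrow> y \<in> J \<Longrightarrow> x - y \<in> J"
    and additive_subgroup_minus: "x \<in> J \<Longrightarrow> - x \<in> J"
    and additive_subgroup_add: "x \<in> J \<Longrightarrow> y \<in> J \<Longrightarrow> x + y \<in> J"
proof -
  show 0: "0 \<in> J" and diff: "x \<in> J \<Longrightarrow> y \<in> J \<Longrightarrow> x - y \<in> J" for x y
    using assms by (auto simp: additive_subgroup_def)
  show minus: "x \<in> J \<Longrightarrow> - x \<in> J" for x using diff[OF 0] by fastforce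
  show "x \<in> J \<Longrightarrow> y \<in> J \<Longrightarrow> x + y \<in> J" using diff[of x "- y"] minus by fastforce
qed

lemma subspace_additive_subgroup: "csubspace J \<Longrightarrow> additive_subgroup J"
  by (simp add: additive_subgroup_def csubspace_0 csubspace_diff)

context
  fixes J :: "'a::ab_group_add set"
  assumes J: "additive_subgroup J"
begin

lemma coset_eq_iff: "(+) a ` J = (+) b ` J \<longleftrightarrow> a - b \<in> J"
proof
  assume "(+) a ` J = (+) b ` J"
  moreover have "a \<in> (+) a ` J" using additive_subgroup_0[OF J] by (auto intro!: image_eqI[of _ _ 0])
  ultimately obtain j where "j \<in> J" "a = b + j" by auto
  then show "a - b \<in> J" by simp
next
  assume ab: "a - b \<in> J"
  have "a + j = b + ((a - b) + j)" "b + j = a + (j - (a - b))" for j by simp_all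
  then show "(+) a ` J = (+) b ` J"
    using additive_subgroup_add[OF J ab] additive_subgroup_diff[OF J _ ab] by (blast intro: image_eqI)
qed

lemma coset_add: "{x + y | x y. x \<in> (+) a ` J \<and> y \<in> (+) b ` J} = (+) (a + b) ` J"
proof safe
  fix i j assume "i \<in> J" "j \<in> J"
  then show "(a + i) + (b + j) \<in> (+) (a + b) ` J"
    by (intro image_eqI[of _ _ "i + j"]) (simp_all add: algebra_simps additive_subgroup_add[OF J])
next
  fix j assume j: "j \<in> J"
  have "a + b + j = (a + 0) + (b + j)" by simp
  then show "\<exists>x y. a + b + j = x + y \<and> x \<in> (+) a ` J \<and> y \<in> (+) b ` J"
    using j additive_subgroup_0[OF J] by blast
qed

lemma coset_act:
  assumes f: "\<And>x y. f (x + y) = f x + f y" "\<And>j. j \<in> J \<Longrightarrow> f j \<in> J"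
  shows "{f x + j | x j. x \<in> (+) a ` J \<and> j \<in> J} = (+) (f a) ` J"
proof safe
  fix i j assume "i \<in> J" "j \<in> J"
  then show "f (a + i) + j \<in> (+) (f a) ` J"
    by (intro image_eqI[of _ _ "f i + j"]) (simp_all add: algebra_simps f additive_subgroup_add[OF J])
next
  fix j assume j: "j \<in> J"
  have "f (a + 0) = f a" by simp
  then show "\<exists>x j'. f a + j = f x + j' \<and> x \<in> (+) a ` J \<and> j' \<in> J"
    using j additive_subgroup_0[OF J] by (metis image_eqI)
qed

lemma quotient_module_sel:
  "carrier (quotient_module act A J) = (\<lambda>a. (+) a ` J) ` A"
  "\<zero>\<^bsub>quotient_module act A J\<^esub> = (+) 0 ` J"
  "(+) a ` J \<oplus>\<^bsub>quotient_module act A J\<^esub> (+) b ` J = (+) (a + b) ` J"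
  by (simp_all add: quotient_module_def coset_add)

lemma quotient_module_smult:
  assumes "\<And>x y. act r (x + y) = act r x + act r y" "\<And>j. j \<in> J \<Longrightarrow> act r j \<in> J"
  shows "r \<odot>\<^bsub>quotient_module act A J\<^esub> (+) a ` J = (+) (act r a) ` J"
  unfolding quotient_module_def by (simp add: coset_act[of "act r", OF assms])

lemma abelian_group_quotient:
  assumes A: "additive_subgroup A"
  shows "abelian_group (quotient_module act A J)"
proof (rule abelian_groupI)
  let ?Q = "quotient_module act A J"
  fix x y z assume "x \<in> carrier ?Q"
  then obtain a where a: "a \<in> A" "x = (+) a ` J" by (auto simp: quotient_module_sel)
  show "\<zero>\<^bsub>?Q\<^esub> \<oplus>\<^bsub>?Q\<^esub> x = x" by (simp only: a quotient_module_sel add_0_left)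
  show "\<exists>y\<in>carrier ?Q. y \<oplus>\<^bsub>?Q\<^esub> x = \<zero>\<^bsub>?Q\<^esub>"
  proof (rule bexI)
    show "(+) (- a) ` J \<oplus>\<^bsub>?Q\<^esub> x = \<zero>\<^bsub>?Q\<^esub>" by (simp only: a quotient_module_sel left_minus)
    show "(+) (- a) ` J \<in> carrier ?Q"
      unfolding quotient_module_sel by (rule imageI[OF additive_subgroup_minus[OF A a(1)]])
  qed
  assume "y \<in> carrier ?Q"
  then obtain b where b: "b \<in> A" "y = (+) b ` J" by (auto simp: quotient_module_sel)
  show "x \<oplus>\<^bsub>?Q\<^esub> y \<in> carrier ?Q"
    unfolding a b quotient_module_sel using additive_subgroup_add[OF A a(1) b(1)] by blast
  show "x \<oplus>\<^bsub>?Q\<^esub> y = y \<oplus>\<^bsub>?Q\<^esub> x" by (simp only: a b quotient_module_sel add.commute)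
  assume "z \<in> carrier ?Q"
  then obtain c where c: "z = (+) c ` J" by (auto simp: quotient_module_sel)
  show "x \<oplus>\<^bsub>?Q\<^esub> y \<oplus>\<^bsub>?Q\<^esub> z = x \<oplus>\<^bsub>?Q\<^esub> (y \<oplus>\<^bsub>?Q\<^esub> z)"
    by (simp only: a b c quotient_module_sel add.assoc)
next
  show "\<zero>\<^bsub>quotient_module act A J\<^esub> \<in> carrier (quotient_module act A J)"
    using additive_subgroup_0[OF A] by (simp only: quotient_module_sel) blast
qed

lemma finsum_quotient:
  assumes A: "additive_subgroup A" and "finite F" "\<And>i. i \<in> F \<Longrightarrow> a i \<in> A"
  shows "finsum (quotient_module act A J) (\<lambda>i. (+) (a i) ` J) F = (+) (\<Sum>i\<in>F. a i) ` J"
  using assms(2,3)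
proof (induction F rule: finite_induct)
  case empty
  interpret abelian_group "quotient_module act A J" by (rule abelian_group_quotient[OF A])
  show ?case by (simp add: quotient_module_sel)
next
  case (insert i F)
  interpret abelian_group "quotient_module act A J" by (rule abelian_group_quotient[OF A])
  have "finsum (quotient_module act A J) (\<lambda>i. (+) (a i) ` J) (insert i F)
      = (+) (a i) ` J \<oplus>\<^bsub>quotient_module act A J\<^esub> finsum (quotient_module act A J) (\<lambda>i. (+) (a i) ` J) F"
    using insert by (intro finsum_insert) (auto simp: quotient_module_sel)
  also have "\<dots> = (+) (\<Sum>i\<in>insert i F. a i) ` J"
    using insert by (simp add: quotient_module_sel)
  finally show ?case .
qed

lemma left_module_quotient:
  assumes A: "additive_subgroup A"
    and act: "\<And>r x y. act r (x + y) = act r x + act r y" "\<And>r j. j \<in> J \<Longrightarrow> act r j \<in> J"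
      "\<And>r a. a \<in> A \<Longrightarrow> act r a \<in> A"
    and "\<And>r s a. a \<in> A \<Longrightarrow> act (r + s) a - (act r a + act s a) \<in> J"
      "\<And>r s a. a \<in> A \<Longrightarrow> act (r * s) a - act r (act s a) \<in> J"
      "\<And>a. a \<in> A \<Longrightarrow> act 1 a - a \<in> J"
  shows "left_module (quotient_module act A J)"
proof -
  let ?Q = "quotient_module act A J"
  have smult: "r \<odot>\<^bsub>?Q\<^esub> (+) a ` J = (+) (act r a) ` J" for r a
    by (rule quotient_module_smult[OF act(1,2)])
  have carrier: "\<exists>a\<in>A. x = (+) a ` J" if "x \<in> carrier ?Q" for x
    using that unfolding quotient_module_sel by blast
  show ?thesis
    unfolding left_module_def
  proof (intro conjI allI ballI abelian_group_quotient[OF A])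
    fix r s x assume "x \<in> carrier ?Q"
    then obtain a where a: "a \<in> A" "x = (+) a ` J" using carrier by blast
    show "r \<odot>\<^bsub>?Q\<^esub> x \<in> carrier ?Q"
      unfolding a(2) smult unfolding quotient_module_sel by (rule imageI[OF act(3)[OF a(1)]])
    show "(r + s) \<odot>\<^bsub>?Q\<^esub> x = r \<odot>\<^bsub>?Q\<^esub> x \<oplus>\<^bsub>?Q\<^esub> s \<odot>\<^bsub>?Q\<^esub> x"
      unfolding a(2) smult quotient_module_sel(3) coset_eq_iff by (rule assms(5)[OF a(1)])
    show "(r * s) \<odot>\<^bsub>?Q\<^esub> x = r \<odot>\<^bsub>?Q\<^esub> (s \<odot>\<^bsub>?Q\<^esub> x)"
      unfolding a(2) smult coset_eq_iff by (rule assms(6)[OF a(1)])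
    show "1 \<odot>\<^bsub>?Q\<^esub> x = x"
      unfolding a(2) smult coset_eq_iff by (rule assms(7)[OF a(1)])
    fix y assume "y \<in> carrier ?Q"
    then obtain b where b: "y = (+) b ` J" using carrier by blast
    show "r \<odot>\<^bsub>?Q\<^esub> (x \<oplus>\<^bsub>?Q\<^esub> y) = r \<odot>\<^bsub>?Q\<^esub> x \<oplus>\<^bsub>?Q\<^esub> r \<odot>\<^bsub>?Q\<^esub> y"
      unfolding a(2) b smult quotient_module_sel(3) smult act(1) ..
  qed
qed

end

lemma left_ideal_additive_subgroup: "left_ideal J \<Longrightarrow> additive_subgroup J"
  for J :: "'u::complex_algebra_1 set"
  by (intro subspace_additive_subgroup left_ideal_subspace)

lemma additive_subgroup_UNIV: "additive_subgroup UNIV"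
  by (simp add: additive_subgroup_def)

lemma cyclic_module_smult:
  fixes J :: "'u::complex_algebra_1 set"
  assumes "left_ideal J"
  shows "r \<odot>\<^bsub>quotient_module (*) UNIV J\<^esub> (+) a ` J = (+) (r * a) ` J"
  by (rule quotient_module_smult[OF left_ideal_additive_subgroup[OF assms]])
    (simp_all add: distrib_left left_ideal_mult[OF assms])

lemma left_module_cyclic:
  fixes J :: "'u::complex_algebra_1 set"
  assumes "left_ideal J"
  shows "left_module (quotient_module (*) UNIV J)"
  by (rule left_module_quotient[OF left_ideal_additive_subgroup[OF assms] additive_subgroup_UNIV])
    (simp_all add: distrib_left distrib_right mult.assoc left_ideal_mult[OF assms]
      additive_subgroup_0[OF left_ideal_additive_subgroup[OF assms]])

section \<open>The tensor product \<open>W(\<lambda>) \<otimes> \<complex>\<^sub>\<pi>\<close>\<close>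

locale weyl_tensor = cartan_setting D
  for D :: "'g::complex_lie_algebra cartan_data" +
  fixes lam :: "'g ext_loop \<Rightarrow> complex" and \<pi> :: "nat \<Rightarrow> complex poly"
begin

abbreviation "Y \<equiv> (loop_gen :: 'g \<Rightarrow> int \<Rightarrow> 'g loop uea)"
abbreviation "A0 \<equiv> U0 D Y"
abbreviation "J \<equiv> weyl_ideal D lam"
abbreviation "K \<equiv> pi_ideal D \<pi>"
abbreviation "M \<equiv> weyl_module_loop D lam"
abbreviation "N \<equiv> pi_module D \<pi>"
abbreviation "T \<equiv> weyl_module_pi D lam \<pi>"

sublocale L: loop_rep D Y "{}"
  by (rule loop_rep_loop)

lemma left_ideal_J: "left_ideal J"
  unfolding weyl_ideal_def by (rule left_ideal_hull)

lemma subgroup_J: "additive_subgroup J"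
  by (rule left_ideal_additive_subgroup[OF left_ideal_J])

lemma subgroup_A0: "additive_subgroup A0"
  by (rule subspace_additive_subgroup[OF L.subspace_U0])

lemma submodule_K: "left_submodule A0 K"
  unfolding pi_ideal_def by (rule hull_in) (auto simp: left_submodule_def)

lemma subgroup_K: "additive_subgroup K"
  unfolding additive_subgroup_def
proof (intro conjI ballI)
  fix x y assume xy: "x \<in> K" "y \<in> K"
  have "- 1 \<in> A0" using csubspace_neg[OF L.subspace_U0 L.U0_one] .
  then have "(- 1) * y \<in> K" using submodule_K xy unfolding left_submodule_def by blast
  then have "x + (- 1) * y \<in> K" using submodule_K xy unfolding left_submodule_def by blast
  then show "x - y \<in> K" by simp
qed (use submodule_K in \<open>simp add: left_submodule_def\<close>)

abbreviation "qM a \<equiv> (+) a ` J"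
abbreviation "qN a \<equiv> (+) a ` K"

lemma M_carrier: "carrier M = range qM"
  and M_add: "qM a \<oplus>\<^bsub>M\<^esub> qM b = qM (a + b)"
  unfolding weyl_module_loop_def by (rule quotient_module_sel[OF subgroup_J])+

lemma M_smult: "r \<odot>\<^bsub>M\<^esub> qM a = qM (r * a)"
  unfolding weyl_module_loop_def by (rule cyclic_module_smult[OF left_ideal_J])

lemma N_carrier: "carrier N = qN ` A0"
  and N_add: "qN a \<oplus>\<^bsub>N\<^esub> qN b = qN (a + b)"
  unfolding pi_module_def by (rule quotient_module_sel[OF subgroup_K])+

lemma N_smult: "s \<in> A0 \<Longrightarrow> s \<odot>\<^bsub>N\<^esub> qN a = qN (s * a)"
  unfolding pi_module_def using submodule_K
  by (intro quotient_module_smult[OF subgroup_K]) (auto simp: left_submodule_def distrib_left)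

lemma ract: assumes "s \<in> A0" shows "weyl_right_action D lam (qM a) s = qM (a * s)"
proof -
  have "j * s \<in> J" if "j \<in> J" for j
    using L.weyl_ideal_right_mult[OF _ assms] that unfolding weyl_ideal_def by blast
  then show ?thesis
    unfolding weyl_right_action_def
    by (intro coset_act[OF subgroup_J, of "\<lambda>x. x * s"]) (auto simp: distrib_right)
qed

abbreviation "rels \<equiv> tensor_relations A0 (weyl_right_action D lam) M N"
definition "G = additive_subgroup hull rels"
definition "F = {p :: ('g loop uea set \<times> 'g loop uea set \<Rightarrow>\<^sub>0 int). Poly_Mapping.keys p \<subseteq> carrier M \<times> carrier N}"
definition "act r = frag_extend (\<lambda>(m, n). frag_of (r \<odot>\<^bsub>M\<^esub> m, n))" for r

lemma T_eq: "T = quotient_module act F G"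
  by (simp add: weyl_module_pi_def tensor_module_def act_def[abs_def] F_def G_def)

lemma subgroup_G: "additive_subgroup G"
  unfolding G_def by (rule additive_subgroup_hull)

lemma subgroup_F: "additive_subgroup F"
  unfolding additive_subgroup_def F_def by (auto dest: subsetD[OF keys_diff])

lemma act_of: "act r (frag_of (qM a, n)) = frag_of (qM (r * a), n)"
  by (simp add: act_def M_smult)

lemma act_add: "act r (p + q) = act r p + act r q" and act_diff: "act r (p - q) = act r p - act r q"
  by (simp_all add: act_def frag_extend_add frag_extend_diff)

lemma G_add_left: "s \<in> A0 \<Longrightarrow> frag_of (qM (a + b), qN s) - frag_of (qM a, qN s) - frag_of (qM b, qN s) \<in> G"
  unfolding G_def tensor_relations_def
  by (rule hull_inc, rule UnI1, rule UnI1, intro CollectI exI[of _ "qM a"] exI[of _ "qM b"] exI[of _ "qN s"])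
    (simp add: M_carrier N_carrier M_add)

lemma G_add_right: "s \<in> A0 \<Longrightarrow> t \<in> A0 \<Longrightarrow>
    frag_of (qM a, qN (s + t)) - frag_of (qM a, qN s) - frag_of (qM a, qN t) \<in> G"
  unfolding G_def tensor_relations_def
  by (rule hull_inc, rule UnI1, rule UnI2, intro CollectI exI[of _ "qM a"] exI[of _ "qN s"] exI[of _ "qN t"])
    (simp add: M_carrier N_carrier N_add)

lemma G_balanced: "s \<in> A0 \<Longrightarrow> t \<in> A0 \<Longrightarrow> frag_of (qM (a * s), qN t) - frag_of (qM a, qN (s * t)) \<in> G"
  unfolding G_def tensor_relations_def
  by (rule hull_inc, rule UnI2, intro CollectI exI[of _ "qM a"] exI[of _ s] exI[of _ "qN t"])
    (simp add: M_carrier N_carrier ract N_smult)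

lemma act_G: assumes "p \<in> G" shows "act r p \<in> G"
proof -
  have "additive_subgroup {p. act r p \<in> G}"
    using additive_subgroup_0[OF subgroup_G] additive_subgroup_diff[OF subgroup_G]
    by (simp add: additive_subgroup_def act_diff) (simp add: act_def)
  moreover have "rels \<subseteq> {p. act r p \<in> G}"
  proof
    fix p assume "p \<in> rels"
    then consider
      a b s where "s \<in> A0" "p = frag_of (qM a \<oplus>\<^bsub>M\<^esub> qM b, qN s) - frag_of (qM a, qN s) - frag_of (qM b, qN s)"
    | a s t where "s \<in> A0" "t \<in> A0" "p = frag_of (qM a, qN s \<oplus>\<^bsub>N\<^esub> qN t) - frag_of (qM a, qN s) - frag_of (qM a, qN t)"
    | a s t where "s \<in> A0" "t \<in> A0" "p = frag_of (weyl_right_action D lam (qM a) s, qN t) - frag_of (qM a, s \<odot>\<^bsub>N\<^esub> qN t)"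
      unfolding tensor_relations_def M_carrier N_carrier by blast
    then show "p \<in> {p. act r p \<in> G}"
    proof cases
      case 1
      then show ?thesis using G_add_left[of s "r * a" "r * b"] by (simp add: M_add act_diff act_of distrib_left)
    next
      case 2
      then show ?thesis using G_add_right[of s t "r * a"] by (simp add: N_add act_diff act_of)
    next
      case 3
      then show ?thesis using G_balanced[of s t "r * a"] by (simp add: ract N_smult act_diff act_of mult.assoc)
    qed
  qed
  ultimately have "G \<subseteq> {p. act r p \<in> G}" unfolding G_def by (intro hull_minimal)
  with assms show ?thesis by blast
qed

lemma F_induct [consumes 1, case_names of diff]:
  assumes "p \<in> F" and "\<And>a s. s \<in> A0 \<Longrightarrow> P (frag_of (qM a, qN s))" "\<And>p q. P p \<Longrightarrow> P q \<Longrightarrow> P (p - q)"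
  shows "P p"
proof -
  have "Poly_Mapping.keys p \<subseteq> carrier M \<times> carrier N" using assms(1) by (simp add: F_def)
  then show ?thesis
  proof (induction p rule: frag_induction)
    case zero
    have "P (frag_of (qM 1, qN 1))" by (rule assms(2)[OF L.U0_one])
    from assms(3)[OF this this] show ?case by simp
  next
    case (one x)
    then obtain a s where "s \<in> A0" "x = (qM a, qN s)" by (auto simp: M_carrier N_carrier)
    then show ?case using assms(2) by simp
  qed (rule assms(3))
qed

lemma frag_of_F: "s \<in> A0 \<Longrightarrow> frag_of (qM a, qN s) \<in> F"
  by (auto simp: F_def M_carrier N_carrier)

lemma act_F: assumes "p \<in> F" shows "act r p \<in> F"
  using assms
proof (induction rule: F_induct)
  case (of a s)
  then show ?case by (simp add: act_of frag_of_F)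
next
  case (diff p q)
  then show ?case using additive_subgroup_diff[OF subgroup_F] by (simp add: act_diff)
qed

lemma left_module_T: "left_module T"
  unfolding T_eq
proof (rule left_module_quotient[OF subgroup_G subgroup_F act_add act_G act_F])
  fix r s p assume p: "p \<in> F"
  show "act (r + s) p - (act r p + act s p) \<in> G"
    using p
  proof (induction rule: F_induct)
    case (of a t)
    then show ?case using G_add_left[of t "r * a" "s * a"] by (simp add: act_of distrib_right diff_diff_eq)
  next
    case (diff p q)
    from additive_subgroup_diff[OF subgroup_G this] show ?case by (simp add: act_diff algebra_simps)
  qed
  show "act (r * s) p - act r (act s p) \<in> G"
    using p
  proof (induction rule: F_induct)
    case (of a t)
    then show ?case using additive_subgroup_0[OF subgroup_G] by (simp add: act_of mult.assoc)
  next
    case (diff p q)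
    from additive_subgroup_diff[OF subgroup_G this] show ?case by (simp add: act_diff algebra_simps)
  qed
  show "act 1 p - p \<in> G"
    using p
  proof (induction rule: F_induct)
    case (of a t)
    then show ?case using additive_subgroup_0[OF subgroup_G] by (simp add: act_of)
  next
    case (diff p q)
    from additive_subgroup_diff[OF subgroup_G this] show ?case by (simp add: act_diff algebra_simps)
  qed
qed

text \<open>The tensor product is the cyclic module generated by \<open>1 \<otimes> 1\<close>; \<open>ann\<close> is its annihilator.\<close>

definition "gen u = frag_of (qM u, qN 1)" for u
definition "ann = {u. gen u \<in> G}"

lemma gen_add: "gen (u + v) - gen u - gen v \<in> G"
  unfolding gen_def by (rule G_add_left[OF L.U0_one])

lemma act_gen: "act r (gen u) = gen (r * u)"
  by (simp add: gen_def act_of)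

lemma gen_0: "gen 0 \<in> G"
  using additive_subgroup_minus[OF subgroup_G gen_add[of 0 0]] by simp

lemma left_ideal_ann: "left_ideal ann"
  unfolding left_submodule_def
proof (intro conjI ballI)
  fix u v assume "u \<in> ann" "v \<in> ann"
  then have "(gen (u + v) - gen u - gen v) + (gen u + gen v) \<in> G"
    by (intro additive_subgroup_add[OF subgroup_G] gen_add) (simp_all only: ann_def mem_Collect_eq)
  then show "u + v \<in> ann" by (simp add: ann_def)
next
  fix r u assume "u \<in> ann"
  then show "r * u \<in> ann" using act_G[of "gen u" r] by (simp add: ann_def act_gen)
qed (simp add: ann_def gen_0)

lemma weyl_ideal_ann: assumes "u \<in> J" shows "u \<in> ann"
proof -
  have "u - 0 \<in> J" using assms by simp
  then have "qM u = qM 0" by (simp only: coset_eq_iff[OF subgroup_J])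
  then show ?thesis using gen_0 by (simp add: ann_def gen_def)
qed

text \<open>u \<otimes> 1 = 1 \<otimes> u, and the class of u modulo K is 0.\<close>

lemma pi_ideal_ann: assumes "u \<in> A0" "u \<in> K" shows "u \<in> ann"
proof -
  have 0: "0 \<in> A0" by (rule additive_subgroup_0[OF subgroup_A0])
  have "gen u - frag_of (qM 1, qN u) \<in> G" using G_balanced[OF assms(1) L.U0_one, of 1] by (simp add: gen_def)
  moreover have "u - 0 \<in> K" using assms by simp
  then have "qN u = qN 0" by (simp only: coset_eq_iff[OF subgroup_K])
  moreover have "frag_of (qM 1, qN 0) \<in> G"
    using additive_subgroup_minus[OF subgroup_G G_add_right[OF 0 0, of 1]] by simp
  ultimately have "(gen u - frag_of (qM 1, qN 0)) + frag_of (qM 1, qN 0) \<in> G"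
    using additive_subgroup_add[OF subgroup_G] by metis
  then show ?thesis by (simp add: ann_def)
qed

text \<open>a \<otimes> s = a s \<otimes> 1 for s in U(0), so the module is cyclic.\<close>

lemma gen_surj: assumes "p \<in> F" shows "\<exists>u. p - gen u \<in> G"
  using assms
proof (induction rule: F_induct)
  case (of a s)
  from additive_subgroup_minus[OF subgroup_G G_balanced[OF of L.U0_one, of a]] show ?case
    by (intro exI[of _ "a * s"]) (simp add: gen_def)
next
  case (diff p q)
  then obtain u v where uv: "p - gen u \<in> G" "q - gen v \<in> G" by blast
  have "(p - gen u) - (q - gen v) + (gen (u - v + v) - gen (u - v) - gen v) \<in> G"
    by (rule additive_subgroup_add[OF subgroup_G additive_subgroup_diff[OF subgroup_G uv] gen_add])
  then have "(p - q) - gen (u - v) \<in> G" by (simp add: algebra_simps)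
  then show ?case by blast
qed

lemma gen_cong: "u - v \<in> ann \<Longrightarrow> gen u - gen v \<in> G"
  using additive_subgroup_add[OF subgroup_G gen_add[of "u - v" v]] by (fastforce simp: ann_def)

lemma gen_sum: "finite B \<Longrightarrow> gen (\<Sum>b\<in>B. f b) - (\<Sum>b\<in>B. gen (f b)) \<in> G"
proof (induction B rule: finite_induct)
  case empty
  then show ?case using gen_0 by simp
next
  case (insert b B)
  from additive_subgroup_add[OF subgroup_G gen_add[of "f b" "\<Sum>b\<in>B. f b"] insert.IH] insert.hyps
  show ?case by (simp add: algebra_simps)
qed

lemma finite_dimensional_T:
  assumes fin: "finite B" and span: "cspan (B \<union> ann) = UNIV"
  shows "finite_dimensional_module T"
proof -
  let ?q = "\<lambda>p. (+) p ` G"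
  \<comment> \<open>\<open>finite_dimensional_module\<close> sums over a set of vectors, so B is
    thinned to B0, on which sending b to b \<otimes> 1 is injective.\<close>
  from subset_image_inj[of "(\<lambda>b. ?q (gen b)) ` B" "\<lambda>b. ?q (gen b)" B, THEN iffD1, OF order_refl]
  obtain B0 where B0: "B0 \<subseteq> B" "inj_on (\<lambda>b. ?q (gen b)) B0" "(\<lambda>b. ?q (gen b)) ` B = (\<lambda>b. ?q (gen b)) ` B0"
    by (elim exE conjE)
  have fin0: "finite B0" using fin B0(1) finite_subset by blast
  have sub: "csubspace ann" by (rule left_ideal_subspace[OF left_ideal_ann])
  have "B \<union> ann \<subseteq> cspan (B0 \<union> ann)"
  proof
    fix b assume "b \<in> B \<union> ann"
    then show "b \<in> cspan (B0 \<union> ann)"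
    proof
      assume "b \<in> B"
      then have "?q (gen b) \<in> (\<lambda>b. ?q (gen b)) ` B0" unfolding B0(3)[symmetric] by (rule imageI)
      then obtain b0 where b0: "b0 \<in> B0" "?q (gen b) = ?q (gen b0)" by (elim imageE)
      then have "gen b - gen b0 \<in> G" by (simp add: coset_eq_iff[OF subgroup_G])
      from additive_subgroup_diff[OF subgroup_G this gen_add[of "b - b0" b0]] have "b - b0 \<in> ann" by (simp add: ann_def)
      then have "b0 + (b - b0) \<in> cspan (B0 \<union> ann)"
        using b0(1) by (intro cspan_add cspan_base) auto
      then show ?thesis by simp
    qed (auto intro: cspan_base)
  qed
  then have "cspan (B \<union> ann) \<subseteq> cspan (B0 \<union> ann)"
    by (intro cspan_minimal csubspace_span)
  with span have span0: "cspan (B0 \<union> ann) = UNIV" by blast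
  have smult: "r \<odot>\<^bsub>T\<^esub> ?q p = ?q (act r p)" for r p
    unfolding T_eq by (rule quotient_module_smult[OF subgroup_G]) (rule act_add, rule act_G)
  have gF: "gen u \<in> F" for u unfolding gen_def by (rule frag_of_F[OF L.U0_one])
  show ?thesis
    unfolding finite_dimensional_module_def
  proof (intro exI[of _ "(\<lambda>b. ?q (gen b)) ` B0"] conjI ballI)
    show "(\<lambda>b. ?q (gen b)) ` B0 \<subseteq> carrier T" unfolding T_eq quotient_module_sel[OF subgroup_G] using gF by blast
    fix x assume "x \<in> carrier T"
    then obtain p where p: "p \<in> F" "x = ?q p" unfolding T_eq quotient_module_sel[OF subgroup_G] by blast
    obtain u where u: "p - gen u \<in> G" using gen_surj[OF p(1)] by blast
    have "u \<in> cspan (B0 \<union> ann)" using span0 by simp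
    then obtain w v where w: "w \<in> cspan B0" and v: "v \<in> cspan ann" and uwv: "u = w + v"
      by (auto simp: cspan_Un)
    have "v \<in> ann" using v cspan_eq_iff[of ann, THEN iffD2, OF sub] by simp
    obtain a where a: "w = (\<Sum>b\<in>B0. a b *\<^sub>C b)" using span_finite_obtain[OF fin0 w] .
    have w': "w = (\<Sum>b\<in>B0. of_complex (a b) * b)" by (simp add: a of_complex_def mult_scaleC_left)
    have "gen u - gen w \<in> G" by (rule gen_cong) (simp add: uwv \<open>v \<in> ann\<close>)
    moreover have "gen w - (\<Sum>b\<in>B0. act (of_complex (a b)) (gen b)) \<in> G"
      unfolding w' act_gen by (rule gen_sum[OF fin0])
    ultimately have "(p - gen u) + (gen u - gen w) + (gen w - (\<Sum>b\<in>B0. act (of_complex (a b)) (gen b))) \<in> G"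
      by (intro additive_subgroup_add[OF subgroup_G] u)
    then have "x = ?q (\<Sum>b\<in>B0. act (of_complex (a b)) (gen b))"
      unfolding p(2) by (simp add: coset_eq_iff[OF subgroup_G])
    also have "\<dots> = finsum T (\<lambda>b. ?q (act (of_complex (a b)) (gen b))) B0"
      unfolding T_eq by (rule finsum_quotient[OF subgroup_G subgroup_F fin0, symmetric]) (rule act_F[OF gF])
    also have "\<dots> = finsum T (\<lambda>b. of_complex (a b) \<odot>\<^bsub>T\<^esub> ?q (gen b)) B0"
      by (simp only: smult)
    also have "\<dots> = finsum T (\<lambda>y. of_complex (a (inv_into B0 (\<lambda>b. ?q (gen b)) y)) \<odot>\<^bsub>T\<^esub> y) ((\<lambda>b. ?q (gen b)) ` B0)"
    proof -
      interpret T: abelian_group T unfolding T_eq by (rule abelian_group_quotient[OF subgroup_G subgroup_F])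
      have c: "of_complex c \<odot>\<^bsub>T\<^esub> ?q (gen b) \<in> carrier T" for c b
        unfolding smult unfolding T_eq quotient_module_sel[OF subgroup_G] using act_F[OF gF] by blast
      let ?s = "\<lambda>y. of_complex (a (inv_into B0 (\<lambda>b. ?q (gen b)) y)) \<odot>\<^bsub>T\<^esub> y"
      have "?s \<in> (\<lambda>b. ?q (gen b)) ` B0 \<rightarrow> carrier T" using c by (intro Pi_I) (elim imageE, simp only:)
      from T.finsum_reindex[OF this B0(2)]
      have "finsum T ?s ((\<lambda>b. ?q (gen b)) ` B0) = finsum T (\<lambda>b. ?s (?q (gen b))) B0" .
      also have "\<dots> = finsum T (\<lambda>b. of_complex (a b) \<odot>\<^bsub>T\<^esub> ?q (gen b)) B0"
        by (rule T.finsum_cong'[OF refl]) (simp_all only: Pi_I c inv_into_f_f[OF B0(2)])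
      finally show ?thesis ..
    qed
    finally show "\<exists>c. x = finsum T (\<lambda>b. of_complex (c b) \<odot>\<^bsub>T\<^esub> b) ((\<lambda>b. ?q (gen b)) ` B0)"
      by (intro exI[of _ "\<lambda>y. a (inv_into B0 (\<lambda>b. ?q (gen b)) y)"])
  qed (use fin0 in simp)
qed

end

lemma (in cartan_setting) finite_dimensional_weyl_module_pi:
  assumes \<pi>0: "\<And>i. i \<in> I \<Longrightarrow> coeff (\<pi> i) 0 = 1"
    and deg: "\<And>i. i \<in> I \<Longrightarrow> lam (ext_elt (simple_coroot D i) 0) = of_nat (degree (\<pi> i))"
  shows "left_module (weyl_module_pi D lam \<pi>) \<and> finite_dimensional_module (weyl_module_pi D lam \<pi>)"
proof -
  interpret W: weyl_tensor D lam \<pi> by unfold_locales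
  have label: "weight_label D lam i = degree (\<pi> i)" if "i \<in> I" for i
    unfolding weight_label_def deg[OF that] by (rule the_equality) simp_all
  have rel: "r \<in> W.ann" if "r \<in> weyl_relations D loop_gen lam" for r
    using that by (intro W.weyl_ideal_ann) (auto simp: weyl_ideal_def intro: hull_inc)
  interpret A: loop_module D loop_gen "{}" W.ann
  proof unfold_locales
    show "left_ideal W.ann" by (rule W.left_ideal_ann)
    show "loop_gen (xp i) m \<in> W.ann" if "i \<in> I" for i m by (rule rel[OF W.L.xp_weyl_relations[OF that]])
    show "nilpotent_at W.ann (loop_gen (xm i) 0) 1" if "i \<in> I" for i
      unfolding nilpotent_at_def using rel[OF W.L.xm_power_weyl_relations[OF that]] by (metis mult.right_neutral)
  qed
  have "\<exists>B. finite B \<and> cspan (B \<union> W.ann) = UNIV"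
  \<comment> \<open>The relation pairs the k-th coefficient of \<pi>_i with the exponent m - k. In
    increasing order of exponents this is the reversed polynomial, whose constant coefficient is the
    leading coefficient of \<pi>_i.\<close>
  proof (rule A.finite_mod_ideal[where p = "\<lambda>i. reflect_poly (\<pi> i)"])
    fix i assume i: "i \<in> I"
    then have nz: "\<pi> i \<noteq> 0" using \<pi>0 by fastforce
    then show "coeff (reflect_poly (\<pi> i)) 0 \<noteq> 0" by simp
    let ?d = "degree (\<pi> i)"
    fix s
    \<comment> \<open>\<Lambda>_(i,k) acts on 1 \<otimes> 1 as the scalar
      \<open>coeff (\<pi> i) k\<close>.\<close>
    have Lam: "Lam D loop_gen i (int k) - of_complex (coeff (\<pi> i) k) \<in> W.ann" for k
    proof (rule W.pi_ideal_ann)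
      show "Lam D loop_gen i (int k) - of_complex (coeff (\<pi> i) k) \<in> W.A0"
        unfolding Lam_def of_complex_def using W.L.Lam_series_U0[OF i]
        by (intro csubspace_diff[OF W.L.subspace_U0] csubspace_scale[OF W.L.subspace_U0]
            W.L.U0_one) simp
      show "Lam D loop_gen i (int k) - of_complex (coeff (\<pi> i) k) \<in> W.K"
        unfolding pi_ideal_def Lam_def using i by (intro hull_inc) auto
    qed
    \<comment> \<open>The relation at m = s + deg + 1, so that the exponents run from s + deg down
      to s.\<close>
    let ?r = "\<Sum>k = 0..?d. loop_gen (xm i) (s + int ?d + 1 - 1 - int k) * Lam D loop_gen i (int k)"
    have "?r * 1 \<in> weyl_relations D loop_gen lam"
      unfolding weyl_relations_def label[OF i, symmetric]
      by (rule UnI1, rule UnI2, intro CollectI exI[of _ i] exI[of _ "s + int (weight_label D lam i) + 1"] exI[of _ 1])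
        (use i W.L.U0_one in simp)
    then have "?r * 1 \<in> W.ann" by (rule rel)
    moreover have "(\<Sum>k = 0..?d. loop_gen (xm i) (s + int ?d - int k) * (Lam D loop_gen i (int k) - of_complex (coeff (\<pi> i) k))) \<in> W.ann"
      by (intro csubspace_sum[OF A.subspace_J] left_ideal_mult[OF A.left_ideal_J] Lam)
    ultimately have "?r * 1 - (\<Sum>k = 0..?d. loop_gen (xm i) (s + int ?d - int k) * (Lam D loop_gen i (int k) - of_complex (coeff (\<pi> i) k))) \<in> W.ann"
      by (rule csubspace_diff[OF A.subspace_J])
    also have "?r * 1 - (\<Sum>k = 0..?d. loop_gen (xm i) (s + int ?d - int k) * (Lam D loop_gen i (int k) - of_complex (coeff (\<pi> i) k)))
      = (\<Sum>k\<le>?d. coeff (\<pi> i) k *\<^sub>C loop_gen (xm i) (s + int ?d - int k))"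
      by (simp add: sum_subtractf[symmetric] right_diff_distrib of_complex_def mult_scaleC_right atLeast0AtMost)
    also have "\<dots> = (\<Sum>k\<le>?d. coeff (reflect_poly (\<pi> i)) k *\<^sub>C loop_gen (xm i) (s + int k))"
      by (rule sum.reindex_bij_witness[of _ "\<lambda>k. ?d - k" "\<lambda>k. ?d - k"])
        (auto simp: coeff_reflect_poly of_nat_diff algebra_simps)
    also have "\<dots> = A.poly_X (xm i) (reflect_poly (\<pi> i)) s"
      using \<pi>0[OF i] by (simp add: A.poly_X_def poly_comb_bound[OF degree_reflect_poly_le])
    finally show "A.poly_X (xm i) (reflect_poly (\<pi> i)) s \<in> W.ann" .
  qed simp
  then show ?thesis using W.left_module_T W.finite_dimensional_T by blast
qed

section \<open>Integrability\<close>

lemma in_span_UN_subspaces: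
  assumes W: "\<And>i. csubspace (W i)" and v: "v \<in> cspan (\<Union>i\<in>K. W i)"
  shows "\<exists>F f. finite F \<and> F \<subseteq> K \<and> (\<forall>i. f i \<in> W i) \<and> v = (\<Sum>i\<in>F. f i)"
  using v
proof (induction rule: cspan_induct_alt)
  case base
  show ?case using csubspace_0[OF W]
    by (intro exI[of _ "{}"] exI[of _ "\<lambda>_. 0"]) simp
next
  case (step c x y)
  then obtain k F f where k: "k \<in> K" "x \<in> W k" and F: "finite F" "F \<subseteq> K" "\<forall>i. f i \<in> W i" "y = (\<Sum>i\<in>F. f i)" by blast
  define g where "g i = (if i \<in> F then f i else 0) + (if i = k then c *\<^sub>C x else 0)" for i
  have "(\<Sum>i\<in>insert k F. g i) = (\<Sum>i\<in>insert k F. if i \<in> F then f i else 0) + c *\<^sub>C x"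
    unfolding g_def sum.distrib using F(1) by (simp del: sum.insert)
  also have "(\<Sum>i\<in>insert k F. if i \<in> F then f i else 0) = (\<Sum>i\<in>F. f i)"
    using F(1) by (intro sum.mono_neutral_cong_right) auto
  finally have "c *\<^sub>C x + y = (\<Sum>i\<in>insert k F. g i)" by (simp add: F(4) add.commute)
  moreover have "g i \<in> W i" for i
    unfolding g_def using F(3) k(2) csubspace_0[OF W] csubspace_scale[OF W]
    by (intro csubspace_add[OF W]) auto
  ultimately show ?case using F(1,2) k(1) by (intro exI[of _ "insert k F"] exI[of _ g]) auto
qed

locale weight_module = loop_module D X Ds J
  for D :: "'g::complex_lie_algebra cartan_data" and X :: "'g \<Rightarrow> int \<Rightarrow> 'u::complex_algebra_1" and Ds J +
  fixes \<chi> :: "'g \<Rightarrow> complex"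
  assumes H_J: "h \<in> H \<Longrightarrow> X h 0 - of_complex (\<chi> h) \<in> J"
    and d_J: "d \<in> Ds \<Longrightarrow> \<exists>c. d - of_complex c \<in> J"
begin

definition weight :: "'g \<Rightarrow> complex \<Rightarrow> 'u \<Rightarrow> bool"
  where "weight h m v \<longleftrightarrow> X h 0 * v - m *\<^sub>C v \<in> J"

lemma weight_one: "h \<in> H \<Longrightarrow> weight h (\<chi> h) 1"
  using H_J by (simp add: weight_def of_complex_def)

lemma weight_mult:
  assumes "weight h m v" "lie h y = a *\<^sub>C y"
  shows "weight h (m + a) (X y n * v)"
proof -
  have "X h 0 * (X y n * v) = X y n * (X h 0 * v) + a *\<^sub>C (X y n * v)"
    using X_mult[of h 0 y n] assms(2) by (simp add: X_scale mult_scaleC_left distrib_right flip: mult.assoc)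
  then have "X h 0 * (X y n * v) - (m + a) *\<^sub>C (X y n * v) = X y n * (X h 0 * v - m *\<^sub>C v)"
    by (simp add: right_diff_distrib mult_scaleC_right scaleC_add_left)
  then show ?thesis using assms(1) left_ideal_mult[OF left_ideal_J] by (simp add: weight_def)
qed

lemma weight_power:
  assumes "weight h m v" "lie h y = a *\<^sub>C y"
  shows "weight h (m + of_nat k * a) (X y n ^ k * v)"
proof (induction k)
  case (Suc k)
  from weight_mult[OF this assms(2), of n] show ?case by (simp add: algebra_simps)
qed (use assms in simp)

lemma subspace_weight: "csubspace {v. weight h m v}"
proof (rule csubspaceI)
  show "0 \<in> {v. weight h m v}" using csubspace_0[OF subspace_J] by (simp add: weight_def)
next
  fix v w assume "v \<in> {v. weight h m v}" "w \<in> {v. weight h m v}"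
  then have "(X h 0 * v - m *\<^sub>C v) + (X h 0 * w - m *\<^sub>C w) \<in> J"
    unfolding weight_def by (intro csubspace_add[OF subspace_J]) auto
  then show "v + w \<in> {v. weight h m v}" by (simp add: weight_def algebra_simps scaleC_add_right)
next
  fix c v assume "v \<in> {v. weight h m v}"
  then have "c *\<^sub>C (X h 0 * v - m *\<^sub>C v) \<in> J"
    unfolding weight_def by (intro csubspace_scale[OF subspace_J]) auto
  then show "c *\<^sub>C v \<in> {v. weight h m v}"
    by (simp add: weight_def mult_scaleC_right complex_vector.scale_right_diff_distrib scaleC_scaleC mult.commute)
qed

lemma weight_J: "v \<in> J \<Longrightarrow> weight h m v"
  unfolding weight_def
  by (intro csubspace_diff[OF subspace_J] left_ideal_mult[OF left_ideal_J] csubspace_scale[OF subspace_J])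

lemma npos_J: assumes "y \<in> npos" shows "X y n \<in> J"
proof -
  have "\<forall>n. X y n \<in> J"
    using assms unfolding npos_def
  proof (induction rule: lie_subalgebra_hull_induct)
    case (lie x y)
    show ?case
    proof
      fix n
      have "commutator (X x n) (X y 0) \<in> J"
        unfolding commutator_def using lie
        by (intro csubspace_diff[OF subspace_J] left_ideal_mult[OF left_ideal_J]) auto
      then show "X (lie x y) n \<in> J" by (simp add: X_lie)
    qed
  next
    case subspace
    show ?case
      by (rule csubspaceI) (auto simp: X_add X_scale csubspace_0[OF subspace_J]
          csubspace_add[OF subspace_J] csubspace_scale[OF subspace_J])
  qed (auto simp: xp_J)
  then show ?thesis ..
qed

lemma lie_npos_H: assumes "y \<in> npos" "h \<in> H" shows "lie y h \<in> npos"
proof -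
  have "y \<in> lie_subalgebra hull (xp ` I)" using assms(1) by (simp only: npos_def)
  then have "y \<in> lie_subalgebra hull (xp ` I) \<and> lie y h \<in> lie_subalgebra hull (xp ` I)"
  proof (induction rule: lie_subalgebra_hull_induct)
    case (base x)
    then obtain i where i: "i \<in> I" "x = xp i" by blast
    have "lie x h = (- sr i h) *\<^sub>C x"
      using tripleD(2)[OF triple_simple[OF i(1)]] assms(2) lie_anticomm[of x h] i(2) by (simp add: root_space_def)
    moreover have "x \<in> lie_subalgebra hull (xp ` I)" using base by (rule hull_inc)
    ultimately show ?case using csubspace_scale[OF hull_subspace] by metis
  next
    case subspace
    show ?case
      by (rule csubspaceI)
        (auto simp: lie_add_left lie_scaleC_left csubspace_0[OF hull_subspace]
          intro: csubspace_add[OF hull_subspace] csubspace_scale[OF hull_subspace])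
  next
    case (lie x y)
    have "lie (lie x y) h = lie (lie x h) y + lie x (lie y h)"
      unfolding lie_anticomm[of "lie x y" h] lie_lie_left[of h x y] lie_anticomm[of h x] lie_anticomm[of h y]
      by (simp add: lie_minus_left lie_minus_right)
    then show ?case using lie by (auto intro!: csubspace_add[OF hull_subspace] hull_lie)
  qed
  then show ?thesis unfolding npos_def ..
qed

text \<open>rho acts on x^-_i by -1, and eigenvalues add under brackets. Their nonpositivity bounds
  the weights of the module in \<open>weight_bounded\<close>.\<close>

lemma nneg_weights:
  assumes "y \<in> nneg" shows "y \<in> cspan {y. \<exists>k::nat. lie rho y = (- of_nat k) *\<^sub>C y}" (is "_ \<in> cspan ?W")
  using assms unfolding nneg_def
proof (induction rule: lie_subalgebra_hull_induct)
  case (base x)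
  then obtain i where i: "i \<in> I" "x = xm i" by blast
  have "lie rho x = (- of_nat 1) *\<^sub>C x"
    using tripleD(3)[OF triple_simple[OF i(1)]] rho(1) rho(2)[OF i(1)] i(2) by (simp add: root_space_def)
  then show ?case by (intro cspan_base) blast
next
  case subspace
  show ?case by (simp add: csubspace_span)
next
  case (lie x y)
  have "lie a b \<in> cspan ?W" if a: "a \<in> ?W" and b: "b \<in> ?W" for a b
  proof -
    obtain k l :: nat where "lie rho a = (- of_nat k) *\<^sub>C a" "lie rho b = (- of_nat l) *\<^sub>C b" using a b by blast
    then have "lie rho (lie a b) = (- of_nat (k + l)) *\<^sub>C lie a b"
      by (simp add: lie_lie_left lie_minus_left lie_minus_right lie_scaleC_left lie_scaleC_right
          complex_vector.scale_left_diff_distrib)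
    then show ?thesis by (intro cspan_base) blast
  qed
  then have 1: "lie a y \<in> cspan ?W" if "a \<in> ?W" for a
    using clinear_span_induct[OF clinear_lie csubspace_span lie(2)] that by blast
  have "clinear (\<lambda>x. lie x y)" by (simp add: clinear_def lie_add_left lie_scaleC_left)
  from clinear_span_induct[OF this csubspace_span lie(1) 1] show ?case .
qed

text \<open>Two inductive closures express the triangular decomposition \<open>U = U(n\<^sup>-) U(h) U(n\<^sup>+)\<close> applied to
  the generator.\<close>

inductive cartan_part :: "'u \<Rightarrow> bool" where
  cartan_J: "u \<in> J \<Longrightarrow> cartan_part u"
| cartan_one: "cartan_part 1"
| cartan_add: "cartan_part u \<Longrightarrow> cartan_part v \<Longrightarrow> cartan_part (u + v)"
| cartan_scale: "cartan_part u \<Longrightarrow> cartan_part (c *\<^sub>C u)"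
| cartan_mult: "h \<in> H \<Longrightarrow> cartan_part u \<Longrightarrow> cartan_part (X h n * u)"

inductive lowered :: "'u \<Rightarrow> bool" where
  lowered_cartan: "cartan_part u \<Longrightarrow> lowered u"
| lowered_add: "lowered u \<Longrightarrow> lowered v \<Longrightarrow> lowered (u + v)"
| lowered_scale: "lowered u \<Longrightarrow> lowered (c *\<^sub>C u)"
| lowered_mult: "y \<in> nneg \<Longrightarrow> lowered u \<Longrightarrow> lowered (X y n * u)"

text \<open>Moving \<open>X y n\<close> past \<open>X h k\<close> leaves [y, h] \<otimes> t^(n+k),
  and [y, h] is again in \<open>npos\<close>; at the generator everything from \<open>npos\<close>
  vanishes.\<close>

lemma cartan_part_npos: "cartan_part u \<Longrightarrow> y \<in> npos \<Longrightarrow> X y n * u \<in> J"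
proof (induction arbitrary: y n rule: cartan_part.induct)
  case (cartan_mult h u k)
  have "X y n * (X h k * u) = X h k * (X y n * u) + X (lie y h) (n + k) * u"
    using X_mult[of y n h k] by (simp add: distrib_right flip: mult.assoc)
  then show ?case
    using cartan_mult lie_npos_H by (simp add: csubspace_add[OF subspace_J] left_ideal_mult[OF left_ideal_J])
qed (auto simp: npos_J distrib_left mult_scaleC_right left_ideal_mult[OF left_ideal_J] csubspace_add[OF subspace_J]
    csubspace_scale[OF subspace_J])

lemma lowered_0: "lowered 0"
  by (intro lowered_cartan cartan_J csubspace_0[OF subspace_J])

text \<open>On the Cartan part x is split by the triangular decomposition. Past a factor from
  \<open>nneg\<close> it moves at the cost of a commutator, to which the induction hypothesis
  applies because x and n are arbitrary.\<close>

lemma lowered_X: "lowered u \<Longrightarrow> lowered (X x n * u)"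
proof (induction arbitrary: x n rule: lowered.induct)
  case (lowered_cartan u)
  have "x \<in> cspan (H \<union> npos \<union> nneg)" by (simp only: triangular_decomposition UNIV_I)
  then show ?case
  proof (rule cspan_induct)
    show "csubspace {x. lowered (X x n * u)}"
      by (rule csubspaceI)
        (auto simp: X_add X_scale distrib_right mult_scaleC_left lowered_0 intro: lowered_add lowered_scale)
    fix x assume "x \<in> H \<union> npos \<union> nneg"
    then show "lowered (X x n * u)"
      using lowered_cartan cartan_part_npos cartan_J cartan_mult lowered_mult lowered.lowered_cartan by blast
  qed
next
  case (lowered_mult y u k)
  have "X x n * (X y k * u) = X y k * (X x n * u) + X (lie x y) (n + k) * u"
    using X_mult[of x n y k] by (simp add: distrib_right flip: mult.assoc)
  then show ?case using lowered_mult by (simp add: lowered_add lowered.lowered_mult)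
qed (auto simp: distrib_left mult_scaleC_right intro: lowered_add lowered_scale)

lemma d_mult: assumes "d \<in> Ds" shows "d * (X x n * u) = X x n * (d * u) + of_int n *\<^sub>C (X x n * u)"
proof -
  have "d * X x n = X x n * d + of_int n *\<^sub>C X x n"
    using Ds[OF assms, of x n] by (simp add: commutator_def algebra_simps)
  then show ?thesis by (simp add: distrib_right mult_scaleC_left flip: mult.assoc)
qed

lemma cartan_part_d: "cartan_part u \<Longrightarrow> d \<in> Ds \<Longrightarrow> cartan_part (d * u)"
proof (induction rule: cartan_part.induct)
  case cartan_one
  then obtain c where "d - of_complex c \<in> J" using d_J by blast
  then have "cartan_part ((d - of_complex c) + c *\<^sub>C 1)"
    by (intro cartan_add cartan_scale cartan_J cartan_part.cartan_one)
  then show ?case by (simp add: of_complex_def)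
qed (auto simp: d_mult distrib_left mult_scaleC_right left_ideal_mult[OF left_ideal_J] intro: cartan_part.intros)

lemma lowered_d: "lowered u \<Longrightarrow> d \<in> Ds \<Longrightarrow> lowered (d * u)"
  by (induction rule: lowered.induct)
    (auto simp: d_mult distrib_left mult_scaleC_right cartan_part_d intro: lowered.intros)

lemma lowered_all: "lowered u"
  by (rule generated) (auto intro: lowered.intros cartan_one lowered_X lowered_d)

lemma cartan_part_weight: "cartan_part u \<Longrightarrow> weight rho (\<chi> rho) u"
proof (induction rule: cartan_part.induct)
  case (cartan_mult h u n)
  have "lie rho h = 0 *\<^sub>C h" using abelian_H[OF rho(1) cartan_mult.hyps(1)] by simp
  from weight_mult[OF cartan_mult.IH this, of n] show ?case by simp
next
  case (cartan_add u v)
  then show ?case using csubspace_add[OF subspace_weight] by blast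
next
  case (cartan_scale u c)
  then show ?case using csubspace_scale[OF subspace_weight] by blast
qed (auto simp: weight_J weight_one rho)

text \<open>Only eigenvalues of rho are recorded: the height is enough to express that no weight
  lies above \<chi>.\<close>

definition "rho_weights = (\<Union>m::nat. {v. weight rho (\<chi> rho - of_nat m) v})"

lemma span_rho_weights: "u \<in> cspan rho_weights"
proof -
  have "lowered u" by (rule lowered_all)
  then show ?thesis
  proof (induction rule: lowered.induct)
    case (lowered_cartan u)
    then have "weight rho (\<chi> rho - of_nat 0) u" using cartan_part_weight by simp
    then show ?case unfolding rho_weights_def by (intro cspan_base) blast
  next
    case (lowered_mult y u n)
    have base: "X z n * v \<in> cspan rho_weights"
      if z: "z \<in> {y. \<exists>k::nat. lie rho y = (- of_nat k) *\<^sub>C y}" and v: "v \<in> rho_weights" for z v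
    proof -
      obtain k m :: nat where km: "lie rho z = (- of_nat k) *\<^sub>C z" "weight rho (\<chi> rho - of_nat m) v"
        using z v unfolding rho_weights_def by blast
      have "weight rho (\<chi> rho - of_nat (m + k)) (X z n * v)"
        using weight_mult[OF km(2,1), of n] by (simp add: algebra_simps)
      then show ?thesis unfolding rho_weights_def by (intro cspan_base) blast
    qed
    have "X z n * u \<in> cspan rho_weights" if z: "z \<in> {y. \<exists>k::nat. lie rho y = (- of_nat k) *\<^sub>C y}" for z
      by (rule clinear_span_induct[OF clinear_mult csubspace_span lowered_mult.IH base[OF z]])
    moreover have "clinear (\<lambda>z. X z n * u)" by (simp add: clinear_def X_add X_scale distrib_right mult_scaleC_left)
    ultimately show ?case
      using clinear_span_induct[OF _ csubspace_span nneg_weights[OF lowered_mult.hyps(1)]] by blast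
  qed (auto intro: cspan_add cspan_scale)
qed

lemma weight_bounded:
  assumes v: "weight rho c v" and c: "\<And>m::nat. c \<noteq> \<chi> rho - of_nat m"
  shows "v \<in> J"
proof -
  from in_span_UN_subspaces[OF subspace_weight span_rho_weights[unfolded rho_weights_def], of v]
  obtain F :: "nat set" and f where F: "finite F" "\<And>m. weight rho (\<chi> rho - of_nat m) (f m)" "v = (\<Sum>m\<in>F. f m)" by auto
  \<comment> \<open>\<open>None\<close> indexes -v, so that the family sums to 0.\<close>
  define g where "g k = (case k of None \<Rightarrow> - v | Some m \<Rightarrow> f m)" for k
  define w where "w k (h :: 'g) = (case k of None \<Rightarrow> c | Some m \<Rightarrow> \<chi> rho - of_nat m)" for k h
  have "g None \<in> J"
  proof (rule weight_vectors_independent_mod[where Y = "{rho}" and A = "\<lambda>h u. X h 0 * u" and F = "insert None (Some ` F)" and w = w])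
    fix i y assume "i \<in> insert None (Some ` F)" "y \<in> {rho}"
    moreover have "weight rho c (- v)" using v csubspace_neg[OF subspace_weight] by blast
    ultimately show "X y 0 * g i - w i y *\<^sub>C g i \<in> J"
      using F(2) by (cases i) (auto simp: g_def w_def weight_def)
  next
    fix i j assume "i \<in> insert None (Some ` F)" "j \<in> insert None (Some ` F)" "i \<noteq> j"
    then show "\<exists>y\<in>{rho}. w i y \<noteq> w j y"
      using c by (cases i; cases j) (auto simp: w_def)
  next
    have "(\<Sum>i\<in>insert None (Some ` F). g i) = 0"
      using F(1) by (simp add: g_def F(3) sum.reindex)
    then show "(\<Sum>i\<in>insert None (Some ` F). g i) \<in> J" using csubspace_0[OF subspace_J] by simp
  qed (use F(1) subspace_J left_ideal_mult[OF left_ideal_J] in \<open>auto simp: clinear_mult\<close>)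
  then have "- v \<in> J" by (simp add: g_def)
  from csubspace_neg[OF subspace_J this] show ?thesis by simp
qed

text \<open>The vectors f^k w lie in a finite-dimensional space and have distinct h-eigenvalues
  \<chi>(h) - 2k, so one of them is 0.\<close>

lemma nilpotent_lowering_degree_0:
  assumes t: "triple \<beta> e f h"
  shows "nilpotent_at J (X f 0) 1"
proof -
  obtain B where B: "finite B" "\<And>l. set l \<subseteq> range (\<lambda>x. X x 0) \<Longrightarrow> prod_list l \<in> cspan (B \<union> J)"
    using products_degree_0_finite by blast
  have lf: "lie h f = (- 2) *\<^sub>C f" using tripleD(3,4,6)[OF t] by (simp add: root_space_def)
  have v: "\<exists>b\<in>cspan B. X f 0 ^ k - b \<in> J" for k
  proof -
    have "prod_list (replicate k (X f 0)) \<in> cspan (B \<union> J)" by (rule B(2)) auto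
    then have "X f 0 ^ k \<in> cspan (B \<union> J)" by simp
    then obtain b j where "b \<in> cspan B" "j \<in> cspan J" "X f 0 ^ k = b + j"
      by (auto simp: cspan_Un)
    moreover from this have "j \<in> J" using cspan_eq_iff[of J, THEN iffD2, OF subspace_J] by simp
    ultimately show ?thesis by (intro bexI[of _ b]) simp_all
  qed
  obtain c where c: "\<exists>k\<in>{..card B}. c k \<noteq> 0" "(\<Sum>k\<in>{..card B}. c k *\<^sub>C X f 0 ^ k) \<in> J"
    using dependent_mod[where I = "{..card B}" and v = "\<lambda>k. X f 0 ^ k", OF subspace_J B(1) _ _ v] by auto
  have inJ: "c k *\<^sub>C X f 0 ^ k \<in> J" if "k \<in> {..card B}" for k
  proof (rule weight_vectors_independent_mod[where Y = "{h}" and A = "\<lambda>h u. X h 0 * u" and F = "{..card B}"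
        and w = "\<lambda>k h. \<chi> h - 2 * of_nat k" and v = "\<lambda>k. c k *\<^sub>C X f 0 ^ k"])
    fix k y assume "y \<in> {h}"
    have "weight h (\<chi> h - 2 * of_nat k) (X f 0 ^ k)"
      using weight_power[OF weight_one[OF tripleD(4)[OF t]] lf, of k 0] by (simp add: mult.commute)
    then have "weight h (\<chi> h - 2 * of_nat k) (c k *\<^sub>C X f 0 ^ k)"
      using csubspace_scale[OF subspace_weight] by blast
    then show "X y 0 * (c k *\<^sub>C X f 0 ^ k) - (\<chi> y - 2 * of_nat k) *\<^sub>C (c k *\<^sub>C X f 0 ^ k) \<in> J"
      using \<open>y \<in> {h}\<close> by (simp add: weight_def)
  qed (use c(2) that subspace_J left_ideal_mult[OF left_ideal_J] in \<open>auto simp: clinear_mult\<close>)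
  from c(1) obtain k where k: "k \<in> {..card B}" "c k \<noteq> 0" by blast
  from csubspace_scale[OF subspace_J inJ[OF k(1)], of "1 / c k"]
  have "X f 0 ^ k * 1 \<in> J" using k(2) by (simp add: scaleC_scaleC scaleC_one)
  then show ?thesis unfolding nilpotent_at_def by blast
qed

text \<open>A nonzero \<open>(x\<^sup>-\<^sub>\<beta> \<otimes> t)\<^sup>k w\<close> with \<open>k\<close> large would generate under \<open>sl\<^sub>2\<close> a vector of weight
  \<open>\<lambda> + \<beta>\<close>.\<close>

lemma nilpotent_lowering:
  assumes \<beta>: "\<beta> \<in> Rpos"
  shows "nilpotent_at J (X (xminus D \<beta>) n) 1"
proof -
  define e f h where "e = xplus D \<beta>" and "f = xminus D \<beta>" and "h = coroot D \<beta>"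
  have t: "triple \<beta> e f h" unfolding e_def f_def h_def by (rule triple_positive[OF \<beta>])
  have lie: "lie h e = 2 *\<^sub>C e" "lie h f = (- 2) *\<^sub>C f" "lie rho e = \<beta> rho *\<^sub>C e" "lie rho f = (- \<beta> rho) *\<^sub>C f"
    using tripleD(2,3,4,6)[OF t] rho(1) by (simp_all add: root_space_def)
  obtain p :: nat where p: "\<beta> rho = of_nat p" using positive_cone_rho positive_roots(2)[OF \<beta>] by blast
  have p0: "p \<noteq> 0"
  proof
    assume "p = 0"
    obtain c :: "nat \<Rightarrow> nat" where c: "\<beta> = (\<lambda>h. \<Sum>i\<in>I. of_nat (c i) * sr i h)"
      using positive_roots(2)[OF \<beta>] by (rule positive_cone_obtain)
    have "\<beta> rho = (\<Sum>i\<in>I. of_nat (c i) * sr i rho)" by (subst c) (rule refl)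
    then have "(of_nat (\<Sum>i\<in>I. c i) :: complex) = 0" using \<open>p = 0\<close> p by (simp add: rho)
    then have "(\<Sum>i\<in>I. c i) = 0" by (simp only: of_nat_eq_0_iff)
    then have "\<beta> = (\<lambda>_. 0)" unfolding c by simp
    then show False using roots_nonzero positive_roots(1)[OF \<beta>] by blast
  qed
  \<comment> \<open>With k above |\<chi>(h)|, the eigenvalue \<chi>(h) - 2(k+q) met below differs
    from -j for all j \<le> k + q.\<close>
  obtain k :: nat where k: "norm (\<chi> h) < of_nat k" using reals_Archimedean2 by blast
  let ?v = "X f n ^ k"
  have "?v \<in> J"
  proof (rule ccontr)
    assume v: "?v \<notin> J"
    have nil_f: "nilpotent_at J (X f 0) u" for u
      using ad_nilpotent_root[OF positive_roots_neg[OF \<beta>] tripleD(3)[OF t]] nilpotent_lowering_degree_0[OF t]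
      by (rule nilpotent_at_of_1)
    have pow: "((*) (X y 0) ^^ j) u = X y 0 ^ j * u" for j y u by (induction j) (simp_all add: mult.assoc)
    \<comment> \<open>Passing to a lowest weight vector for the sl_2 in degree 0 secures the
      condition e f u = 0 of \<open>sl2_eq_0_of_raise_lower\<close>.\<close>
    obtain q where q: "X f 0 ^ q * ?v \<notin> J" "X f 0 ^ Suc q * ?v \<in> J"
      using last_nonmember[where e = "(*) (X f 0)" and v = ?v and J = J] v nil_f[of ?v]
      unfolding nilpotent_at_def pow by metis
    let ?u = "X f 0 ^ q * ?v" and ?k = "k + q"
    have wh: "weight h (\<chi> h - 2 * of_nat ?k) ?u"
      using weight_power[OF weight_power[OF weight_one[OF tripleD(4)[OF t]] lie(2), of k n] lie(2), of q 0]
      by (simp add: algebra_simps)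
    have wr: "weight rho (\<chi> rho - of_nat ?k * of_nat p) ?u"
      using weight_power[OF weight_power[OF weight_one[OF rho(1)] lie(4), of k n] lie(4), of q 0]
      by (simp add: algebra_simps p)
    have "?u \<in> J"
    proof (rule sl2_eq_0_of_raise_lower[OF subspace_J clinear_mult clinear_mult clinear_mult, where k = "Suc ?k"])
      show "X e 0 * (X f 0 * x) - X f 0 * (X e 0 * x) = X h 0 * x" for x
        using X_mult[of e 0 f 0] tripleD(5)[OF t] by (simp add: distrib_right flip: mult.assoc)
      show "X h 0 * (X e 0 * x) - X e 0 * (X h 0 * x) = 2 *\<^sub>C (X e 0 * x)" for x
        using X_mult[of h 0 e 0] lie(1) by (simp add: distrib_right X_scale mult_scaleC_left flip: mult.assoc)
      show "X h 0 * ?u - (\<chi> h - 2 * of_nat ?k) *\<^sub>C ?u \<in> J" using wh by (simp add: weight_def)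
      show "X e 0 * (X f 0 * ?u) \<in> J" using q(2) by (intro left_ideal_mult[OF left_ideal_J, of "X f 0 * _"]) (simp add: mult.assoc)
      show "(\<chi> h - 2 * of_nat ?k) + of_nat j \<noteq> 0" if "j < Suc ?k" for j
      proof
        assume "(\<chi> h - 2 * of_nat ?k) + of_nat j = 0"
        then have "\<chi> h = of_nat (2 * ?k - j)" using that by (simp add: of_nat_diff algebra_simps)
        then have "norm (\<chi> h) = of_nat (2 * ?k - j)" by (simp only: norm_of_nat)
        then have "2 * ?k - j < k" using k by (simp only: of_nat_less_iff)
        moreover have "k + q \<le> 2 * ?k - j" using diff_le_mono2[of j ?k "2 * ?k"] that by simp
        ultimately show False by simp
      qed
      \<comment> \<open>One raising step more than the k + q lowering steps would give a
        rho-eigenvalue above \<chi>(rho), which \<open>weight_bounded\<close> excludes.\<close>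
      have "weight rho (\<chi> rho + of_nat p) (X e 0 ^ Suc ?k * ?u)"
        using weight_power[OF wr lie(3), of "Suc ?k" 0] by (simp add: algebra_simps p)
      then have "X e 0 ^ Suc ?k * ?u \<in> J"
      proof (rule weight_bounded)
        fix m :: nat
        show "\<chi> rho + of_nat p \<noteq> \<chi> rho - of_nat m"
        proof
          assume "\<chi> rho + of_nat p = \<chi> rho - of_nat m"
          then have "(of_nat (p + m) :: complex) = 0" by (simp add: algebra_simps)
          with p0 show False by (simp only: of_nat_eq_0_iff)
        qed
      qed
      then show "((*) (X e 0) ^^ Suc ?k) ?u \<in> J" by (simp only: pow)
    qed (auto intro: left_ideal_mult[OF left_ideal_J])
    with q(1) show False ..
  qed
  then show ?thesis unfolding nilpotent_at_def f_def by (intro exI[of _ k]) simp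
qed

end

section \<open>The extended Cartan subalgebra and the weight decomposition of W(\<lambda>)\<close>

definition loop_part :: "'g::complex_lie_algebra ext_loop \<Rightarrow> 'g"
  where "loop_part y = Poly_Mapping.lookup (fst (Rep_ext_loop y)) 0"

definition d_part :: "'g::complex_lie_algebra ext_loop \<Rightarrow> complex"
  where "d_part y = snd (Rep_ext_loop y)"

lemma loop_part_add: "loop_part (x + y) = loop_part x + loop_part y"
  and d_part_add: "d_part (x + y) = d_part x + d_part y"
  and loop_part_scaleC: "loop_part (c *\<^sub>C x) = c *\<^sub>C loop_part x"
  and d_part_scaleC: "d_part (c *\<^sub>C x) = c * d_part x"
  unfolding loop_part_def d_part_def
  by (transfer; simp add: case_prod_beta lookup_add)+

lemma loop_part_elt: "loop_part (ext_elt h 0) = h" and d_part_elt: "d_part (ext_elt h 0) = 0"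
  and loop_part_deg_d: "loop_part deg_d = 0" and d_part_deg_d: "d_part deg_d = 1"
  unfolding loop_part_def d_part_def by (transfer; simp add: loop_elt_def)+

context cartan_setting
begin

abbreviation "He \<equiv> ext_cartan D"

lemma ext_cartan_iff: "y \<in> He \<longleftrightarrow> loop_part y \<in> H \<and> y = ext_elt (loop_part y) 0 + d_part y *\<^sub>C deg_d"
  by (auto simp: ext_cartan_def loop_part_add loop_part_elt loop_part_scaleC loop_part_deg_d
      d_part_add d_part_elt d_part_scaleC d_part_deg_d)

lemma subspace_ext_cartan: "csubspace He"
proof (rule csubspaceI)
  have "(0 :: 'g ext_loop) = ext_elt 0 0 + 0 *\<^sub>C deg_d"
    using ext_elt_scaleC[of 0 0 0] by simp
  then show "0 \<in> He" unfolding ext_cartan_def using csubspace_0[OF subspace_H] by blast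
next
  fix x y assume "x \<in> He" "y \<in> He"
  then obtain g h b c where "g \<in> H" "h \<in> H" "x = ext_elt g 0 + b *\<^sub>C deg_d" "y = ext_elt h 0 + c *\<^sub>C deg_d"
    unfolding ext_cartan_def by blast
  then have "x + y = ext_elt (g + h) 0 + (b + c) *\<^sub>C deg_d" "g + h \<in> H"
    using csubspace_add[OF subspace_H] by (simp_all add: ext_elt_add scaleC_add_left)
  then show "x + y \<in> He" unfolding ext_cartan_def by blast
next
  fix a x assume "x \<in> He"
  then obtain h c where "h \<in> H" "x = ext_elt h 0 + c *\<^sub>C deg_d"
    unfolding ext_cartan_def by blast
  then have "a *\<^sub>C x = ext_elt (a *\<^sub>C h) 0 + (a * c) *\<^sub>C deg_d" "a *\<^sub>C h \<in> H"
    using csubspace_scale[OF subspace_H] by (simp_all add: ext_elt_scaleC scaleC_add_right scaleC_scaleC)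
  then show "a *\<^sub>C x \<in> He" unfolding ext_cartan_def by blast
qed

lemma uea_of_ext_cartan: "y \<in> He \<Longrightarrow> uea_of y = ext_gen (loop_part y) 0 + d_part y *\<^sub>C uea_of deg_d"
  unfolding ext_gen_def uea_of_add[symmetric] uea_of_scaleC[symmetric] using ext_cartan_iff by metis

end

locale ext_weyl = cartan_setting D
  for D :: "'g::complex_lie_algebra cartan_data" +
  fixes lam :: "'g ext_loop \<Rightarrow> complex"
  assumes lam: "lam \<in> dual (ext_cartan D)"
begin

definition J :: "'g ext_loop uea set"
  where "J = left_ideal hull (insert (uea_of deg_d - of_complex (lam deg_d)) (weyl_relations D ext_gen lam))"

lemma weyl_module_eq: "weyl_module D lam = quotient_module (*) UNIV J"
  by (simp add: weyl_module_def J_def)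

sublocale R: loop_rep D ext_gen "{uea_of deg_d}"
  by (rule loop_rep_ext)

lemma rel: "r \<in> weyl_relations D ext_gen lam \<Longrightarrow> r \<in> J"
  unfolding J_def by (intro hull_inc) simp

sublocale W: weight_module D ext_gen "{uea_of deg_d}" J "\<lambda>h. lam (ext_elt h 0)"
proof unfold_locales
  show "left_ideal J" unfolding J_def by (rule left_ideal_hull)
  show "ext_gen (xp i) m \<in> J" if "i \<in> I" for i m by (rule rel[OF R.xp_weyl_relations[OF that]])
  show "nilpotent_at J (ext_gen (xm i) 0) 1" if "i \<in> I" for i
    unfolding nilpotent_at_def using rel[OF R.xm_power_weyl_relations[OF that]] by (metis mult.right_neutral)
  show "ext_gen h 0 - of_complex (lam (ext_elt h 0)) \<in> J" if "h \<in> H" for h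
    by (rule rel) (use that in \<open>auto simp: weyl_relations_def\<close>)
  show "\<exists>c. d - of_complex c \<in> J" if "d \<in> {uea_of deg_d}" for d
    using that unfolding J_def by (intro exI[of _ "lam deg_d"] hull_inc) simp
qed

lemma subgroup_J: "additive_subgroup J"
  by (rule left_ideal_additive_subgroup[OF W.left_ideal_J])

text \<open>The preimage of a weight space of W(\<lambda>) in the enveloping algebra.\<close>

definition wt :: "('g ext_loop \<Rightarrow> complex) \<Rightarrow> 'g ext_loop uea set"
  where "wt \<mu> = {v. \<forall>y\<in>He. uea_of y * v - \<mu> y *\<^sub>C v \<in> J}"

lemma subspace_wt: "csubspace (wt \<mu>)"
proof (rule csubspaceI)
  show "0 \<in> wt \<mu>" using csubspace_0[OF W.subspace_J] by (simp add: wt_def)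
next
  fix v w assume "v \<in> wt \<mu>" "w \<in> wt \<mu>"
  then have "(uea_of y * v - \<mu> y *\<^sub>C v) + (uea_of y * w - \<mu> y *\<^sub>C w) \<in> J" if "y \<in> He" for y
    using that unfolding wt_def by (intro csubspace_add[OF W.subspace_J]) auto
  then show "v + w \<in> wt \<mu>" by (simp add: wt_def algebra_simps scaleC_add_right)
next
  fix c v assume "v \<in> wt \<mu>"
  then have "c *\<^sub>C (uea_of y * v - \<mu> y *\<^sub>C v) \<in> J" if "y \<in> He" for y
    using that unfolding wt_def by (intro csubspace_scale[OF W.subspace_J]) auto
  then show "c *\<^sub>C v \<in> wt \<mu>"
    by (simp add: wt_def mult_scaleC_right complex_vector.scale_right_diff_distrib scaleC_scaleC mult.commute)
qed

lemma wt_J: "v \<in> J \<Longrightarrow> v \<in> wt \<mu>"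
  unfolding wt_def
  by (intro CollectI ballI csubspace_diff[OF W.subspace_J] left_ideal_mult[OF W.left_ideal_J]
      csubspace_scale[OF W.subspace_J])

lemma wt_one: "1 \<in> wt lam"
  unfolding wt_def
proof (intro CollectI ballI)
  fix y assume y: "y \<in> He"
  then have h: "loop_part y \<in> H" using ext_cartan_iff by blast
  have e: "ext_elt (loop_part y) 0 \<in> He" "deg_d \<in> He"
    unfolding ext_cartan_iff using h csubspace_0[OF subspace_H] ext_elt_scaleC[of 0 0 0]
    by (simp_all add: loop_part_elt d_part_elt loop_part_deg_d d_part_deg_d scaleC_one)
  have "lam y = lam (ext_elt (loop_part y) 0 + d_part y *\<^sub>C deg_d)" using y ext_cartan_iff by metis
  also have "\<dots> = lam (ext_elt (loop_part y) 0) + d_part y * lam deg_d"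
    using dual_add[OF lam e(1) csubspace_scale[OF subspace_ext_cartan e(2)]] dual_scale[OF lam e(2)] by simp
  finally have l: "lam y = lam (ext_elt (loop_part y) 0) + d_part y * lam deg_d" .
  have 1: "ext_gen (loop_part y) 0 - of_complex (lam (ext_elt (loop_part y) 0)) \<in> J" by (rule W.H_J[OF h])
  have 2: "uea_of deg_d - of_complex (lam deg_d) \<in> J" unfolding J_def by (rule hull_inc) simp
  have "uea_of y * 1 - lam y *\<^sub>C 1 = (ext_gen (loop_part y) 0 - of_complex (lam (ext_elt (loop_part y) 0)))
      + d_part y *\<^sub>C (uea_of deg_d - of_complex (lam deg_d))"
    by (simp add: uea_of_ext_cartan[OF y] l of_complex_def scaleC_add_left complex_vector.scale_right_diff_distrib scaleC_scaleC)
  also have "\<dots> \<in> J"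
    by (intro csubspace_add[OF W.subspace_J] csubspace_scale[OF W.subspace_J] 1 2)
  finally show "uea_of y * 1 - lam y *\<^sub>C 1 \<in> J" .
qed

lemma wt_mult:
  assumes \<mu>: "\<mu> \<in> dual He" "v \<in> wt \<mu>" and \<alpha>: "\<alpha> \<in> dual H" "x \<in> rs \<alpha>"
  shows "\<exists>\<nu>\<in>dual He. ext_gen x m * v \<in> wt \<nu>"
proof
  \<comment> \<open>This is \<mu> + \<alpha> + m \<delta>, where \<delta> is 1 at d and 0 on H,
    extended by 0 as \<open>dual\<close> requires.\<close>
  define \<nu> where "\<nu> y = (if y \<in> He then \<mu> y + (\<alpha> (loop_part y) + of_int m * d_part y) else 0)" for y
  have hp: "loop_part y \<in> H" if "y \<in> He" for y using that ext_cartan_iff by blast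
  show "\<nu> \<in> dual He"
    unfolding dual_def using \<mu>(1) \<alpha>(1)
    by (auto simp: \<nu>_def csubspace_add[OF subspace_ext_cartan] csubspace_scale[OF subspace_ext_cartan]
        loop_part_add d_part_add loop_part_scaleC d_part_scaleC dual_add dual_scale hp algebra_simps)
  show "ext_gen x m * v \<in> wt \<nu>"
    unfolding wt_def
  proof (intro CollectI ballI)
    fix y assume y: "y \<in> He"
    have "lie (loop_part y) x = \<alpha> (loop_part y) *\<^sub>C x" using \<alpha>(2) hp[OF y] by (simp add: root_space_def)
    then have "ext_gen (loop_part y) 0 * ext_gen x m = ext_gen x m * ext_gen (loop_part y) 0 + \<alpha> (loop_part y) *\<^sub>C ext_gen x m"
      using R.X_mult[of "loop_part y" 0 x m] by (simp add: R.X_scale)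
    moreover have "uea_of deg_d * ext_gen x m = ext_gen x m * uea_of deg_d + of_int m *\<^sub>C ext_gen x m"
      using R.Ds[of "uea_of deg_d" x m] by (simp add: commutator_def algebra_simps)
    ultimately have "uea_of y * ext_gen x m = ext_gen x m * uea_of y + (\<alpha> (loop_part y) + of_int m * d_part y) *\<^sub>C ext_gen x m"
      by (simp add: uea_of_ext_cartan[OF y] distrib_left distrib_right mult_scaleC_left mult_scaleC_right scaleC_add_left
          scaleC_add_right scaleC_scaleC mult.commute)
    then have "uea_of y * (ext_gen x m * v) = ext_gen x m * (uea_of y * v) + (\<alpha> (loop_part y) + of_int m * d_part y) *\<^sub>C (ext_gen x m * v)"
      by (simp only: mult.assoc[symmetric] distrib_right mult_scaleC_left)
    then have "uea_of y * (ext_gen x m * v) - \<nu> y *\<^sub>C (ext_gen x m * v) = ext_gen x m * (uea_of y * v - \<mu> y *\<^sub>C v)"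
      using y by (simp add: \<nu>_def scaleC_add_left right_diff_distrib mult_scaleC_right)
    then show "uea_of y * (ext_gen x m * v) - \<nu> y *\<^sub>C (ext_gen x m * v) \<in> J"
      using \<mu>(2) y left_ideal_mult[OF W.left_ideal_J] by (simp add: wt_def)
  qed
qed

text \<open>The generator has weight \<lambda>, and the Lie algebra is spanned by weight vectors by
  \<open>root_sum_UNIV\<close>.\<close>

lemma span_wt: "u \<in> cspan (\<Union>\<mu>\<in>dual He. wt \<mu>)" (is "_ \<in> cspan ?W")
proof (rule R.generated)
  show "1 \<in> cspan ?W" using wt_one lam by (intro cspan_base) blast
next
  fix x m u assume u: "u \<in> cspan ?W"
  have "x \<in> root_sum" by (simp add: root_sum_UNIV)
  then show "ext_gen x m * u \<in> cspan ?W"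
  proof (induction rule: root_sum_weight_induct)
    case (weight \<alpha> x)
    show ?case
    proof (rule clinear_span_induct[OF clinear_mult csubspace_span u])
      fix v assume "v \<in> ?W"
      then obtain \<mu> where \<mu>: "\<mu> \<in> dual He" "v \<in> wt \<mu>" by blast
      show "ext_gen x m * v \<in> cspan ?W"
        using wt_mult[OF \<mu> weight, of m] by (intro cspan_base) blast
    qed
  next
    case subspace
    show ?case
      by (rule csubspaceI)
        (auto simp: R.X_add R.X_scale distrib_right mult_scaleC_left cspan_zero
          intro: cspan_add cspan_scale)
  qed
next
  fix d u :: "'g ext_loop uea" assume d: "d \<in> {uea_of deg_d}" and u: "u \<in> cspan ?W"
  have dHe: "deg_d \<in> He"
    unfolding ext_cartan_iff using csubspace_0[OF subspace_H] ext_elt_scaleC[of 0 0 0]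
    by (simp add: loop_part_deg_d d_part_deg_d scaleC_one)
  show "d * u \<in> cspan ?W"
  proof (rule clinear_span_induct[OF clinear_mult csubspace_span u])
    fix v assume "v \<in> ?W"
    then obtain \<mu> where \<mu>: "\<mu> \<in> dual He" "v \<in> wt \<mu>" by blast
    then have "d * v - \<mu> deg_d *\<^sub>C v \<in> J" using d dHe by (simp add: wt_def)
    then have "(d * v - \<mu> deg_d *\<^sub>C v) + \<mu> deg_d *\<^sub>C v \<in> wt \<mu>"
      by (intro csubspace_add[OF subspace_wt] wt_J csubspace_scale[OF subspace_wt] \<mu>(2))
    then show "d * v \<in> cspan ?W" using \<mu>(1) by (intro cspan_base) auto
  qed
qed (auto intro: cspan_add cspan_scale)

lemma wt_independent:
  assumes "finite F" "F \<subseteq> dual He" "\<And>\<mu>. \<mu> \<in> F \<Longrightarrow> f \<mu> \<in> wt \<mu>" "(\<Sum>\<mu>\<in>F. f \<mu>) \<in> J" "\<mu> \<in> F"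
  shows "f \<mu> \<in> J"
proof (rule weight_vectors_independent_mod[where Y = He and A = "\<lambda>y u. uea_of y * u" and w = "\<lambda>\<mu>. \<mu>" and F = F and v = f])
  fix i j assume "i \<in> F" "j \<in> F" "i \<noteq> j"
  then show "\<exists>y\<in>He. i y \<noteq> j y" using assms(2) dual_outside by (metis subsetD ext)
qed (use assms W.subspace_J left_ideal_mult[OF W.left_ideal_J] in \<open>auto simp: clinear_mult wt_def\<close>)

abbreviation "V \<equiv> weyl_module D lam"
abbreviation "q a \<equiv> (+) a ` J"

lemma carrier_V: "carrier V = range q" and zero_V: "\<zero>\<^bsub>V\<^esub> = q 0"
  unfolding weyl_module_eq by (rule quotient_module_sel[OF subgroup_J])+

lemma smult_V: "r \<odot>\<^bsub>V\<^esub> q a = q (r * a)"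
  unfolding weyl_module_eq by (rule cyclic_module_smult[OF W.left_ideal_J])

lemma q_eq: "q a = q b \<longleftrightarrow> a - b \<in> J"
  by (rule coset_eq_iff[OF subgroup_J])

lemma q_zero: "q a = \<zero>\<^bsub>V\<^esub> \<longleftrightarrow> a \<in> J"
  unfolding zero_V q_eq by simp

lemma weight_space_V: "q a \<in> weight_space D V \<mu> \<longleftrightarrow> a \<in> wt \<mu>"
proof -
  have "q a \<in> carrier V" unfolding carrier_V by (rule rangeI)
  then show ?thesis
    unfolding weight_space_def wt_def mem_Collect_eq smult_V q_eq
    by (simp add: of_complex_def mult_scaleC_left)
qed

lemma finsum_V: "finite F \<Longrightarrow> finsum V (\<lambda>i. q (a i)) F = q (\<Sum>i\<in>F. a i)"
  unfolding weyl_module_eq by (rule finsum_quotient[OF subgroup_J additive_subgroup_UNIV]) auto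

lemma weight_decomposition_V: "weight_decomposition D V"
  unfolding weight_decomposition_def
proof
  fix v assume "v \<in> carrier V"
  then obtain u where u: "v = q u" unfolding carrier_V by blast
  from in_span_UN_subspaces[OF subspace_wt span_wt, of u]
  obtain F f where F: "finite F" "F \<subseteq> dual He" "\<And>\<mu>. f \<mu> \<in> wt \<mu>" "u = (\<Sum>\<mu>\<in>F. f \<mu>)" by auto
  define g where "g \<mu> = (if \<mu> \<in> F then f \<mu> else 0)" for \<mu>
  define S where "S = {\<mu>. q (g \<mu>) \<noteq> \<zero>\<^bsub>V\<^esub>}"
  have 0: "q 0 = \<zero>\<^bsub>V\<^esub>" by (simp only: zero_V)
  have SF: "S \<subseteq> F"
  proof
    fix \<mu> assume "\<mu> \<in> S"
    then show "\<mu> \<in> F" using 0 unfolding S_def g_def by (cases "\<mu> \<in> F") auto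
  qed
  have finS: "finite S" using SF F(1) finite_subset by blast
  have "u = (\<Sum>\<mu>\<in>S. g \<mu>) + (\<Sum>\<mu>\<in>F - S. g \<mu>)"
    using sum.subset_diff[OF SF F(1), of g] F(4) by (simp add: g_def add.commute)
  moreover have "(\<Sum>\<mu>\<in>F - S. g \<mu>) \<in> J"
    by (rule csubspace_sum[OF W.subspace_J]) (simp add: S_def q_zero)
  ultimately have v: "v = finsum V (\<lambda>\<mu>. q (g \<mu>)) S"
    unfolding u finsum_V[OF finS] q_eq by (simp only: add_diff_cancel_left')
  show "\<exists>!f. (\<forall>\<mu>\<in>dual He. f \<mu> \<in> weight_space D V \<mu>) \<and> (\<forall>\<mu>. \<mu> \<notin> dual He \<longrightarrow> f \<mu> = \<zero>\<^bsub>V\<^esub>) \<and>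
    finite {\<mu>. f \<mu> \<noteq> \<zero>\<^bsub>V\<^esub>} \<and> v = finsum V f {\<mu>. f \<mu> \<noteq> \<zero>\<^bsub>V\<^esub>}"
  proof (rule ex1I[of _ "\<lambda>\<mu>. q (g \<mu>)"], intro conjI ballI allI impI)
    fix \<mu>
    show "q (g \<mu>) \<in> weight_space D V \<mu>"
      unfolding weight_space_V g_def using F(3) csubspace_0[OF subspace_wt] by simp
    assume "\<mu> \<notin> dual He"
    then have "g \<mu> = 0" using F(2) by (auto simp: g_def)
    then show "q (g \<mu>) = \<zero>\<^bsub>V\<^esub>" by (simp only: 0)
  next
    show "finite {\<mu>. q (g \<mu>) \<noteq> \<zero>\<^bsub>V\<^esub>}" using finS by (simp only: S_def)
    show "v = finsum V (\<lambda>\<mu>. q (g \<mu>)) {\<mu>. q (g \<mu>) \<noteq> \<zero>\<^bsub>V\<^esub>}" using v by (simp only: S_def)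
  next
    fix k
    assume k: "(\<forall>\<mu>\<in>dual He. k \<mu> \<in> weight_space D V \<mu>) \<and> (\<forall>\<mu>. \<mu> \<notin> dual He \<longrightarrow> k \<mu> = \<zero>\<^bsub>V\<^esub>) \<and>
      finite {\<mu>. k \<mu> \<noteq> \<zero>\<^bsub>V\<^esub>} \<and> v = finsum V k {\<mu>. k \<mu> \<noteq> \<zero>\<^bsub>V\<^esub>}"
    let ?S = "{\<mu>. k \<mu> \<noteq> \<zero>\<^bsub>V\<^esub>}"
    \<comment> \<open>Representatives are chosen to be 0 off the support of k, so that both sums can
      be taken over the union of F and this support.\<close>
    have "\<exists>a. k \<mu> = q a \<and> (\<mu> \<notin> ?S \<longrightarrow> a = 0)" for \<mu>
    proof (cases "\<mu> \<in> ?S")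
      case True
      then have "k \<mu> \<in> carrier V" using k by (cases "\<mu> \<in> dual He") (auto simp: weight_space_def)
      then show ?thesis using True unfolding carrier_V by blast
    next
      case False
      then show ?thesis using 0 by (intro exI[of _ 0]) simp
    qed
    then obtain a where a: "\<And>\<mu>. k \<mu> = q (a \<mu>)" "\<And>\<mu>. \<mu> \<notin> ?S \<Longrightarrow> a \<mu> = 0" by metis
    have S_dual: "?S \<subseteq> dual He" using k by blast
    have finS': "finite ?S" using k by blast
    have keq: "k = (\<lambda>\<mu>. q (a \<mu>))" using a(1) by (rule ext)
    have "v = q (\<Sum>\<mu>\<in>?S. a \<mu>)"
    proof -
      have "v = finsum V k ?S" using k by blast
      also have "\<dots> = finsum V (\<lambda>\<mu>. q (a \<mu>)) ?S" by (subst (1) keq) (rule refl)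
      finally show ?thesis by (simp only: finsum_V[OF finS'])
    qed
    also have "(\<Sum>\<mu>\<in>?S. a \<mu>) = (\<Sum>\<mu>\<in>F \<union> ?S. a \<mu>)"
      using F(1) finS' a(2) by (intro sum.mono_neutral_left) auto
    finally have "u - (\<Sum>\<mu>\<in>F \<union> ?S. a \<mu>) \<in> J" by (simp only: u q_eq)
    moreover have "u = (\<Sum>\<mu>\<in>F \<union> ?S. g \<mu>)"
      unfolding F(4) using F(1) finS' by (intro sum.mono_neutral_cong_left) (auto simp: g_def)
    \<comment> \<open>The two decompositions differ by weight vectors with sum in J, each of which
      then lies in J by \<open>wt_independent\<close>.\<close>
    ultimately have sumJ: "(\<Sum>\<mu>\<in>F \<union> ?S. g \<mu> - a \<mu>) \<in> J" by (simp only: sum_subtractf)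
    have awt: "a \<mu> \<in> wt \<mu>" if "\<mu> \<in> dual He" for \<mu> using k that by (simp only: a(1) weight_space_V)
    have "g \<mu> - a \<mu> \<in> J" for \<mu>
    proof (cases "\<mu> \<in> F \<union> ?S")
      case True
      show ?thesis
      proof (rule wt_independent[OF _ _ _ sumJ True])
        show "F \<union> ?S \<subseteq> dual He" using F(2) S_dual by blast
        then show "g \<nu> - a \<nu> \<in> wt \<nu>" if "\<nu> \<in> F \<union> ?S" for \<nu>
          using awt that F(3) csubspace_0[OF subspace_wt]
          by (intro csubspace_diff[OF subspace_wt]) (auto simp: g_def)
      qed (use F(1) finS' in blast)
    next
      case False
      then have "g \<mu> - a \<mu> = 0" using a(2) by (simp add: g_def)
      then show ?thesis using csubspace_0[OF W.subspace_J] by simp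
    qed
    then show "k = (\<lambda>\<mu>. q (g \<mu>))"
      unfolding keq by (intro ext) (simp only: q_eq[THEN iffD2, symmetric])
  qed
qed

lemma locally_nilpotent_V: "(\<And>u. nilpotent_at J x u) \<Longrightarrow> locally_nilpotent V x"
  unfolding locally_nilpotent_def nilpotent_at_def carrier_V by (auto simp: smult_V q_zero simp del: image_add_0)

lemma integrable_V: "integrable D V"
  unfolding integrable_def
proof (intro conjI ballI weight_decomposition_V)
  show "left_module V" unfolding weyl_module_eq by (rule left_module_cyclic[OF W.left_ideal_J])
  show "locally_nilpotent V (uea_of (ext_elt (xp i) 0))" if "i \<in> I" for i
    using W.nilpotent_xp[OF that] by (intro locally_nilpotent_V) (simp add: ext_gen_def)
  show "locally_nilpotent V (uea_of (ext_elt (xm i) 0))" if "i \<in> I" for i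
    using W.nilpotent_xm[OF that] by (intro locally_nilpotent_V) (simp add: ext_gen_def)
  let ?\<theta> = "highest_root D"
  note t = triple_positive[OF highest_root_positive]
  have "nilpotent_at J (ext_gen (xminus D ?\<theta>) 1) u" for u
    using ad_nilpotent_root[OF positive_roots_neg[OF highest_root_positive] tripleD(3)[OF t]]
      W.nilpotent_lowering[OF highest_root_positive] by (rule W.nilpotent_at_of_1)
  then show "locally_nilpotent V (uea_of (ext_elt (xminus D ?\<theta>) 1))"
    by (intro locally_nilpotent_V) (simp add: ext_gen_def)
  \<comment> \<open>The root vector lies in \<open>npos\<close>, which kills the generator in every
    degree of t.\<close>
  have "nilpotent_at J (ext_gen (xplus D ?\<theta>) (- 1)) 1"
    using root_vectors_generated[OF highest_root_positive] by (intro W.nilpotent_at_J W.npos_J) blast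
  with ad_nilpotent_root[OF positive_roots(1)[OF highest_root_positive] tripleD(2)[OF t]]
  have "nilpotent_at J (ext_gen (xplus D ?\<theta>) (- 1)) u" for u by (rule W.nilpotent_at_of_1)
  then show "locally_nilpotent V (uea_of (ext_elt (xplus D ?\<theta>) (- 1)))"
    by (intro locally_nilpotent_V) (simp add: ext_gen_def)
qed

end

theorem theorem1:
  fixes D :: "'g::complex_lie_algebra cartan_data"
  assumes "finite_dimensional_lie TYPE('g)"
    and "simple_lie TYPE('g)"
    and "is_cartan_data D"
  shows "(\<forall>lam\<in>dominant_weights D. integrable D (weyl_module D lam)) \<and>
    (\<forall>(\<pi> :: nat \<Rightarrow> complex poly). \<forall>lam\<in>dominant_weights D.
      (\<forall>i\<in>index_set D. coeff (\<pi> i) 0 = 1) \<longrightarrow>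
      (\<forall>i\<in>index_set D. lam (ext_elt (simple_coroot D i) 0) = of_nat (degree (\<pi> i))) \<longrightarrow>
      left_module (weyl_module_pi D lam \<pi>) \<and> finite_dimensional_module (weyl_module_pi D lam \<pi>))"
proof -
  interpret cartan_setting D using assms by unfold_locales
  have "integrable D (weyl_module D lam)" if "lam \<in> dominant_weights D" for lam
  proof -
    interpret ext_weyl D lam using that by unfold_locales (simp add: dominant_weights_def)
    show ?thesis by (rule integrable_V)
  qed
  then show ?thesis using finite_dimensional_weyl_module_pi by blast
qed

end
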